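(* For every constant $C>0$ there exist constants $c_1>c_3>c_2>0$ with $\frac{c_3}{c_1}<\frac{8}{(\sqrt2+1)^2}-1$ and a constant $A>0$, all depending only on $C$, such that for all $S$ and all $n\ge2$ with $\ln n\le C\ln S$, the estimator $\hat L^{(2)}$ (defined in the context with these $c_1,c_2,c_3$) satisfies $$\sup_{P,Q\in\mathcal{M}_S}\mathbb{E}\big|\hat L^{(2)}-\|P-Q\|_1\big|^2\le A\,\frac{S}{n\ln n}.$$
   Context: $\mathcal{M}_S$ is the set of probability vectors on $\{1,\dots,S\}$; $\|P-Q\|_1=\sum_i|p_i-q_i|$; $a\wedge b=\min\{a,b\}$, $a\vee b=\max\{a,b\}$; logarithms are natural. Both $P=(p_i)$ and $Q=(q_i)$ are unknown. Observations (Poisson sampling, after splitting each sample into two halves and renaming $n/2$ as $n$): mutually independent $\hat p_{i,j},\hat q_{i,j}$, $1\le i\le S$, $j=1,2$, with $n\hat p_{i,j}\sim\mathrm{Poi}(np_i)$, $n\hat q_{i,j}\sim\mathrm{Poi}(nq_i)$. Construction of $\hat L^{(2)}$. Let $K=c_2\ln n$, and let $\mathrm{poly}_K^d$ be the set of polynomials in $d$ variables of degree at most $K$ in each variable. (a) Let $u_K,v_K\in\mathrm{poly}_K^2$ be best uniform approximations on $[0,1]^2$ (minimizers of the sup-norm error over $\mathrm{poly}_K^2$) of $\sqrt x+\sqrt y$ and of $|\sqrt x-\sqrt y|$ respectively. Put $h_{2K}(x,y)=u_K(x,y)v_K(x,y)-u_K(0,0)v_K(0,0)$ and $$P_K^{(1)}(x,y)=\frac{2c_1\ln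 n}{n}\,h_{2K}\!\left(\frac{xn}{2c_1\ln n},\frac{yn}{2c_1\ln n}\right).$$ (b) Let $R_K(t)=\sum_{j=0}^{K}r_jt^j$ be the best uniform approximation of $|t|$ on $[-1,1]$ by polynomials of degree at most $K$, and for $a,b\ge0$ put $$P_K^{(2)}(x,y;a,b)=\sum_{j=0}^{K}r_jW^{-j+1}(x-y)^j,\qquad W=\sqrt{\frac{8c_1\ln n}{n}}\sqrt{(a+b)\vee\frac1n}.$$ (c) Let $\tilde P_K^{(1)}(\hat p,\hat q)$ and $\tilde P_K^{(2)}(\hat p,\hat q;a,b)$ be the unbiased estimators of $P_K^{(1)}(p,q)$ and $P_K^{(2)}(p,q;a,b)$ based on independent $n\hat p\sim\mathrm{Poi}(np)$, $n\hat q\sim\mathrm{Poi}(nq)$ (with $a,b$ fixed), obtained by replacing each monomial $x^ry^s$ by $\prod_{i=0}^{r-1}(\hat p-\frac in)\prod_{j=0}^{s-1}(\hat q-\frac jn)$. (d) Let $U_1=\{(p,q):|p-q|\le\sqrt{\frac{(c_1+c_3)\ln n}{n}}(\sqrt p+\sqrt q)\}$ and $\tau=\sqrt{\frac{(c_1+c_3)\ln n}{n}}$. Define $$\begin{aligned}\tilde L_2=\sum_{i=1}^S\Big[&(\hat p_{i,2}-\hat q_{i,2})\mathbf 1\big(\hat p_{i,1}-\hat q_{i,1}>\tau(\sqrt{\hat p_{i,1}}+\sqrt{\hat q_{i,1}})\big)\\&+(\hat q_{i,2}-\hat p_{i,2})\mathbf 1\big(\hat p_{i,1}-\hat q_{i,1}<-\tau(\sqrt{\hat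 p_{i,1}}+\sqrt{\hat q_{i,1}})\big)\\&+\tilde P_K^{(1)}(\hat p_{i,2},\hat q_{i,2})\mathbf 1\big(\hat p_{i,1}+\hat q_{i,1}<\tfrac{c_1\ln n}{n}\big)\\&+\tilde P_K^{(2)}(\hat p_{i,2},\hat q_{i,2};\hat p_{i,1},\hat q_{i,1})\mathbf 1\big((\hat p_{i,1},\hat q_{i,1})\in U_1,\ \hat p_{i,1}+\hat q_{i,1}\ge\tfrac{c_1\ln n}{n}\big)\Big],\end{aligned}$$ $$\hat L^{(2)}=0\vee(\tilde L_2\wedge2).$$ *)

theory Defs
  imports "HOL-Probability.Probability" "HOL-Computational_Algebra.Polynomial"
begin


text \<open>Vectors indexed by \<open>{1..S}\<close> are functions on \<^typ>\<open>nat\<close> whose values outside \<open>{1..S}\<close>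
  are never used.\<close>

definition prob_vectors :: "nat \<Rightarrow> (nat \<Rightarrow> real) set" where
  "prob_vectors S = {p. (\<forall>i\<in>{1..S}. 0 \<le> p i) \<and> (\<Sum>i=1..S. p i) = 1}"

definition l1_dist :: "nat \<Rightarrow> (nat \<Rightarrow> real) \<Rightarrow> (nat \<Rightarrow> real) \<Rightarrow> real" where
  "l1_dist S P Q = (\<Sum>i=1..S. \<bar>P i - Q i\<bar>)"

text \<open>The library's \<^const>\<open>poisson_pmf\<close> is specified only for positive rates; the Poisson law
  with rate 0 is the point mass at 0.\<close>

definition Poi :: "real \<Rightarrow> nat pmf" where
  "Poi l = (if 0 < l then poisson_pmf l else return_pmf 0)"

text \<open>Joint law of the independent counts \<open>(X, Y)\<close>, where \<open>X (i, j) = n * phat i j\<close> and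
  \<open>Y (i, j) = n * qhat i j\<close> for \<open>i \<in> {1..S}\<close> and \<open>j \<in> {1, 2}\<close>. The intensity \<open>n\<close> need not be
  an integer.\<close>

definition sample_pmf ::
  "nat \<Rightarrow> real \<Rightarrow> (nat \<Rightarrow> real) \<Rightarrow> (nat \<Rightarrow> real) \<Rightarrow> ((nat \<times> nat \<Rightarrow> nat) \<times> (nat \<times> nat \<Rightarrow> nat)) pmf" where
  "sample_pmf S n P Q =
     pair_pmf (Pi_pmf ({1..S} \<times> {1, 2}) 0 (\<lambda>(i, j). Poi (n * P i)))
              (Pi_pmf ({1..S} \<times> {1, 2}) 0 (\<lambda>(i, j). Poi (n * Q i)))"

definition freq :: "real \<Rightarrow> (nat \<times> nat \<Rightarrow> nat) \<Rightarrow> nat \<Rightarrow> nat \<Rightarrow> real" where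
  "freq n X i j = real (X (i, j)) / n"



text \<open>A polynomial in \<open>x\<close> and \<open>y\<close> is a polynomial in \<open>y\<close> with coefficients in \<open>\<real>[x]\<close>: the
  coefficient of \<open>x ^ r * y ^ s\<close> in \<open>f\<close> is \<open>coeff (coeff f s) r\<close>.\<close>

definition eval2 :: "real poly poly \<Rightarrow> real \<Rightarrow> real \<Rightarrow> real" where
  "eval2 f x y = poly (poly f [:y:]) x"

definition X2 :: "real poly poly" where "X2 = [:[:0, 1:]:]"

definition Y2 :: "real poly poly" where "Y2 = [:0, 1:]"

definition const2 :: "real \<Rightarrow> real poly poly" where "const2 c = [:[:c:]:]"

definition poly_space2 :: "nat \<Rightarrow> real poly poly set" where
  "poly_space2 K = {f. degree f \<le> K \<and> (\<forall>s. degree (coeff f s) \<le> K)}"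

text \<open>The real-valued suprema below are meaningful because they are only used for functions
  \<open>g\<close> that are continuous on the compact domain.\<close>

definition sup_err2 :: "(real \<Rightarrow> real \<Rightarrow> real) \<Rightarrow> real poly poly \<Rightarrow> real" where
  "sup_err2 g f = (SUP (x, y)\<in>{0..1} \<times> {0..1}. \<bar>eval2 f x y - g x y\<bar>)"

definition best_approx2 :: "nat \<Rightarrow> (real \<Rightarrow> real \<Rightarrow> real) \<Rightarrow> real poly poly \<Rightarrow> bool" where
  "best_approx2 K g f \<longleftrightarrow>
     f \<in> poly_space2 K \<and> (\<forall>f'\<in>poly_space2 K. sup_err2 g f \<le> sup_err2 g f')"

definition sup_err1 :: "(real \<Rightarrow> real) \<Rightarrow> real poly \<Rightarrow> real" where
  "sup_err1 g f = (SUP t\<in>{-1..1}. \<bar>poly f t - g t\<bar>)"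

definition best_approx1 :: "nat \<Rightarrow> (real \<Rightarrow> real) \<Rightarrow> real poly \<Rightarrow> bool" where
  "best_approx1 K g f \<longleftrightarrow>
     degree f \<le> K \<and> (\<forall>f'. degree f' \<le> K \<longrightarrow> sup_err1 g f \<le> sup_err1 g f')"



definition h_poly :: "real poly poly \<Rightarrow> real poly poly \<Rightarrow> real poly poly" where
  "h_poly u v = u * v - const2 (eval2 u 0 0 * eval2 v 0 0)"

text \<open>\<open>rescale2 B h\<close> is the polynomial \<open>B * h (x / B, y / B)\<close>.\<close>

definition rescale2 :: "real \<Rightarrow> real poly poly \<Rightarrow> real poly poly" where
  "rescale2 B h =
     smult [:B:] (pcompose (map_poly (\<lambda>q. pcompose q [:0, 1 / B:]) h) [:0, [:1 / B:]:])"

lemma eval2_rescale2: "eval2 (rescale2 B h) x y = B * eval2 h (x / B) (y / B)"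
proof -
  have "poly (poly (map_poly (\<lambda>q. pcompose q [:0, 1 / B:]) h) [:y / B:]) x
        = poly (poly h [:y / B:]) (x / B)"
    by (induction h) (simp_all add: map_poly_pCons poly_pcompose)
  then show ?thesis
    by (simp add: eval2_def rescale2_def poly_pcompose)
qed

definition P1_poly :: "real \<Rightarrow> real \<Rightarrow> real poly poly \<Rightarrow> real poly poly \<Rightarrow> real poly poly" where
  "P1_poly c1 n u v = rescale2 (2 * c1 * ln n / n) (h_poly u v)"

definition W_scale :: "real \<Rightarrow> real \<Rightarrow> real \<Rightarrow> real \<Rightarrow> real" where
  "W_scale c1 n a b = sqrt (8 * c1 * ln n / n) * sqrt (max (a + b) (1 / n))"

definition P2_poly :: "real \<Rightarrow> real \<Rightarrow> nat \<Rightarrow> real poly \<Rightarrow> real \<Rightarrow> real \<Rightarrow> real poly poly" where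
  "P2_poly c1 n K R a b =
     (\<Sum>j\<le>K. const2 (coeff R j * W_scale c1 n a b powi (1 - int j)) * (X2 - Y2) ^ j)"

lemma eval2_P2_poly:
  "eval2 (P2_poly c1 n K R a b) x y =
     (\<Sum>j\<le>K. coeff R j * W_scale c1 n a b powi (1 - int j) * (x - y) ^ j)"
  by (simp add: eval2_def P2_poly_def const2_def X2_def Y2_def poly_sum)

text \<open>Replace each monomial \<open>x ^ r * y ^ s\<close> by its unbiased estimator under Poisson sampling.\<close>

definition unbiased2 :: "real \<Rightarrow> real poly poly \<Rightarrow> real \<Rightarrow> real \<Rightarrow> real" where
  "unbiased2 n f p q =
     (\<Sum>s\<le>degree f. \<Sum>r\<le>degree (coeff f s).
        coeff (coeff f s) r * (\<Prod>i<r. p - real i / n) * (\<Prod>j<s. q - real j / n))"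

definition tau :: "real \<Rightarrow> real \<Rightarrow> real \<Rightarrow> real" where
  "tau c1 c3 n = sqrt ((c1 + c3) * ln n / n)"

definition U1 :: "real \<Rightarrow> real \<Rightarrow> real \<Rightarrow> (real \<times> real) set" where
  "U1 c1 c3 n = {(p, q). \<bar>p - q\<bar> \<le> sqrt ((c1 + c3) * ln n / n) * (sqrt p + sqrt q)}"

definition L_tilde ::
  "real \<Rightarrow> real \<Rightarrow> real \<Rightarrow> nat \<Rightarrow> real poly poly \<Rightarrow> real poly poly \<Rightarrow> real poly \<Rightarrow> nat
    \<Rightarrow> (nat \<Rightarrow> nat \<Rightarrow> real) \<Rightarrow> (nat \<Rightarrow> nat \<Rightarrow> real) \<Rightarrow> real" where
  "L_tilde c1 c3 n K u v R S phat qhat =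
     (\<Sum>i=1..S.
        (phat i 2 - qhat i 2) *
          of_bool (phat i 1 - qhat i 1 > tau c1 c3 n * (sqrt (phat i 1) + sqrt (qhat i 1)))
      + (qhat i 2 - phat i 2) *
          of_bool (phat i 1 - qhat i 1 < - tau c1 c3 n * (sqrt (phat i 1) + sqrt (qhat i 1)))
      + unbiased2 n (P1_poly c1 n u v) (phat i 2) (qhat i 2) *
          of_bool (phat i 1 + qhat i 1 < c1 * ln n / n)
      + unbiased2 n (P2_poly c1 n K R (phat i 1) (qhat i 1)) (phat i 2) (qhat i 2) *
          of_bool ((phat i 1, qhat i 1) \<in> U1 c1 c3 n \<and> phat i 1 + qhat i 1 \<ge> c1 * ln n / n))"

definition L_hat ::
  "real \<Rightarrow> real \<Rightarrow> real \<Rightarrow> nat \<Rightarrow> real poly poly \<Rightarrow> real poly poly \<Rightarrow> real poly \<Rightarrow> nat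
    \<Rightarrow> (nat \<Rightarrow> nat \<Rightarrow> real) \<Rightarrow> (nat \<Rightarrow> nat \<Rightarrow> real) \<Rightarrow> real" where
  "L_hat c1 c3 n K u v R S phat qhat = max 0 (min (L_tilde c1 c3 n K u v R S phat qhat) 2)"

text \<open>Degrees are integers, so a degree bound by \<open>c\<^sub>2 * ln n\<close> is a bound by its integer part.\<close>

definition deg_bound :: "real \<Rightarrow> real \<Rightarrow> nat" where
  "deg_bound c2 n = nat \<lfloor>c2 * ln n\<rfloor>"

end

theory Submission
  imports Defs
begin

text \<open>
  Every symbol contributes \<open>\<bar>p - q\<bar>\<close> to the distance. The first halves of the samples decide how this
  contribution is estimated, and the second halves, which are independent of them, provide the
  estimate. The risk is therefore analysed for fixed first halves. By a Chernoff bound in Hellinger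
  form (\<open>Poi_sqrt_concentration\<close>) the first-half frequencies \<open>a\<close> and \<open>b\<close> of all symbols, with
  probabilities \<open>p\<close> and \<open>q\<close>, satisfy \<open>\<bar>sqrt a - sqrt p\<bar> \<le> sqrt (2 * ln n / n)\<close> and the same for \<open>b\<close> and \<open>q\<close>,
  outside an event of probability at most \<open>4 * S / n\<^sup>2\<close>, on which the truncation to \<open>[0, 2]\<close> bounds the
  loss. Otherwise the decision is correct in the following sense.

  If the frequencies differ clearly, \<open>p - q\<close> has the sign that is observed, and the plain difference of
  the frequencies is unbiased with variance \<open>(p + q) / n\<close>. If \<open>a + b\<close> is small, then \<open>p\<close> and \<open>q\<close> are at most of the
  order of \<open>B = ln n / n\<close>, and \<open>\<bar>p - q\<bar>\<close> is replaced by a polynomial in \<open>p / B\<close> and \<open>q / B\<close>. In the remaining case \<open>p - q\<close> is at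
  most of the order of \<open>W = sqrt (ln n / n * (p + q))\<close>, and \<open>\<bar>p - q\<bar>\<close> is replaced by a polynomial in \<open>(p - q) / W\<close>.

  The bias of the two polynomial estimators is the error of approximation. A polynomial of degree \<open>K\<close>
  approximates \<open>\<bar>t\<bar>\<close> on \<open>[-1, 1]\<close> up to order \<open>1 / K\<close> (\<open>abs_poly_error\<close>), and the identity
  \<open>\<bar>s - t\<bar> = \<bar>s + t\<bar> + \<bar>s - t\<bar> - s - t\<close> for \<open>s, t \<ge> 0\<close> transfers this to \<open>\<bar>sqrt x - sqrt y\<bar>\<close>. For
  \<open>K\<close> of the order of \<open>ln n\<close> the bias of a symbol is of order \<open>sqrt ((p + q) / (n * ln n)) + 1 / (n * ln n)\<close>, and the sum
  over all symbols is of the desired order.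

  The variance is controlled by second moments (\<open>ff_moment_bound\<close>) and by bounds on the coefficients of
  bounded polynomials (\<open>coeff_bound_unit_interval\<close>). Both lose only a factor that is exponential in \<open>K\<close>, which is
  an arbitrarily small power of \<open>n\<close> if \<open>K = c2 * ln n\<close> with a small \<open>c2\<close>. The lower bound on \<open>S\<close> in terms of \<open>n\<close>
  absorbs this power. Variances add up by independence across symbols (\<open>Pi_pmf_bias_variance\<close>), and the pieces
  are put together in \<open>L_hat_risk\<close> and \<open>risk_bound_rate\<close>.
\<close>

section \<open>Moments and concentration of Poisson counts\<close>

lemma pmf_Poi: "0 \<le> l \<Longrightarrow> pmf (Poi l) k = l ^ k / fact k * exp (- l)"
  by (cases "l = 0"; cases k) (auto simp: Poi_def)

lemma nn_integral_Poi:
  "(\<integral>\<^sup>+k. f k \<partial>measure_pmf (Poi l)) = (\<Sum>k. ennreal (pmf (Poi l) k) * f k)"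
  by (simp add: nn_integral_measure_pmf nn_integral_count_space_nat)

text \<open>Since \<open>k * l ^ k / k! = l * l ^ (k - 1) / (k - 1)!\<close>, a factor \<open>k\<close> under the Poisson integral can be
  traded for the factor \<open>l\<close> and a shift of the argument. All polynomial moments below come from
  this identity.\<close>

lemma nn_integral_Poi_shift:
  assumes "0 \<le> l"
  shows "(\<integral>\<^sup>+k. of_nat k * f k \<partial>measure_pmf (Poi l)) = ennreal l * (\<integral>\<^sup>+k. f (Suc k) \<partial>measure_pmf (Poi l))"
proof -
  have eq: "ennreal (pmf (Poi l) (Suc k)) * of_nat (Suc k) = ennreal l * ennreal (pmf (Poi l) k)" for k
  proof -
    have "pmf (Poi l) (Suc k) * real (Suc k) = l * pmf (Poi l) k"
      using assms by (simp add: pmf_Poi field_simps del: of_nat_Suc)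
    then show ?thesis
      using assms by (simp only: ennreal_of_nat_eq_real_of_nat flip: ennreal_mult' ennreal_mult'')
  qed
  have "(\<Sum>k. ennreal (pmf (Poi l) k) * (of_nat k * f k))
      = (\<Sum>k. ennreal (pmf (Poi l) (k + 1)) * (of_nat (k + 1) * f (k + 1)))"
    by (subst suminf_offset[where i = 1]) auto
  also have "\<dots> = (\<Sum>k. ennreal l * (ennreal (pmf (Poi l) k) * f (Suc k)))"
    by (intro suminf_cong) (metis eq mult.assoc Suc_eq_plus1)
  finally show ?thesis
    by (simp add: nn_integral_Poi)
qed

lemma nn_integral_Poi_power: 
  assumes "0 \<le> l" "c \<ge> 0"
  shows "(\<integral>\<^sup>+k. ennreal ((c + real k) ^ m) \<partial>measure_pmf (Poi l)) < \<infinity>"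
  using assms(2)
proof (induction m arbitrary: c)
  case (Suc m)
  have "(\<integral>\<^sup>+k. ennreal ((c + real k) ^ Suc m) \<partial>measure_pmf (Poi l))
     = (\<integral>\<^sup>+k. ennreal c * ennreal ((c + real k) ^ m) + of_nat k * ennreal ((c + real k) ^ m) \<partial>measure_pmf (Poi l))"
    using Suc.prems
    by (intro nn_integral_cong) 
       (simp add: ennreal_of_nat_eq_real_of_nat distrib_right flip: ennreal_mult ennreal_plus)
  also have "\<dots> = ennreal c * (\<integral>\<^sup>+k. ennreal ((c + real k) ^ m) \<partial>measure_pmf (Poi l))
       + ennreal l * (\<integral>\<^sup>+k. ennreal ((c + 1 + real k) ^ m) \<partial>measure_pmf (Poi l))"
    by (subst nn_integral_add) (auto simp: nn_integral_cmult nn_integral_Poi_shift[OF assms(1)] add_ac)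
  also have "\<dots> < \<infinity>"
    using Suc.IH[of c] Suc.IH[of "c + 1"] Suc.prems by (auto simp: ennreal_mult_less_top)
  finally show ?case .
qed auto

lemma nn_integral_Poi_exp:
  assumes "0 \<le> l" "0 \<le> th"
  shows "(\<integral>\<^sup>+k. ennreal (th ^ k) \<partial>measure_pmf (Poi l)) = ennreal (exp (l * (th - 1)))"
proof -
  have "(\<lambda>k. (th * l) ^ k /\<^sub>R fact k * exp (- l)) sums (exp (th * l) * exp (- l))"
    by (intro sums_mult2 exp_converges)
  moreover have "(th * l) ^ k /\<^sub>R fact k * exp (- l) = pmf (Poi l) k * th ^ k" for k
    using assms by (simp add: pmf_Poi power_mult_distrib field_simps)
  ultimately have "(\<lambda>k. pmf (Poi l) k * th ^ k) sums (exp (th * l) * exp (- l))"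
    by simp
  also have "exp (th * l) * exp (- l) = exp (l * (th - 1))"
    by (simp add: algebra_simps flip: exp_add)
  finally have "(\<lambda>k. pmf (Poi l) k * th ^ k) sums exp (l * (th - 1))" .
  then have "(\<lambda>k. ennreal (pmf (Poi l) k * th ^ k)) sums ennreal (exp (l * (th - 1)))"
    using assms by (subst sums_ennreal) auto
  then show ?thesis
    using assms by (simp add: nn_integral_Poi ennreal_mult' sums_iff)
qed

text \<open>The right-hand side is the Kullback-Leibler divergence of the Poisson laws with rates \<open>x\<close> and \<open>l\<close>, which is
  the exponent in the Chernoff bound. The inequality is \<open>ln y \<le> y - 1\<close> at \<open>y = sqrt (l / x)\<close>.\<close>

lemma Poi_hellinger_KL:
  fixes x l :: real
  assumes "x > 0" "l > 0"
  shows "(sqrt x - sqrt l)\<^sup>2 \<le> x * ln (x / l) - x + l"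
proof -
  have "ln (sqrt (l / x)) \<le> sqrt (l / x) - 1"
    using assms by (intro ln_le_minus_one) auto
  then have "2 * x * (1 - sqrt (l / x)) \<le> - 2 * x * ln (sqrt (l / x))"
    using assms mult_left_mono[of "ln (sqrt (l / x))" "sqrt (l / x) - 1" x] by (simp add: algebra_simps)
  also have "\<dots> = x * ln (x / l)"
    using assms by (simp add: ln_sqrt ln_div field_simps)
  also have "2 * x * (1 - sqrt (l / x)) = 2 * x - 2 * sqrt x * sqrt l"
    using assms by (simp add: real_sqrt_divide field_simps)
  finally show ?thesis
    using assms by (simp add: power2_diff)
qed

text \<open>Both tails at the level \<open>x\<close> are covered at once: the hypothesis on \<open>A\<close> says that \<open>k\<close> lies on the far
  side of \<open>x\<close> as seen from \<open>l\<close>, and in either case \<open>(x / l) ^ (k - x) \<ge> 1\<close>, so that the expectation of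
  this power bounds the probability. Its base is the optimal one of the Chernoff method.\<close>

lemma Poi_chernoff:
  fixes x l :: real
  assumes "x > 0" "l > 0" and A: "\<And>k. k \<in> A \<Longrightarrow> l \<le> x \<and> x \<le> real k \<or> x \<le> l \<and> real k \<le> x"
  shows "measure_pmf.prob (Poi l) A \<le> exp (- (sqrt x - sqrt l)\<^sup>2)"
proof -
  let ?c = "(x / l) powr (- x)"
  have ind: "indicator A k \<le> ennreal ?c * ennreal ((x / l) ^ k)" for k
  proof (cases "k \<in> A")
    case True
    have "?c * (x / l) ^ k = (x / l) powr (real k - x)"
      using assms by (simp add: powr_diff powr_minus powr_realpow field_simps)
    also have "1 \<le> \<dots>"
      using A[OF \<open>k \<in> A\<close>]
    proof
      assume "l \<le> x \<and> x \<le> real k"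
      then show ?thesis
        using assms(1,2) by (intro ge_one_powr_ge_zero) (auto simp: field_simps)
    next
      assume "x \<le> l \<and> real k \<le> x"
      then show ?thesis
        using assms(1,2) powr_mono'[of "real k - x" 0 "x / l"] by auto
    qed
    finally show ?thesis
      using True by (simp flip: ennreal_mult' ennreal_1)
  qed auto
  have "ennreal (measure_pmf.prob (Poi l) A) = (\<integral>\<^sup>+k. indicator A k \<partial>measure_pmf (Poi l))"
    by (simp add: measure_pmf.emeasure_eq_measure)
  also have "\<dots> \<le> (\<integral>\<^sup>+k. ennreal ?c * ennreal ((x / l) ^ k) \<partial>measure_pmf (Poi l))"
    by (intro nn_integral_mono ind)
  also have "\<dots> = ennreal (?c * exp (l * (x / l - 1)))"
    using assms by (subst nn_integral_cmult) (auto simp: nn_integral_Poi_exp ennreal_mult')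
  also have "?c * exp (l * (x / l - 1)) = exp (- (x * ln (x / l) - x + l))"
    using assms by (simp add: powr_def right_diff_distrib flip: exp_add)
  also have "ennreal \<dots> \<le> ennreal (exp (- (sqrt x - sqrt l)\<^sup>2))"
    using Poi_hellinger_KL[OF assms(1,2)] by simp
  finally show ?thesis
    by (simp)
qed

text \<open>The square root stabilises the variance of a Poisson count: on the scale of square roots the tails
  are Gaussian with a width that is independent of the rate.\<close>

lemma Poi_sqrt_concentration:
  fixes l t :: real
  assumes "l \<ge> 0" "t > 0"
  shows "measure_pmf.prob (Poi l) {k. \<bar>sqrt (real k) - sqrt l\<bar> > t} \<le> 2 * exp (- t\<^sup>2)"
proof (cases "l = 0")
  case True
  then show ?thesis
    using assms by (simp add: Poi_def measure_return_pmf)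
next
  case False
  let ?U = "{k::nat. sqrt (real k) - sqrt l > t}" and ?D = "{k::nat. sqrt l - sqrt (real k) > t}"
  have U: "measure_pmf.prob (Poi l) ?U \<le> exp (- t\<^sup>2)"
  proof -
    have "measure_pmf.prob (Poi l) ?U \<le> exp (- (sqrt ((sqrt l + t)\<^sup>2) - sqrt l)\<^sup>2)"
    proof (rule Poi_chernoff)
      fix k :: nat assume "k \<in> ?U"
      then have "sqrt l + t \<le> sqrt (real k)" "0 \<le> sqrt l + t" using assms by auto
      then have "(sqrt l + t)\<^sup>2 \<le> real k" by (metis power_mono of_nat_0_le_iff real_sqrt_pow2)
      moreover have "(sqrt l)\<^sup>2 \<le> (sqrt l + t)\<^sup>2" using assms by (intro power_mono) auto
      ultimately show "l \<le> (sqrt l + t)\<^sup>2 \<and> (sqrt l + t)\<^sup>2 \<le> real k \<or> (sqrt l + t)\<^sup>2 \<le> l \<and> real k \<le> (sqrt l + t)\<^sup>2"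
        using assms by auto
    qed (use assms False in \<open>auto simp: add_nonneg_pos zero_less_power2 add_nonneg_eq_0_iff\<close>)
    then show ?thesis using assms by simp
  qed
  have D: "measure_pmf.prob (Poi l) ?D \<le> exp (- t\<^sup>2)"
  proof (cases "sqrt l > t")
    case True
    have "measure_pmf.prob (Poi l) ?D \<le> exp (- (sqrt ((sqrt l - t)\<^sup>2) - sqrt l)\<^sup>2)"
    proof (rule Poi_chernoff)
      fix k :: nat assume "k \<in> ?D"
      then have "(sqrt (real k))\<^sup>2 \<le> (sqrt l - t)\<^sup>2" using assms by (intro power_mono) auto
      moreover have "(sqrt l - t)\<^sup>2 \<le> (sqrt l)\<^sup>2" using assms True by (intro power_mono) auto
      ultimately show "l \<le> (sqrt l - t)\<^sup>2 \<and> (sqrt l - t)\<^sup>2 \<le> real k \<or> (sqrt l - t)\<^sup>2 \<le> l \<and> real k \<le> (sqrt l - t)\<^sup>2"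
        using assms by auto
    qed (use assms False True in \<open>auto simp: zero_less_power2\<close>)
    then show ?thesis using assms True by simp
  next
    case False
    then have "?D = {}" using real_sqrt_ge_zero[of "real _"] by (auto simp: not_less) (smt (verit) real_sqrt_ge_zero of_nat_0_le_iff)
    then show ?thesis by simp
  qed
  have "measure_pmf.prob (Poi l) {k. \<bar>sqrt (real k) - sqrt l\<bar> > t} \<le> measure_pmf.prob (Poi l) (?U \<union> ?D)"
    by (intro measure_pmf.finite_measure_mono) (auto simp: abs_if split: if_splits)
  also have "\<dots> \<le> measure_pmf.prob (Poi l) ?U + measure_pmf.prob (Poi l) ?D"
    by (intro measure_Un_le) auto
  finally show ?thesis using U D by simp
qed

section \<open>Two independent Poisson counts\<close>

abbreviation Poi2 :: "real \<Rightarrow> real \<Rightarrow> (nat \<times> nat) pmf" where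
  "Poi2 l m \<equiv> pair_pmf (Poi l) (Poi m)"

text \<open>Expectations of polynomials in two Poisson counts exist because every power of a Poisson count is
  integrable. This predicate is a sufficient condition for integrability that is closed under sums and
  products.\<close>

definition poly_growth :: "(nat \<Rightarrow> nat \<Rightarrow> real) \<Rightarrow> bool" where
  "poly_growth F \<longleftrightarrow> (\<exists>c k. \<forall>x y. \<bar>F x y\<bar> \<le> c * (1 + real x + real y) ^ k)"

lemma poly_growthI: "(\<And>x y. \<bar>F x y\<bar> \<le> c * (1 + real x + real y) ^ k) \<Longrightarrow> poly_growth F"
  unfolding poly_growth_def by blast

lemma poly_growth_const [intro!, simp]: "poly_growth (\<lambda>x y. c)"
  by (rule poly_growthI[of _ "\<bar>c\<bar>" 0]) auto

lemma poly_growth_fst [intro!, simp]: "poly_growth (\<lambda>x y. real x)"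
  by (rule poly_growthI[of _ 1 1]) auto

lemma poly_growth_snd [intro!, simp]: "poly_growth (\<lambda>x y. real y)"
  by (rule poly_growthI[of _ 1 1]) auto

lemma poly_growth_add [intro!]:
  assumes "poly_growth F" "poly_growth G"
  shows "poly_growth (\<lambda>x y. F x y + G x y)"
proof -
  obtain c k d l where F: "\<bar>F x y\<bar> \<le> c * (1 + real x + real y) ^ k"
    and G: "\<bar>G x y\<bar> \<le> d * (1 + real x + real y) ^ l" for x y
    using assms unfolding poly_growth_def by blast
  show ?thesis
  proof (rule poly_growthI)
    fix x y :: nat
    let ?b = "1 + real x + real y"
    have "\<bar>F x y\<bar> \<le> \<bar>c\<bar> * ?b ^ (k + l)"
      by (rule order.trans[OF F]) (intro mult_mono power_increasing, auto)
    moreover have "\<bar>G x y\<bar> \<le> \<bar>d\<bar> * ?b ^ (k + l)"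
      by (rule order.trans[OF G]) (intro mult_mono power_increasing, auto)
    ultimately show "\<bar>F x y + G x y\<bar> \<le> (\<bar>c\<bar> + \<bar>d\<bar>) * ?b ^ (k + l)"
      by (simp add: distrib_right)
  qed
qed

lemma poly_growth_mult [intro!]:
  assumes "poly_growth F" "poly_growth G"
  shows "poly_growth (\<lambda>x y. F x y * G x y)"
proof -
  obtain c k d l where F: "\<bar>F x y\<bar> \<le> c * (1 + real x + real y) ^ k"
    and G: "\<bar>G x y\<bar> \<le> d * (1 + real x + real y) ^ l" for x y
    using assms unfolding poly_growth_def by blast
  show ?thesis
  proof (rule poly_growthI)
    fix x y :: nat
    have "\<bar>F x y\<bar> * \<bar>G x y\<bar> \<le> (c * (1 + real x + real y) ^ k) * (d * (1 + real x + real y) ^ l)"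
      by (intro mult_mono F G) (use F[of x y] in linarith)+
    then show "\<bar>F x y * G x y\<bar> \<le> (c * d) * (1 + real x + real y) ^ (k + l)"
      by (simp add: abs_mult power_add mult_ac)
  qed
qed

lemma poly_growth_minus [intro!]: "poly_growth F \<Longrightarrow> poly_growth (\<lambda>x y. - F x y)"
  unfolding poly_growth_def by simp

lemma poly_growth_diff [intro!]: 
  "poly_growth F \<Longrightarrow> poly_growth G \<Longrightarrow> poly_growth (\<lambda>x y. F x y - G x y)"
  using poly_growth_add[of F "\<lambda>x y. - G x y"] poly_growth_minus[of G] by simp

lemma poly_growth_power [intro!]: "poly_growth F \<Longrightarrow> poly_growth (\<lambda>x y. F x y ^ k)"
  by (induction k) auto

lemma poly_growth_sum [intro!]:
  "(\<And>i. i \<in> A \<Longrightarrow> poly_growth (F i)) \<Longrightarrow> poly_growth (\<lambda>x y. \<Sum>i\<in>A. F i x y)"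
  by (induction A rule: infinite_finite_induct) auto

lemma poly_growth_prod [intro!]:
  "(\<And>i. i \<in> A \<Longrightarrow> poly_growth (F i)) \<Longrightarrow> poly_growth (\<lambda>x y. \<Prod>i\<in>A. F i x y)"
  by (induction A rule: infinite_finite_induct) auto

lemma poly_growth_integrable:
  assumes "poly_growth F" "0 \<le> l" "0 \<le> m"
  shows "integrable (measure_pmf (Poi2 l m)) (\<lambda>z. F (fst z) (snd z))"
proof -
  obtain c k where F: "\<bar>F x y\<bar> \<le> c * (1 + real x + real y) ^ k" for x y
    using assms(1) unfolding poly_growth_def by blast
  have F': "\<bar>F x y\<bar> \<le> \<bar>c\<bar> * ((1 + real x) ^ k * (1 + real y) ^ k)" for x y
  proof -
    have "c * (1 + real x + real y) ^ k \<le> \<bar>c\<bar> * ((1 + real x) * (1 + real y)) ^ k"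
      by (intro mult_mono power_mono) (auto simp: algebra_simps)
    then show ?thesis using F[of x y] by (simp add: power_mult_distrib)
  qed
  have "(\<integral>\<^sup>+z. ennreal (norm (F (fst z) (snd z))) \<partial>measure_pmf (Poi2 l m))
      \<le> (\<integral>\<^sup>+z. ennreal \<bar>c\<bar> * (ennreal ((1 + real (fst z)) ^ k) * ennreal ((1 + real (snd z)) ^ k))
           \<partial>measure_pmf (Poi2 l m))"
    using F' by (intro nn_integral_mono) (simp flip: ennreal_mult)
  also have "\<dots> = ennreal \<bar>c\<bar> * ((\<integral>\<^sup>+x. ennreal ((1 + real x) ^ k) \<partial>measure_pmf (Poi l))
          * (\<integral>\<^sup>+y. ennreal ((1 + real y) ^ k) \<partial>measure_pmf (Poi m)))"
    by (simp add: nn_integral_pair_pmf' nn_integral_cmult nn_integral_multc)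
  also have "\<dots> < \<infinity>"
    using nn_integral_Poi_power[of l 1 k] nn_integral_Poi_power[of m 1 k] assms
    by (auto simp: ennreal_mult_less_top)
  finally show ?thesis
    by (intro integrableI_bounded) auto
qed

lemma expectation_Poi2_shift_fst:
  assumes "poly_growth F" "poly_growth (\<lambda>x y. F (Suc x) y)" "0 \<le> l" "0 \<le> m"
  shows "measure_pmf.expectation (Poi2 l m) (\<lambda>z. real (fst z) * F (fst z) (snd z))
    = l * measure_pmf.expectation (Poi2 l m) (\<lambda>z. F (Suc (fst z)) (snd z))"
proof -
  have *: "(\<integral>\<^sup>+z. ennreal (real (fst z) * G (fst z) (snd z)) \<partial>measure_pmf (Poi2 l m))
        = ennreal l * (\<integral>\<^sup>+z. ennreal (G (Suc (fst z)) (snd z)) \<partial>measure_pmf (Poi2 l m))" for G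
    using nn_integral_Poi_shift[OF assms(3), of "\<lambda>x. \<integral>\<^sup>+y. ennreal (G x y) \<partial>measure_pmf (Poi m)"]
    by (simp add: nn_integral_pair_pmf' ennreal_mult' ennreal_of_nat_eq_real_of_nat nn_integral_cmult)
  have "integrable (measure_pmf (Poi2 l m)) (\<lambda>z. real (fst z) * F (fst z) (snd z))"
    using assms by (intro poly_growth_integrable[of "\<lambda>x y. real x * F x y"]) auto
  moreover have "integrable (measure_pmf (Poi2 l m)) (\<lambda>z. F (Suc (fst z)) (snd z))"
    using assms by (intro poly_growth_integrable[of "\<lambda>x y. F (Suc x) y"]) auto
  ultimately show ?thesis
    using *[of F] *[of "\<lambda>x y. - F x y"] assms
    by (simp add: real_lebesgue_integral_def enn2real_mult right_diff_distrib)
qed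

lemma expectation_Poi2_shift_snd:
  assumes "poly_growth F" "poly_growth (\<lambda>x y. F x (Suc y))" "0 \<le> l" "0 \<le> m"
  shows "measure_pmf.expectation (Poi2 l m) (\<lambda>z. real (snd z) * F (fst z) (snd z))
    = m * measure_pmf.expectation (Poi2 l m) (\<lambda>z. F (fst z) (Suc (snd z)))"
proof -
  have *: "(\<integral>\<^sup>+z. ennreal (real (snd z) * G (fst z) (snd z)) \<partial>measure_pmf (Poi2 l m))
        = ennreal m * (\<integral>\<^sup>+z. ennreal (G (fst z) (Suc (snd z))) \<partial>measure_pmf (Poi2 l m))" for G
  proof -
    have "(\<integral>\<^sup>+y. ennreal (real y * G x y) \<partial>measure_pmf (Poi m))
        = ennreal m * (\<integral>\<^sup>+y. ennreal (G x (Suc y)) \<partial>measure_pmf (Poi m))" for x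
      using nn_integral_Poi_shift[OF assms(4), of "\<lambda>y. ennreal (G x y)"]
      by (simp add: ennreal_mult' ennreal_of_nat_eq_real_of_nat)
    then show ?thesis
      by (simp add: nn_integral_pair_pmf' nn_integral_cmult)
  qed
  have "integrable (measure_pmf (Poi2 l m)) (\<lambda>z. real (snd z) * F (fst z) (snd z))"
    using assms by (intro poly_growth_integrable[of "\<lambda>x y. real y * F x y"]) auto
  moreover have "integrable (measure_pmf (Poi2 l m)) (\<lambda>z. F (fst z) (Suc (snd z)))"
    using assms by (intro poly_growth_integrable[of "\<lambda>x y. F x (Suc y)"]) auto
  ultimately show ?thesis
    using *[of F] *[of "\<lambda>x y. - F x y"] assms
    by (simp add: real_lebesgue_integral_def enn2real_mult right_diff_distrib)
qed

text \<open>The unbiased estimator of \<open>(l - m) ^ j\<close> from independent counts \<open>x\<close> and \<open>y\<close> with rates \<open>l\<close> and \<open>m\<close>. It is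
  the coefficient of \<open>t ^ j / j!\<close> in the generating function \<open>(1 + t) ^ x * (1 - t) ^ y\<close>; the recursion comes
  from differentiating this function in \<open>t\<close>. For \<open>y = 0\<close> it is the falling factorial of \<open>x\<close>.\<close>

fun diff_ff :: "nat \<Rightarrow> real \<Rightarrow> real \<Rightarrow> real" where
  "diff_ff 0 x y = 1"
| "diff_ff (Suc j) x y = x * diff_ff j (x - 1) y - y * diff_ff j x (y - 1)"

text \<open>In terms of the generating function, raising \<open>x\<close> by one multiplies it by \<open>1 + t\<close>.\<close>

lemma diff_ff_shift_fst: "diff_ff j (x + 1) y = diff_ff j x y + real j * diff_ff (j - 1) x y"
proof (induction j arbitrary: x y)
  case (Suc j)
  have 1: "diff_ff j x y = diff_ff j (x - 1) y + real j * diff_ff (j - 1) (x - 1) y"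
    using Suc[of "x - 1" y] by simp
  have 2: "real j * diff_ff j x y
      = real j * (x * diff_ff (j - 1) (x - 1) y - y * diff_ff (j - 1) x (y - 1))"
    by (cases j) auto
  have "diff_ff (Suc j) (x + 1) y = diff_ff j x y + x * diff_ff j x y
      - y * (diff_ff j x (y - 1) + real j * diff_ff (j - 1) x (y - 1))"
    using arg_cong[OF Suc[of x "y - 1"], of "\<lambda>t. y * t"] by (simp add: algebra_simps)
  also have "\<dots> = diff_ff (Suc j) x y + diff_ff j x y
      + real j * (x * diff_ff (j - 1) (x - 1) y - y * diff_ff (j - 1) x (y - 1))"
    by (subst (2) 1) (simp add: algebra_simps)
  also have "\<dots> = diff_ff (Suc j) x y + real (Suc j) * diff_ff (Suc j - 1) x y"
    by (subst 2[symmetric]) (simp add: algebra_simps)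
  finally show ?case .
qed auto

text \<open>Raising \<open>y\<close> by one multiplies the generating function by \<open>1 - t\<close>.\<close>

lemma diff_ff_shift_snd: "diff_ff j x (y + 1) = diff_ff j x y - real j * diff_ff (j - 1) x y"
proof (induction j arbitrary: x y)
  case (Suc j)
  have 1: "diff_ff j x y = diff_ff j x (y - 1) - real j * diff_ff (j - 1) x (y - 1)"
    using Suc[of x "y - 1"] by simp
  have 2: "real j * diff_ff j x y
      = real j * (x * diff_ff (j - 1) (x - 1) y - y * diff_ff (j - 1) x (y - 1))"
    by (cases j) auto
  have "diff_ff (Suc j) x (y + 1) = x * (diff_ff j (x - 1) y - real j * diff_ff (j - 1) (x - 1) y)
      - y * diff_ff j x y - diff_ff j x y"
    using arg_cong[OF Suc[of "x - 1" y], of "\<lambda>t. x * t"] by (simp add: algebra_simps)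
  also have "\<dots> = diff_ff (Suc j) x y - diff_ff j x y
      - real j * (x * diff_ff (j - 1) (x - 1) y - y * diff_ff (j - 1) x (y - 1))"
    by (subst (1) 1) (simp add: algebra_simps)
  also have "\<dots> = diff_ff (Suc j) x y - real (Suc j) * diff_ff (Suc j - 1) x y"
    by (subst 2[symmetric]) (simp add: algebra_simps)
  finally show ?case .
qed auto

lemma poly_growth_diff_ff: "poly_growth (\<lambda>x y. diff_ff j (real x + a) (real y + b))"
proof (induction j arbitrary: a b)
  case (Suc j)
  from Suc[of "a - 1" b] Suc[of a "b - 1"] show ?case
    by (auto simp: add_diff_eq)
qed auto

lemma poly_growth_diff_ff' [intro!, simp]: 
  "poly_growth (\<lambda>x y. diff_ff j (real x) (real y))"
  "poly_growth (\<lambda>x y. diff_ff j (real x - 1) (real y))"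
  "poly_growth (\<lambda>x y. diff_ff j (real x) (real y - 1))"
  "poly_growth (\<lambda>x y. diff_ff j (1 + real x) (real y))"
  "poly_growth (\<lambda>x y. diff_ff j (real x) (1 + real y))"
  using poly_growth_diff_ff[of j 0 0] poly_growth_diff_ff[of j "-1" 0] poly_growth_diff_ff[of j 0 "-1"]
   poly_growth_diff_ff[of j 1 0] poly_growth_diff_ff[of j 0 1]
  by (simp_all add: add_ac)

definition ff_moment :: "real \<Rightarrow> real \<Rightarrow> nat \<Rightarrow> nat \<Rightarrow> real" where
  "ff_moment l m j k = measure_pmf.expectation (Poi2 l m) 
    (\<lambda>z. diff_ff j (real (fst z)) (real (snd z)) * diff_ff k (real (fst z)) (real (snd z)))"

lemma ff_moment_commute: "ff_moment l m j k = ff_moment l m k j"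
  by (simp add: ff_moment_def mult.commute)

text \<open>The factors \<open>x\<close> and \<open>y\<close> in the recursion of the estimator of order \<open>j + 1\<close> are absorbed by the Poisson
  shift. This shifts the argument of the other estimator, of order \<open>k\<close>, which produces its lower-order
  companion. In the sum over the two samples the leading terms combine to \<open>l - m\<close> and the companions
  to \<open>l + m\<close>.\<close>

lemma ff_moment_Suc:
  assumes "0 \<le> l" "0 \<le> m"
  shows "ff_moment l m (Suc j) k 
    = (l - m) * ff_moment l m j k + (l + m) * real k * ff_moment l m j (k - 1)"
proof -
  let ?E = "measure_pmf.expectation (Poi2 l m)"
  let ?g = "\<lambda>j z. diff_ff j (real (fst z)) (real (snd z))"
  let ?F = "\<lambda>x y. diff_ff j (real x - 1) (real y) * diff_ff k (real x) (real y)"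
  let ?G = "\<lambda>x y. diff_ff j (real x) (real y - 1) * diff_ff k (real x) (real y)"
  have int [simp]: "integrable (measure_pmf (Poi2 l m)) (\<lambda>z. ?g j z * ?g k z)" for j k
    using assms
    by (intro poly_growth_integrable[of "\<lambda>x y. diff_ff j (real x) (real y) * diff_ff k (real x) (real y)"]) auto
  have s1: "diff_ff k (1 + x) y = diff_ff k x y + real k * diff_ff (k - 1) x y"
    and s2: "diff_ff k x (1 + y) = diff_ff k x y - real k * diff_ff (k - 1) x y" for x y
    using diff_ff_shift_fst[of k x y] diff_ff_shift_snd[of k x y] by (simp_all add: add.commute)
  have i1: "integrable (measure_pmf (Poi2 l m)) (\<lambda>z. real (fst z) * ?F (fst z) (snd z))"
    using assms by (intro poly_growth_integrable[of "\<lambda>x y. real x * ?F x y"]) auto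
  have i2: "integrable (measure_pmf (Poi2 l m)) (\<lambda>z. real (snd z) * ?G (fst z) (snd z))"
    using assms by (intro poly_growth_integrable[of "\<lambda>x y. real y * ?G x y"]) auto
  have "ff_moment l m (Suc j) k = ?E (\<lambda>z. real (fst z) * ?F (fst z) (snd z) - real (snd z) * ?G (fst z) (snd z))"
    by (simp add: ff_moment_def algebra_simps)
  also have "\<dots> = ?E (\<lambda>z. real (fst z) * ?F (fst z) (snd z)) - ?E (\<lambda>z. real (snd z) * ?G (fst z) (snd z))"
    by (intro Bochner_Integration.integral_diff i1 i2)
  also have "?E (\<lambda>z. real (fst z) * ?F (fst z) (snd z)) = l * ?E (\<lambda>z. ?F (Suc (fst z)) (snd z))"
    using assms by (intro expectation_Poi2_shift_fst) auto
  also have "(\<lambda>z. ?F (Suc (fst z)) (snd z)) = (\<lambda>z. ?g j z * ?g k z + real k * (?g j z * ?g (k - 1) z))"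
    by (simp add: fun_eq_iff s1 algebra_simps)
  also have "?E \<dots> = ff_moment l m j k + real k * ff_moment l m j (k - 1)"
    by (simp add: ff_moment_def)
  also have "?E (\<lambda>z. real (snd z) * ?G (fst z) (snd z)) = m * ?E (\<lambda>z. ?G (fst z) (Suc (snd z)))"
    using assms by (intro expectation_Poi2_shift_snd) auto
  also have "(\<lambda>z. ?G (fst z) (Suc (snd z))) = (\<lambda>z. ?g j z * ?g k z - real k * (?g j z * ?g (k - 1) z))"
    by (simp add: fun_eq_iff s2 algebra_simps)
  also have "?E \<dots> = ff_moment l m j k - real k * ff_moment l m j (k - 1)"
    by (simp add: ff_moment_def)
  finally show ?thesis
    by (simp add: algebra_simps)
qed

lemma ff_moment_0: 
  assumes "0 \<le> l" "0 \<le> m"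
  shows "ff_moment l m j 0 = (l - m) ^ j" "ff_moment l m 0 j = (l - m) ^ j"
proof -
  show "ff_moment l m j 0 = (l - m) ^ j"
    by (induction j) (simp_all add: ff_moment_Suc assms, simp add: ff_moment_def)
  then show "ff_moment l m 0 j = (l - m) ^ j"
    by (simp add: ff_moment_commute)
qed

text \<open>The two terms of the recursion are the steps of an induction on \<open>j\<close>: with
  \<open>r = \<bar>l - m\<bar> + sqrt (N * (l + m))\<close> one has \<open>\<bar>l - m\<bar> * r + N * (l + m) \<le> r\<^sup>2\<close>. Up to
  the factor \<open>sqrt N\<close>, the base of the bound is the mean of \<open>x - y\<close> plus its standard deviation. For large
  rates that are close to each other it is far below the rates themselves.\<close>

lemma ff_moment_bound:
  assumes "0 \<le> l" "0 \<le> m" "j \<le> N" "k \<le> N"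
  shows "\<bar>ff_moment l m j k\<bar> \<le> (\<bar>l - m\<bar> + sqrt (real N * (l + m))) ^ (j + k)"
  using assms(3,4)
proof (induction j arbitrary: k)
  case 0
  then show ?case
    using assms by (auto simp: ff_moment_0 power_abs intro!: power_mono)
next
  case (Suc j)
  let ?s = "sqrt (real N * (l + m))"
  let ?r = "\<bar>l - m\<bar> + ?s"
  have r0: "?r \<ge> 0" "?s \<ge> 0" using assms by auto
  have "\<bar>ff_moment l m (Suc j) k\<bar> \<le> \<bar>l - m\<bar> * \<bar>ff_moment l m j k\<bar> + (l + m) * real k * \<bar>ff_moment l m j (k - 1)\<bar>"
    unfolding ff_moment_Suc[OF assms(1,2)]
    by (rule order.trans[OF abs_triangle_ineq]) (use assms in \<open>simp add: abs_mult\<close>)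
  also have "\<bar>l - m\<bar> * \<bar>ff_moment l m j k\<bar> \<le> \<bar>l - m\<bar> * ?r ^ (j + k)"
    using Suc by (intro mult_left_mono) auto
  also have "(l + m) * real k * \<bar>ff_moment l m j (k - 1)\<bar> \<le> ?s * ?r ^ (j + k)"
  proof (cases k)
    case (Suc k')
    have "(l + m) * real k * \<bar>ff_moment l m j (k - 1)\<bar> \<le> (l + m) * real N * ?r ^ (j + k')"
      using Suc.IH[of k'] Suc.prems Suc assms r0 by (intro mult_mono) auto
    also have "(l + m) * real N = ?s * ?s"
      using assms by (simp add: mult.commute)
    also have "\<dots> * ?r ^ (j + k') \<le> ?s * ?r * ?r ^ (j + k')"
      using r0 by (intro mult_right_mono mult_left_mono) auto
    finally show ?thesis using Suc by (simp add: mult_ac)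
  qed (use r0 in auto)
  finally show ?case by (simp add: algebra_simps)
qed

section \<open>Unbiased estimation of bivariate polynomials\<close>

lemma poly_space2_mono: "f \<in> poly_space2 M \<Longrightarrow> M \<le> N \<Longrightarrow> f \<in> poly_space2 N"
  by (auto simp: poly_space2_def intro: order.trans)

lemma poly_space2_exhausts: "\<exists>N. f \<in> poly_space2 N"
proof -
  have "degree (coeff f s) \<le> (\<Sum>s\<le>degree f. degree (coeff f s))" for s
    by (cases "s \<le> degree f") (auto intro: member_le_sum simp: coeff_eq_0)
  then have "f \<in> poly_space2 (degree f + (\<Sum>s\<le>degree f. degree (coeff f s)))"
    by (auto simp: poly_space2_def intro: trans_le_add2)
  then show ?thesis ..
qed

lemma poly_space2_common: "\<exists>N. f \<in> poly_space2 N \<and> g \<in> poly_space2 N"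
  using poly_space2_exhausts[of f] poly_space2_exhausts[of g] poly_space2_mono
  by (metis max.cobounded1 max.cobounded2)

lemma poly_space2_add: "f \<in> poly_space2 N \<Longrightarrow> g \<in> poly_space2 N \<Longrightarrow> f + g \<in> poly_space2 N"
  by (auto simp: poly_space2_def intro!: degree_add_le)

lemma poly_space2_diff: "f \<in> poly_space2 N \<Longrightarrow> g \<in> poly_space2 N \<Longrightarrow> f - g \<in> poly_space2 N"
  by (auto simp: poly_space2_def intro!: degree_diff_le)

lemma poly_space2_mult:
  assumes "f \<in> poly_space2 M" "g \<in> poly_space2 N"
  shows "f * g \<in> poly_space2 (M + N)"
proof -
  have "degree (f * g) \<le> M + N"
    using assms by (intro order.trans[OF degree_mult_le] add_mono) (auto simp: poly_space2_def)
  moreover have "degree (coeff f i * coeff g j) \<le> M + N" for i j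
    using assms by (intro order.trans[OF degree_mult_le] add_mono) (auto simp: poly_space2_def)
  then have "degree (coeff (f * g) s) \<le> M + N" for s
    by (auto simp: coeff_mult intro!: degree_sum_le)
  ultimately show ?thesis
    by (auto simp: poly_space2_def)
qed

lemma poly_space2_const2: "const2 c \<in> poly_space2 N"
  by (auto simp: poly_space2_def const2_def coeff_pCons split: nat.splits)

lemma poly_space2_X2: "X2 \<in> poly_space2 (Suc N)"
  by (auto simp: poly_space2_def X2_def coeff_pCons split: nat.splits)

lemma poly_space2_Y2: "Y2 \<in> poly_space2 (Suc N)"
  by (auto simp: poly_space2_def Y2_def coeff_pCons split: nat.splits)

text \<open>With a common bound on all degrees the sums range over fixed sets, which makes linearity visible.\<close>

lemma unbiased2_altdef:
  assumes "f \<in> poly_space2 N"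
  shows "unbiased2 n f p q = (\<Sum>s\<le>N. \<Sum>r\<le>N.
    coeff (coeff f s) r * (\<Prod>i<r. p - real i / n) * (\<Prod>j<s. q - real j / n))"
proof -
  have "(\<Sum>r\<le>degree (coeff f s). coeff (coeff f s) r * (\<Prod>i<r. p - real i / n) * (\<Prod>j<s. q - real j / n))
    = (\<Sum>r\<le>N. coeff (coeff f s) r * (\<Prod>i<r. p - real i / n) * (\<Prod>j<s. q - real j / n))" for s
    using assms by (intro sum.mono_neutral_left) (auto simp: poly_space2_def coeff_eq_0)
  then show ?thesis
    unfolding unbiased2_def using assms
    by (simp, intro sum.mono_neutral_left) (auto simp: poly_space2_def coeff_eq_0)
qed

lemma unbiased2_add: "unbiased2 n (f + g) p q = unbiased2 n f p q + unbiased2 n g p q"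
proof -
  obtain N where "f \<in> poly_space2 N" "g \<in> poly_space2 N"
    using poly_space2_common by blast
  then show ?thesis
    by (simp add: unbiased2_altdef[of _ N] poly_space2_add sum.distrib distrib_right)
qed

lemma unbiased2_const_mult: "unbiased2 n (const2 c * f) p q = c * unbiased2 n f p q"
proof -
  obtain N where f: "f \<in> poly_space2 N"
    using poly_space2_exhausts by blast
  have "const2 c * f \<in> poly_space2 N"
    using poly_space2_mult[OF poly_space2_const2[of c 0] f] by simp
  then show ?thesis
    using f by (simp add: unbiased2_altdef[of _ N] const2_def sum_distrib_left mult_ac)
qed

lemma unbiased2_0 [simp]: "unbiased2 n 0 p q = 0"
  by (simp add: unbiased2_def)

lemma unbiased2_sum: "unbiased2 n (\<Sum>i\<in>A. f i) p q = (\<Sum>i\<in>A. unbiased2 n (f i) p q)"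
  by (induction A rule: infinite_finite_induct) (auto simp: unbiased2_add)

lemma unbiased2_diff: "unbiased2 n (f - g) p q = unbiased2 n f p q - unbiased2 n g p q"
  using unbiased2_add[of n "f - g" g p q] by simp

lemma unbiased2_X2_mult: "unbiased2 n (X2 * f) p q = p * unbiased2 n f (p - 1 / n) q"
proof -
  obtain N where f: "f \<in> poly_space2 N"
    using poly_space2_exhausts by blast
  have f': "X2 * f \<in> poly_space2 (Suc N)"
    using poly_space2_mult[OF poly_space2_X2[of 0] f] by simp
  have c: "coeff (X2 * f) s = pCons 0 (coeff f s)" for s
    by (simp add: X2_def)
  have z: "coeff f (Suc N) = 0" "coeff (coeff f s) (Suc N) = 0" for s
    using f by (auto simp: poly_space2_def intro!: coeff_eq_0 le_imp_less_Suc)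
  have pr: "(\<Prod>i<Suc r. p - real i / n) = p * (\<Prod>i<r. p - 1 / n - real i / n)" for r
    by (subst prod.lessThan_Suc_shift) (simp add: add_divide_distrib diff_diff_eq)
  have inner: "(\<Sum>r\<le>Suc N. coeff (pCons 0 (coeff f s)) r * (\<Prod>i<r. p - real i / n) * Q)
      = p * (\<Sum>r\<le>N. coeff (coeff f s) r * (\<Prod>i<r. p - 1 / n - real i / n) * Q)" for s Q
    by (subst sum.atMost_Suc_shift)
      (simp add: pr sum_distrib_left mult_ac del: prod.lessThan_Suc)
  show ?thesis
    unfolding unbiased2_altdef[OF f'] unbiased2_altdef[OF f] c inner
    by (simp add: z sum_distrib_left del: prod.lessThan_Suc)
qed

lemma unbiased2_Y2_mult: "unbiased2 n (Y2 * f) p q = q * unbiased2 n f p (q - 1 / n)"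
proof -
  obtain N where f: "f \<in> poly_space2 N"
    using poly_space2_exhausts by blast
  have f': "Y2 * f \<in> poly_space2 (Suc N)"
    using poly_space2_mult[OF poly_space2_Y2[of 0] f] by simp
  have c: "coeff (Y2 * f) (Suc s) = coeff f s" "coeff (Y2 * f) 0 = 0" for s
    by (simp_all add: Y2_def)
  have z: "coeff f (Suc N) = 0" "coeff (coeff f s) (Suc N) = 0" for s
    using f by (auto simp: poly_space2_def intro!: coeff_eq_0 le_imp_less_Suc)
  have pr: "(\<Prod>i<Suc r. q - real i / n) = q * (\<Prod>i<r. q - 1 / n - real i / n)" for r
    by (subst prod.lessThan_Suc_shift) (simp add: add_divide_distrib diff_diff_eq)
  show ?thesis
    unfolding unbiased2_altdef[OF f'] unbiased2_altdef[OF f]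
    by (subst sum.atMost_Suc_shift)
      (simp add: c z pr sum_distrib_left mult_ac del: prod.lessThan_Suc)
qed

lemma diff_ff_0: "diff_ff r x 0 = (\<Prod>i<r. x - real i)"
  by (induction r arbitrary: x)
    (simp_all add: prod.lessThan_Suc_shift diff_diff_eq del: prod.lessThan_Suc)

text \<open>Multiplication by a variable acts on the estimators by a shift and a factor, so the powers of
  \<open>X2 - Y2\<close> obey the recursion of \<open>diff_ff\<close>.\<close>

lemma unbiased2_diff_power:
  assumes "n \<noteq> 0"
  shows "unbiased2 n ((X2 - Y2) ^ j) (x / n) (y / n) = diff_ff j x y / n ^ j"
proof (induction j arbitrary: x y)
  case 0
  show ?case by (simp add: unbiased2_def)
next
  case (Suc j)
  show ?case
    using Suc[of "x - 1" y] Suc[of x "y - 1"] assms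
    by (simp add: left_diff_distrib unbiased2_diff unbiased2_X2_mult unbiased2_Y2_mult
       diff_divide_distrib)
qed

lemma unbiased2_P2_poly:
  assumes "n \<noteq> 0" "W_scale c1 n a b \<noteq> 0"
  shows "unbiased2 n (P2_poly c1 n K R a b) (x / n) (y / n)
    = (\<Sum>j\<le>K. (W_scale c1 n a b * coeff R j) * (diff_ff j x y / (n * W_scale c1 n a b) ^ j))"
  unfolding P2_poly_def unbiased2_sum unbiased2_const_mult unbiased2_diff_power[OF assms(1)]
  using assms by (intro sum.cong refl) (simp add: power_int_diff power_mult_distrib field_simps)

lemma coeff_rescale2: "coeff (coeff (rescale2 B h) s) r = B * (1 / B) ^ (r + s) * coeff (coeff h s) r"
proof -
  have "[:1 / B:] ^ s = [:(1 / B) ^ s:]"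
    by (induction s) auto
  then show ?thesis
    by (simp add: rescale2_def coeff_pcompose_linear coeff_map_poly power_add mult_ac)
qed

lemma poly_space2_rescale2: 
  assumes "h \<in> poly_space2 N" shows "rescale2 B h \<in> poly_space2 N"
proof -
  have "coeff (coeff h s) r = 0" if "s > N \<or> r > N" for r s
  proof -
    have "degree h \<le> N" "degree (coeff h s) \<le> N"
      using assms by (auto simp: poly_space2_def)
    then show ?thesis
      using that by (auto simp: coeff_eq_0)
  qed
  then have "coeff (coeff (rescale2 B h) s) r = 0" if "s > N \<or> r > N" for r s
    using that by (simp add: coeff_rescale2)
  then show ?thesis
    unfolding poly_space2_def mem_Collect_eq
    by (intro conjI allI degree_le impI poly_eqI) simp_all
qed

lemma unbiased2_rescale2:
  assumes "n \<noteq> 0" "B \<noteq> 0" "h \<in> poly_space2 N"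
  shows "unbiased2 n (rescale2 B h) (x / n) (y / n)
    = (\<Sum>(s, r)\<in>{..N} \<times> {..N}. 
         (B * coeff (coeff h s) r) * (diff_ff r x 0 * diff_ff s y 0 / (n * B) ^ (r + s)))"
proof -
  have pr: "(\<Prod>i<r. x / n - real i / n) = diff_ff r x 0 / n ^ r" for r x
    by (simp add: diff_ff_0 prod_dividef flip: diff_divide_distrib)
  show ?thesis
    unfolding unbiased2_altdef[OF poly_space2_rescale2[OF assms(3)]] coeff_rescale2 pr
    using assms unfolding sum.cartesian_product[symmetric]
    by (intro sum.cong refl) (simp add: power_mult_distrib power_add power_divide field_simps)
qed

lemma poly_growth_ff [intro!, simp]: 
  "poly_growth (\<lambda>x y. diff_ff r (real x) 0)" "poly_growth (\<lambda>x y. diff_ff r (real y) 0)"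
  "poly_growth (\<lambda>x y. diff_ff r (real x - 1) 0)" "poly_growth (\<lambda>x y. diff_ff r (real y - 1) 0)"
  unfolding diff_ff_0 by (intro poly_growth_prod poly_growth_diff poly_growth_const poly_growth_fst poly_growth_snd)+

lemma expectation_ff_ff:
  assumes "0 \<le> l" "0 \<le> m"
  shows "measure_pmf.expectation (Poi2 l m) 
    (\<lambda>z. diff_ff r (real (fst z)) 0 * diff_ff s (real (snd z)) 0) = l ^ r * m ^ s"
proof (induction r)
  case 0
  show ?case
  proof (induction s)
    case (Suc s)
    have "measure_pmf.expectation (Poi2 l m) (\<lambda>z. real (snd z) * diff_ff s (real (snd z) - 1) 0)
     = m * measure_pmf.expectation (Poi2 l m) (\<lambda>z. diff_ff s (real (Suc (snd z)) - 1) 0)"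
      by (rule expectation_Poi2_shift_snd[where F = "\<lambda>x y. diff_ff s (real y - 1) 0"]) (use assms in auto)
    then show ?case using Suc by simp
  qed auto
next
  case (Suc r)
  have "measure_pmf.expectation (Poi2 l m) (\<lambda>z. real (fst z) * (diff_ff r (real (fst z) - 1) 0 * diff_ff s (real (snd z)) 0))
     = l * measure_pmf.expectation (Poi2 l m) (\<lambda>z. (diff_ff r (real (Suc (fst z)) - 1) 0 * diff_ff s (real (snd z)) 0))"
    by (rule expectation_Poi2_shift_fst[where F = "\<lambda>x y. diff_ff r (real x - 1) 0 * diff_ff s (real y) 0"]) 
       (use assms in auto)
  then show ?case using Suc by (simp add: mult_ac)
qed

text \<open>By independence the expectation factors, and each factor is the diagonal moment of \<open>diff_ff\<close> for a
  second sample of rate \<open>0\<close>.\<close>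

lemma second_moment_ff_ff:
  assumes "0 \<le> l" "0 \<le> m"
  shows "measure_pmf.expectation (Poi2 l m) 
    (\<lambda>z. (diff_ff r (real (fst z)) 0 * diff_ff s (real (snd z)) 0)\<^sup>2) = ff_moment l 0 r r * ff_moment m 0 s s"
proof -
  have single: "(\<integral>\<^sup>+x. ennreal ((diff_ff r (real x) 0)\<^sup>2) \<partial>measure_pmf (Poi l)) = ennreal (ff_moment l 0 r r)"
    if "0 \<le> l" for l r
  proof -
    have "integrable (measure_pmf (Poi2 l 0)) (\<lambda>z. (diff_ff r (real (fst z)) (real (snd z)))\<^sup>2)"
      using that by (intro poly_growth_integrable[of "\<lambda>x y. (diff_ff r (real x) (real y))\<^sup>2"]) auto
    then have "(\<integral>\<^sup>+z. ennreal ((diff_ff r (real (fst z)) (real (snd z)))\<^sup>2) \<partial>measure_pmf (Poi2 l 0)) = ennreal (ff_moment l 0 r r)"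
      by (subst nn_integral_eq_integral) (auto simp: ff_moment_def power2_eq_square)
    then show ?thesis
      by (simp add: nn_integral_pair_pmf' Poi_def[of 0])
  qed
  have nn: "ff_moment l 0 r r \<ge> 0" for l r
    by (simp add: ff_moment_def)
  have "integrable (measure_pmf (Poi2 l m)) (\<lambda>z. (diff_ff r (real (fst z)) 0 * diff_ff s (real (snd z)) 0)\<^sup>2)"
    using assms by (intro poly_growth_integrable[of "\<lambda>x y. (diff_ff r (real x) 0 * diff_ff s (real y) 0)\<^sup>2"]) auto
  then have "ennreal (measure_pmf.expectation (Poi2 l m) 
    (\<lambda>z. (diff_ff r (real (fst z)) 0 * diff_ff s (real (snd z)) 0)\<^sup>2)) 
   = (\<integral>\<^sup>+z. ennreal ((diff_ff r (real (fst z)) 0 * diff_ff s (real (snd z)) 0)\<^sup>2) \<partial>measure_pmf (Poi2 l m))"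
    by (subst nn_integral_eq_integral) auto
  also have "\<dots> = (\<integral>\<^sup>+x. ennreal ((diff_ff r (real x) 0)\<^sup>2) \<partial>measure_pmf (Poi l))
         * (\<integral>\<^sup>+x. ennreal ((diff_ff s (real x) 0)\<^sup>2) \<partial>measure_pmf (Poi m))"
    by (simp add: nn_integral_pair_pmf' power_mult_distrib ennreal_mult nn_integral_cmult nn_integral_multc)
  also have "\<dots> = ennreal (ff_moment l 0 r r * ff_moment m 0 s s)"
    by (simp add: single assms nn ennreal_mult)
  finally show ?thesis
    using nn by (subst (asm) ennreal_inj) auto
qed

text \<open>A weighted Cauchy-Schwarz inequality: no information on the correlations of the \<open>Z j\<close> enters.\<close>

lemma second_moment_weighted_sum:
  fixes Z :: "'i \<Rightarrow> 'a \<Rightarrow> real"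
  assumes "finite J" "\<And>j. j \<in> J \<Longrightarrow> integrable (measure_pmf M) (\<lambda>z. (Z j z)\<^sup>2)"
    and "\<And>j. j \<in> J \<Longrightarrow> measure_pmf.expectation M (\<lambda>z. (Z j z)\<^sup>2) \<le> V"
  shows "measure_pmf.expectation M (\<lambda>z. (\<Sum>j\<in>J. a j * Z j z)\<^sup>2) \<le> (\<Sum>j\<in>J. \<bar>a j\<bar>)\<^sup>2 * V"
proof -
  have cs: "(\<Sum>j\<in>J. a j * Z j z)\<^sup>2 \<le> (\<Sum>j\<in>J. \<bar>a j\<bar>) * (\<Sum>j\<in>J. \<bar>a j\<bar> * (Z j z)\<^sup>2)" for z
  proof -
    have "(\<Sum>j\<in>J. a j * Z j z)\<^sup>2 = (\<Sum>j\<in>J. sqrt \<bar>a j\<bar> * (sgn (a j) * sqrt \<bar>a j\<bar> * Z j z))\<^sup>2"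
      by (intro arg_cong[where f = "\<lambda>t. t\<^sup>2"] sum.cong) (auto simp: sgn_if)
    also have "\<dots> \<le> (\<Sum>j\<in>J. (sqrt \<bar>a j\<bar>)\<^sup>2) * (\<Sum>j\<in>J. (sgn (a j) * sqrt \<bar>a j\<bar> * Z j z)\<^sup>2)"
      by (rule Cauchy_Schwarz_ineq_sum)
    also have "\<dots> = (\<Sum>j\<in>J. \<bar>a j\<bar>) * (\<Sum>j\<in>J. \<bar>a j\<bar> * (Z j z)\<^sup>2)"
      by (intro arg_cong2[where f = "(*)"] sum.cong) (auto simp: power_mult_distrib sgn_if)
    finally show ?thesis .
  qed
  have "measure_pmf.expectation M (\<lambda>z. (\<Sum>j\<in>J. a j * Z j z)\<^sup>2) 
     \<le> measure_pmf.expectation M (\<lambda>z. (\<Sum>j\<in>J. \<bar>a j\<bar>) * (\<Sum>j\<in>J. \<bar>a j\<bar> * (Z j z)\<^sup>2))"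
    using assms cs by (intro integral_mono') (auto intro!: mult_nonneg_nonneg sum_nonneg)
  also have "\<dots> = (\<Sum>j\<in>J. \<bar>a j\<bar>) * (\<Sum>j\<in>J. \<bar>a j\<bar> * measure_pmf.expectation M (\<lambda>z. (Z j z)\<^sup>2))"
    using assms by (simp add: integral_sum)
  also have "\<dots> \<le> (\<Sum>j\<in>J. \<bar>a j\<bar>) * (\<Sum>j\<in>J. \<bar>a j\<bar> * V)"
    using assms by (intro mult_left_mono sum_mono sum_nonneg) auto
  also have "\<dots> = (\<Sum>j\<in>J. \<bar>a j\<bar>)\<^sup>2 * V"
    by (simp add: power2_eq_square mult.assoc flip: sum_distrib_right)
  finally show ?thesis .
qed

section \<open>Coefficients of bounded polynomials\<close>

lemma coeff_prod_linear_bound: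
  fixes x :: "'i \<Rightarrow> real"
  assumes "finite J" "\<And>j. j \<in> J \<Longrightarrow> \<bar>x j\<bar> \<le> 1"
  shows "\<bar>coeff (\<Prod>j\<in>J. [:- x j, 1:]) k\<bar> \<le> 2 ^ card J"
  using assms
proof (induction J arbitrary: k rule: finite_induct)
  case (insert j J)
  let ?p = "\<Prod>j\<in>J. [:- x j, 1:]"
  have IH: "\<bar>coeff ?p k\<bar> \<le> 2 ^ card J" for k
    using insert by auto
  have "\<bar>x j * coeff ?p k\<bar> \<le> 1 * 2 ^ card J"
    unfolding abs_mult using insert.prems IH by (intro mult_mono) auto
  moreover have "\<bar>case k of 0 \<Rightarrow> 0 | Suc m \<Rightarrow> coeff ?p m\<bar> \<le> 2 ^ card J"
    using IH by (auto split: nat.split)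
  ultimately show ?case
    using insert.hyps by (simp add: coeff_pCons split: nat.splits)
qed (auto simp: coeff_1)

lemma lagrange_interpolation:
  fixes p :: "real poly"
  assumes "finite J" "degree p < card J" "inj_on x J"
  shows "p = (\<Sum>i\<in>J. smult (poly p (x i) / (\<Prod>j\<in>J - {i}. x i - x j)) (\<Prod>j\<in>J - {i}. [:- x j, 1:]))"
    (is "p = ?q")
proof (rule poly_eqI_degree)
  show "poly p t = poly ?q t" if t: "t \<in> x ` J" for t
  proof -
    obtain k where k: "k \<in> J" "t = x k" using t by auto
    have "poly ?q t = (\<Sum>i\<in>J. poly p (x i) / (\<Prod>j\<in>J - {i}. x i - x j) * (\<Prod>j\<in>J - {i}. x k - x j))"
      using k by (simp add: poly_sum poly_prod)
    also have "\<dots> = (\<Sum>i\<in>{k}. poly p (x i) / (\<Prod>j\<in>J - {i}. x i - x j) * (\<Prod>j\<in>J - {i}. x k - x j))"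
      using assms k by (intro sum.mono_neutral_right) (auto intro!: prod_zero bexI[of _ k])
    also have "\<dots> = poly p t"
      using assms k by (auto simp: inj_on_def)
    finally show ?thesis ..
  qed
  show "degree p < card (x ` J)"
    using assms by (simp add: card_image)
  have "degree (\<Prod>j\<in>J - {i}. [:- x j, 1:]) \<le> card (J - {i})" for i
    using degree_prod_sum_le[of "J - {i}" "\<lambda>j. [:- x j, 1:]"] assms by simp
  then have "degree (\<Prod>j\<in>J - {i}. [:- x j, 1:]) \<le> card J - 1" if "i \<in> J" for i
    using that assms(1) by (metis card_Diff_singleton)
  then have "degree ?q \<le> card J - 1"
    using assms by (intro degree_sum_le order.trans[OF degree_smult_le]) auto
  then show "degree ?q < card (x ` J)"
    using assms by (simp add: card_image)
qed

lemma prod_abs_diff_eq_fact: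
  assumes "i \<le> N"
  shows "(\<Prod>j\<in>{..N} - {i}. \<bar>real i - real j\<bar>) = fact i * fact (N - i)"
proof -
  have *: "{..N} - {i} = {..<i} \<union> {i<..N}" "{..<i} \<inter> {i<..N} = {}"
    using assms by auto
  have "(\<Prod>j<i. \<bar>real i - real j\<bar>) = (\<Prod>j = 0..<i. real (i - j))"
    by (intro prod.cong) auto
  also have "\<dots> = fact i"
    by (simp add: fact_prod_rev)
  finally have 1: "(\<Prod>j<i. \<bar>real i - real j\<bar>) = fact i" .
  have "(\<Prod>j\<in>{i<..N}. \<bar>real i - real j\<bar>) = (\<Prod>k\<in>{1..N - i}. real k)"
    by (rule prod.reindex_bij_witness[where i = "\<lambda>k. k + i" and j = "\<lambda>j. j - i"]) (use assms in auto)
  also have "\<dots> = fact (N - i)"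
    by (simp add: fact_prod)
  finally show ?thesis
    unfolding * by (subst prod.union_disjoint) (use 1 in auto)
qed

text \<open>One term of the exponential series of \<open>N\<close>.\<close>

lemma power_self_le_fact: "real N ^ N \<le> exp 1 ^ N * fact N"
proof -
  have "real N ^ N /\<^sub>R fact N \<le> (\<Sum>k. real N ^ k /\<^sub>R fact k)"
    using sum_le_suminf[OF summable_exp_generic[of "real N"], of "{N}"] by simp
  then have "real N ^ N / fact N \<le> exp (real N)"
    by (simp add: exp_def field_simps)
  also have "exp (real N) = exp 1 ^ N"
    using exp_of_nat_mult[of N 1] by simp
  finally show ?thesis
    by (simp add: field_simps)
qed

text \<open>Interpolate \<open>p\<close> at the points \<open>i / N\<close>. The node polynomials have coefficients at most \<open>2 ^ N\<close>, and the
  denominators are \<open>i! * (N - i)! / N ^ N\<close>, so that the sum over the nodes is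
  \<open>M * (4 * N) ^ N / N! \<le> M * (4 * exp 1) ^ N\<close>. Growth that is exponential in the degree is all that is needed
  for a degree that is a small multiple of \<open>ln n\<close>.\<close>

lemma coeff_bound_unit_interval:
  fixes p :: "real poly"
  assumes "degree p \<le> N" and M: "\<And>t. t \<in> {0..1} \<Longrightarrow> \<bar>poly p t\<bar> \<le> M"
  shows "\<bar>coeff p k\<bar> \<le> M * 12 ^ N"
proof -
  define x where "x i = real i / real N" for i :: nat
  let ?J = "{..N}"
  have M0: "M \<ge> 0" using M[of 0] by (simp add: order.trans[OF abs_ge_zero])
  have inj: "inj_on x ?J"
    by (cases "N = 0") (auto simp: inj_on_def x_def)
  have x01: "x i \<in> {0..1}" if "i \<le> N" for i
    using that by (cases "N = 0") (auto simp: x_def)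
  have D: "\<bar>\<Prod>j\<in>?J - {i}. x i - x j\<bar> = fact i * fact (N - i) / real N ^ N" if "i \<le> N" for i
  proof -
    have "\<bar>\<Prod>j\<in>?J - {i}. x i - x j\<bar> = (\<Prod>j\<in>?J - {i}. \<bar>real i - real j\<bar> / real N)"
      unfolding abs_prod by (simp add: x_def abs_divide flip: diff_divide_distrib)
    also have "\<dots> = fact i * fact (N - i) / real N ^ card (?J - {i})"
      using that by (simp add: prod_dividef prod_abs_diff_eq_fact)
    finally show ?thesis using that by (simp add: card_Diff_singleton)
  qed
  have "p = (\<Sum>i\<in>?J. smult (poly p (x i) / (\<Prod>j\<in>?J - {i}. x i - x j)) (\<Prod>j\<in>?J - {i}. [:- x j, 1:]))"
    using lagrange_interpolation[of ?J p x] assms(1) inj by simp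
  from arg_cong[OF this, of "\<lambda>q. coeff q k"] have "coeff p k = (\<Sum>i\<in>?J. poly p (x i) / (\<Prod>j\<in>?J - {i}. x i - x j) * coeff (\<Prod>j\<in>?J - {i}. [:- x j, 1:]) k)"
    unfolding coeff_sum coeff_smult .
  then have "\<bar>coeff p k\<bar> \<le> (\<Sum>i\<in>?J. \<bar>poly p (x i) / (\<Prod>j\<in>?J - {i}. x i - x j) * coeff (\<Prod>j\<in>?J - {i}. [:- x j, 1:]) k\<bar>)"
    by (simp only: sum_abs)
  also have "\<dots> \<le> (\<Sum>i\<in>?J. M / (fact i * fact (N - i) / real N ^ N) * 2 ^ N)"
  proof (intro sum_mono)
    fix i assume i: "i \<in> ?J"
    have c: "\<bar>coeff (\<Prod>j\<in>?J - {i}. [:- x j, 1:]) k\<bar> \<le> 2 ^ card (?J - {i})"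
      using x01 by (intro coeff_prod_linear_bound) auto
    have "\<bar>poly p (x i)\<bar> / \<bar>\<Prod>j\<in>?J - {i}. x i - x j\<bar> * \<bar>coeff (\<Prod>j\<in>?J - {i}. [:- x j, 1:]) k\<bar>
      \<le> M / (fact i * fact (N - i) / real N ^ N) * 2 ^ N"
      using i c x01 M M0 by (subst D) (auto intro!: mult_mono divide_right_mono simp: card_Diff_singleton)
    then show "\<bar>poly p (x i) / (\<Prod>j\<in>?J - {i}. x i - x j) * coeff (\<Prod>j\<in>?J - {i}. [:- x j, 1:]) k\<bar>
      \<le> M / (fact i * fact (N - i) / real N ^ N) * 2 ^ N"
      by (simp only: abs_mult abs_divide)
  qed
  also have "\<dots> = (\<Sum>i\<in>?J. M * (2 * real N) ^ N / fact N * real (N choose i))"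
    by (intro sum.cong) (auto simp: binomial_fact power_mult_distrib)
  also have "\<dots> = M * (2 * real N) ^ N / fact N * (\<Sum>i\<in>?J. real (N choose i))"
    by (simp only: sum_distrib_left)
  also have "(\<Sum>i\<in>?J. real (N choose i)) = 2 ^ N"
    using choose_row_sum[of N] by (metis of_nat_numeral of_nat_power of_nat_sum)
  also have "M * (2 * real N) ^ N / fact N * 2 ^ N = M * 4 ^ N * (real N ^ N / fact N)"
    by (simp add: power_mult_distrib flip: power_mult_distrib[of 2 2 N])
  also have "\<dots> \<le> M * 4 ^ N * exp 1 ^ N"
    using power_self_le_fact[of N] M0 by (intro mult_left_mono) (auto simp: field_simps)
  also have "\<dots> \<le> M * 4 ^ N * 3 ^ N"
    using M0 exp_le by (intro mult_left_mono power_mono) auto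
  also have "\<dots> = M * 12 ^ N"
    by (simp flip: power_mult_distrib)
  finally show ?thesis .
qed

lemma coeff2_bound_unit_square:
  assumes h: "h \<in> poly_space2 N" and M: "\<And>x y. x \<in> {0..1} \<Longrightarrow> y \<in> {0..1} \<Longrightarrow> \<bar>eval2 h x y\<bar> \<le> M"
  shows "\<bar>coeff (coeff h s) r\<bar> \<le> M * 144 ^ N"
proof -
  have "\<bar>poly (coeff h s) x\<bar> \<le> M * 12 ^ N" if x: "x \<in> {0..1}" for x
  proof -
    let ?p = "map_poly (\<lambda>q. poly q x) h"
    have "poly ?p y = eval2 h x y" for y
      unfolding eval2_def by (induction h) (simp_all add: map_poly_pCons)
    moreover have "degree ?p \<le> N"
      using h by (intro degree_le) (auto simp: poly_space2_def coeff_map_poly coeff_eq_0)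
    ultimately show ?thesis
      using coeff_bound_unit_interval[of ?p N M s] M[OF x] by (simp add: coeff_map_poly)
  qed
  then have "\<bar>coeff (coeff h s) r\<bar> \<le> (M * 12 ^ N) * 12 ^ N"
    using h by (intro coeff_bound_unit_interval) (auto simp: poly_space2_def)
  also have "\<dots> = M * 144 ^ N"
    by (simp flip: power_mult_distrib)
  finally show ?thesis .
qed

section \<open>Polynomial approximation of moduli\<close>

text \<open>Chebyshev polynomials in the variable \<open>(sin t)\<^sup>2\<close>: \<open>sin ((2 * k + 1) * t)\<close> divided by \<open>sin t\<close>.\<close>

fun odd_sine_poly :: "nat \<Rightarrow> real poly" where
  "odd_sine_poly 0 = 1"
| "odd_sine_poly (Suc 0) = [:3, -4:]"
| "odd_sine_poly (Suc (Suc k)) = [:2, -4:] * odd_sine_poly (Suc k) - odd_sine_poly k"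

lemma degree_odd_sine_poly: "degree (odd_sine_poly k) \<le> k"
proof (induction k rule: odd_sine_poly.induct)
  case (3 k)
  have "degree ([:2, -4:] * odd_sine_poly (Suc k)) \<le> 1 + Suc k"
    by (rule order.trans[OF degree_mult_le]) (use 3 in auto)
  then show ?case
    using 3 by (auto intro!: degree_diff_le)
qed auto

lemma sin_odd_multiple: "sin (real (2 * k + 1) * t) = sin t * poly (odd_sine_poly k) ((sin t)\<^sup>2)"
proof (induction k rule: odd_sine_poly.induct)
  case 2
  have "sin (3 * t) = sin (2 * t + t)" by simp
  also have "\<dots> = 2 * sin t * (cos t)\<^sup>2 + (1 - 2 * (sin t)\<^sup>2) * sin t"
    by (simp only: sin_add[of "2 * t" t]) (simp add: sin_double cos_double_sin power2_eq_square)
  finally have "sin (3 * t) = 2 * sin t * (cos t)\<^sup>2 + (1 - 2 * (sin t)\<^sup>2) * sin t" .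
  then show ?case
    unfolding cos_squared_eq by (simp add: algebra_simps power2_eq_square)
next
  case (3 k)
  let ?a = "real (2 * Suc k + 1) * t"
  have eq: "real (2 * Suc (Suc k) + 1) * t = ?a + 2 * t" "real (2 * k + 1) * t = ?a - 2 * t"
    by (simp_all add: algebra_simps)
  have "sin (?a + 2 * t) + sin (?a - 2 * t) = 2 * cos (2 * t) * sin ?a"
    by (simp add: sin_add sin_diff)
  then have "sin (?a + 2 * t) = 2 * (1 - 2 * (sin t)\<^sup>2) * (sin t * poly (odd_sine_poly (Suc k)) ((sin t)\<^sup>2))
      - sin t * poly (odd_sine_poly k) ((sin t)\<^sup>2)"
    using 3 unfolding eq cos_double_sin by simp
  then show ?case
    unfolding eq by (simp add: algebra_simps power2_eq_square)
qed auto

text \<open>The partial sums of the Fourier series of a square wave, which is constant on \<open>(0, pi)\<close>. Multiplied by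
  \<open>sin t\<close> and normalised they approximate \<open>\<bar>sin t\<bar>\<close>, with a uniform error because the factor \<open>sin t\<close>
  damps the Gibbs oscillations near \<open>0\<close>.\<close>

definition square_wave_sum :: "nat \<Rightarrow> real \<Rightarrow> real" where
  "square_wave_sum K t = (\<Sum>k<K. sin (real (2 * k + 1) * t) / real (2 * k + 1))"

lemma sin_times_sum_cos_odd:
  "2 * sin t * (\<Sum>k<K. cos (real (2 * k + 1) * t)) = sin (2 * real K * t)"
proof (induction K)
  case (Suc K)
  have "2 * sin t * cos (real (2 * K + 1) * t) = sin (2 * real (Suc K) * t) - sin (2 * real K * t)"
  proof -
    have "2 * real (Suc K) * t = real (2 * K + 1) * t + t" "2 * real K * t = real (2 * K + 1) * t - t"
      by (simp_all add: algebra_simps)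
    then show ?thesis by (simp only: sin_add sin_diff) (simp add: mult_ac)
  qed
  then show ?case using Suc by (simp add: distrib_left del: of_nat_Suc)
qed auto

text \<open>The derivative of the partial sum is \<open>sin (N * s) / (2 * sin s)\<close> with \<open>N = 2 * K\<close>. Integrating it by parts from
  \<open>t\<close> to \<open>pi / 2\<close> gains a factor \<open>1 / N\<close> and costs a factor \<open>1 / sin t\<close>, which the prefactor \<open>sin t\<close> pays for. The
  integration by parts is carried out with the function \<open>H\<close>, and its remainder is bounded by comparing
  \<open>H\<close> with \<open>1 / (2 * N * sin s)\<close>, whose derivative dominates that of \<open>H\<close>.\<close>

lemma square_wave_sum_deviation:
  assumes K: "K \<ge> 1" and t: "0 < t" "t \<le> pi / 2"
  shows "sin t * \<bar>square_wave_sum K t - square_wave_sum K (pi / 2)\<bar> \<le> 1 / (2 * real K)"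
proof -
  define N where "N = 2 * real K"
  have N: "N > 0" using K by (simp add: N_def)
  \<comment> \<open>By the choice of the correction term, the oscillating parts of the derivative cancel up to order \<open>1 / N\<close>.\<close>
  define H where "H s = square_wave_sum K s + cos (N * s) / (2 * N * sin s)" for s
  have sin_pos: "sin s > 0" if "s \<in> {t..pi/2}" for s
    using that t by (intro sin_gt_zero) auto
  define S where "S s = (\<Sum>k<K. cos (real (2 * k + 1) * s))" for s
  have dG: "(square_wave_sum K has_real_derivative S s) (at s)" for s
    unfolding square_wave_sum_def[abs_def] S_def
    by (auto intro!: derivative_eq_intros sum.cong simp del: of_nat_add of_nat_mult)
  have sc: "S s = sin (N * s) / (2 * sin s)" if "sin s > 0" for s
    using sin_times_sum_cos_odd[of s K, folded S_def N_def] that by (simp add: field_simps)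
  have dH: "((\<lambda>s. H s + c / (2 * N * sin s)) has_real_derivative
       - (cos (N * s) + c) * cos s / (2 * N * (sin s)\<^sup>2)) (at s)" if "sin s > 0" for s c
    unfolding H_def using N that
    by (auto intro!: derivative_eq_intros dG simp: sc field_simps power2_eq_square)
  have up: "H t + 1 / (2 * N * sin t) \<ge> H (pi/2) + 1 / (2 * N * sin (pi/2))"
  proof (rule DERIV_nonpos_imp_nonincreasing[where f = "\<lambda>s. H s + 1 / (2 * N * sin s)"])
    fix s assume s: "t \<le> s" "s \<le> pi / 2"
    have "cos s \<ge> 0" "sin s > 0"
      using s t sin_pos[of s] by (auto intro!: cos_ge_zero)
    moreover have "cos (N * s) + 1 \<ge> 0"
      using cos_ge_minus_one[of "N * s"] by linarith
    ultimately have "- (cos (N * s) + 1) * cos s / (2 * N * (sin s)\<^sup>2) \<le> 0"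
      using N by (intro divide_nonpos_nonneg mult_nonpos_nonneg) auto
    then show "\<exists>y. ((\<lambda>s. H s + 1 / (2 * N * sin s)) has_real_derivative y) (at s) \<and> y \<le> 0"
      using dH[of s 1] \<open>sin s > 0\<close> by blast
  qed (use t in auto)
  have down: "H t + (-1) / (2 * N * sin t) \<le> H (pi/2) + (-1) / (2 * N * sin (pi/2))"
  proof (rule DERIV_nonneg_imp_nondecreasing[where f = "\<lambda>s. H s + (-1) / (2 * N * sin s)"])
    fix s assume s: "t \<le> s" "s \<le> pi / 2"
    have "cos s \<ge> 0" "sin s > 0"
      using s t sin_pos[of s] by (auto intro!: cos_ge_zero)
    moreover have "cos (N * s) + (-1) \<le> 0"
      using cos_le_one[of "N * s"] by linarith
    ultimately have "- (cos (N * s) + (-1)) * cos s / (2 * N * (sin s)\<^sup>2) \<ge> 0"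
      using N by (intro divide_nonneg_nonneg mult_nonneg_nonneg) auto
    then show "\<exists>y. ((\<lambda>s. H s + (-1) / (2 * N * sin s)) has_real_derivative y) (at s) \<and> 0 \<le> y"
      using dH[of s "-1"] \<open>sin s > 0\<close> by blast
  qed (use t in auto)
  let ?d = "square_wave_sum K t - square_wave_sum K (pi / 2)"
  let ?c = "cos (N * t)" and ?e = "cos (N * (pi / 2))"
  have st: "sin t > 0" "sin t \<le> 1" using sin_pos[of t] t by auto
  have b: "\<bar>?c\<bar> \<le> 1" "\<bar>?e\<bar> \<le> 1" by (auto simp: abs_le_iff)
  have "?d + ?c / (2 * N * sin t) - ?e / (2 * N) \<ge> 1 / (2 * N) - 1 / (2 * N * sin t)"
    using up by (simp add: H_def)
  then have "2 * N * sin t * (1 / (2 * N) - 1 / (2 * N * sin t))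
      \<le> 2 * N * sin t * (?d + ?c / (2 * N * sin t) - ?e / (2 * N))"
    using st N by (intro mult_left_mono) auto
  moreover have "2 * N * sin t * (1 / (2 * N) - 1 / (2 * N * sin t)) = sin t - 1"
    using st N by (simp add: right_diff_distrib)
  moreover have eq: "2 * N * sin t * (?d + ?c / (2 * N * sin t) - ?e / (2 * N))
      = 2 * N * (sin t * ?d) + ?c - sin t * ?e"
    using st N by (simp add: right_diff_distrib distrib_left mult_ac)
  ultimately have 1: "2 * N * (sin t * ?d) \<ge> sin t - 1 - ?c + sin t * ?e"
    by linarith
  have "?d + ?c / (2 * N * sin t) - ?e / (2 * N) \<le> 1 / (2 * N * sin t) - 1 / (2 * N)"
    using down by (simp add: H_def)
  then have "2 * N * sin t * (?d + ?c / (2 * N * sin t) - ?e / (2 * N))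
      \<le> 2 * N * sin t * (1 / (2 * N * sin t) - 1 / (2 * N))"
    using st N by (intro mult_left_mono) auto
  moreover have "2 * N * sin t * (1 / (2 * N * sin t) - 1 / (2 * N)) = 1 - sin t"
    using st N by (simp add: right_diff_distrib)
  ultimately have 2: "2 * N * (sin t * ?d) \<le> 1 - sin t - ?c + sin t * ?e"
    using eq by linarith
  have "\<bar>sin t * ?e\<bar> \<le> sin t" 
    using mult_left_mono[OF b(2), of "sin t"] st by (simp add: abs_mult)
  then have "\<bar>2 * N * (sin t * ?d)\<bar> \<le> 2"
    using 1 2 b by linarith
  moreover have "\<bar>2 * N * (sin t * ?d)\<bar> = 2 * N * (sin t * \<bar>?d\<bar>)"
    using st N by (simp add: abs_mult)
  moreover have "2 * N * X \<le> 2 \<Longrightarrow> X \<le> 1 / N" for X :: real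
    using N by (simp add: field_simps)
  ultimately show ?thesis
    unfolding N_def by metis
qed

lemma square_wave_sum_pi_half: "square_wave_sum K (pi / 2) = (\<Sum>k<K. (-1) ^ k / real (2 * k + 1))"
proof -
  have "sin (real (2 * k + 1) * (pi / 2)) = (-1) ^ k" for k
  proof (induction k)
    case (Suc k)
    have "real (2 * Suc k + 1) * (pi / 2) = real (2 * k + 1) * (pi / 2) + pi"
      by (simp add: algebra_simps)
    then show ?case using Suc by (simp only: sin_periodic_pi) simp
  qed auto
  then show ?thesis by (simp only: square_wave_sum_def)
qed

text \<open>These are the partial sums of the Leibniz series. Those with an even number of terms increase from
  \<open>1 - 1 / 3\<close>, and those with an odd number of terms are larger.\<close>

lemma square_wave_sum_pi_half_ge:
  assumes "K \<ge> 1" shows "square_wave_sum K (pi / 2) \<ge> 2 / 3"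
proof -
  have ev: "square_wave_sum (2 * m + 2) (pi / 2) \<ge> 2 / 3" for m
  proof (induction m)
    case (Suc m)
    have "2 * Suc m + 2 = Suc (Suc (2 * m + 2))" by simp
    then have "square_wave_sum (2 * Suc m + 2) (pi / 2)
      = square_wave_sum (2 * m + 2) (pi / 2) + (1 / real (4 * m + 5) - 1 / real (4 * m + 7))"
      unfolding square_wave_sum_pi_half by (simp add: algebra_simps)
    moreover have "1 / real (4 * m + 5) \<ge> 1 / real (4 * m + 7)" by (simp add: field_simps)
    ultimately show ?case using Suc by linarith
  qed (simp add: square_wave_sum_pi_half lessThan_Suc numeral_2_eq_2)
  have od: "square_wave_sum (2 * m + 1) (pi / 2) \<ge> 2 / 3" for m
  proof -
    have "square_wave_sum (2 * m + 2) (pi / 2) \<le> square_wave_sum (2 * m + 1) (pi / 2)"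
      unfolding square_wave_sum_pi_half by simp
    then show ?thesis using ev[of m] by linarith
  qed
  show ?thesis
  proof (cases "even K")
    case True
    then obtain m where "K = 2 * m" by auto
    then show ?thesis using ev[of "m - 1"] assms by (cases m) auto
  next
    case False
    then obtain m where "K = 2 * m + 1" by (auto elim: oddE)
    then show ?thesis using od[of m] by auto
  qed
qed

text \<open>A polynomial \<open>b\<close> for which \<open>b (x\<^sup>2)\<close> approximates \<open>\<bar>x\<bar>\<close> on \<open>[-1, 1]\<close>. Dividing by the value of the partial
  sum at \<open>pi / 2\<close>, instead of by its limit, makes the approximation exact at \<open>x = 1\<close>.\<close>

definition abs_poly :: "nat \<Rightarrow> real poly" where
  "abs_poly K = smult (1 / square_wave_sum K (pi / 2))
     (\<Sum>k<K. smult (1 / real (2 * k + 1)) (pCons 0 (odd_sine_poly k)))"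

lemma degree_abs_poly: "degree (abs_poly K) \<le> K"
proof -
  have "degree (smult (1 / real (2 * k + 1)) (pCons 0 (odd_sine_poly k))) \<le> K" if "k < K" for k
    using that degree_odd_sine_poly[of k] 
    by (intro order.trans[OF degree_smult_le] order.trans[OF degree_pCons_le]) auto
  then show ?thesis
    unfolding abs_poly_def 
    by - (rule order.trans[OF degree_smult_le], rule degree_sum_le, simp_all only: finite_lessThan lessThan_iff)
qed

lemma abs_poly_sin:
  "poly (abs_poly K) ((sin t)\<^sup>2) = sin t * square_wave_sum K t / square_wave_sum K (pi / 2)"
proof -
  have "poly (\<Sum>k<K. smult (1 / real (2 * k + 1)) (pCons 0 (odd_sine_poly k))) ((sin t)\<^sup>2) 
    = sin t * square_wave_sum K t"
    unfolding square_wave_sum_def sin_odd_multiple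
    by (simp add: poly_sum sum_distrib_left power2_eq_square mult_ac)
  then show ?thesis by (simp add: abs_poly_def)
qed

text \<open>Put \<open>\<bar>x\<bar> = sin t\<close> with \<open>t\<close> in \<open>[0, pi / 2]\<close>.\<close>

lemma abs_poly_error:
  assumes "K \<ge> 1" "x \<in> {-1..1}"
  shows "\<bar>poly (abs_poly K) (x\<^sup>2) - \<bar>x\<bar>\<bar> \<le> 1 / real K"
proof (cases "x = 0")
  case True
  then show ?thesis using abs_poly_sin[of K 0] by simp
next
  case False
  define t where "t = arcsin \<bar>x\<bar>"
  have s: "sin t = \<bar>x\<bar>" using assms by (auto simp: t_def)
  have t: "0 < t" "t \<le> pi / 2"
    using False assms arcsin_less_mono[of 0 "\<bar>x\<bar>"] arcsin_bounded[of "\<bar>x\<bar>"]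
    by (auto simp: t_def abs_le_iff)
  define g where "g = square_wave_sum K (pi / 2)"
  have g: "g \<ge> 2 / 3" using square_wave_sum_pi_half_ge assms by (simp add: g_def)
  have "poly (abs_poly K) (x\<^sup>2) - \<bar>x\<bar> = sin t * (square_wave_sum K t - g) / g"
    using abs_poly_sin[of K t] g s by (simp add: g_def[symmetric] field_simps)
  also have "\<bar>\<dots>\<bar> = sin t * \<bar>square_wave_sum K t - g\<bar> / g"
    using s g by (simp add: abs_mult)
  also have "\<dots> \<le> (1 / (2 * real K)) / (2 / 3)"
    using square_wave_sum_deviation[OF assms(1) t] g assms unfolding g_def[symmetric]
    by (intro frac_le) auto
  also have "\<dots> \<le> 1 / real K" using assms by (simp add: field_simps)
  finally show ?thesis .
qed

lemma sup_err1_ge: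
  assumes "t \<in> {-1..1}" shows "\<bar>poly f t - \<bar>t\<bar>\<bar> \<le> sup_err1 (\<lambda>t. \<bar>t\<bar>) f"
proof -
  have "compact ((\<lambda>t. \<bar>poly f t - \<bar>t\<bar>\<bar>) ` {-1..1::real})"
    by (intro compact_continuous_image continuous_intros) auto
  then have "bdd_above ((\<lambda>t. \<bar>poly f t - \<bar>t\<bar>\<bar>) ` {-1..1::real})"
    by (intro bounded_imp_bdd_above compact_imp_bounded)
  then show ?thesis
    unfolding sup_err1_def using assms by (intro cSUP_upper)
qed

text \<open>The even competitor \<open>b (t\<^sup>2)\<close> uses only half of the degree; the constant \<open>3\<close> absorbs the rounding of
  \<open>K / 2\<close> and the case \<open>K = 1\<close>.\<close>

lemma best_approx1_abs_error:
  assumes "best_approx1 K (\<lambda>t. \<bar>t\<bar>) R" "K \<ge> 1" "t \<in> {-1..1}"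
  shows "\<bar>poly R t - \<bar>t\<bar>\<bar> \<le> 3 / real K"
proof -
  have "\<exists>f. degree f \<le> K \<and> (\<forall>t\<in>{-1..1}. \<bar>poly f t - \<bar>t\<bar>\<bar> \<le> 3 / real K)"
  proof (cases "K = 1")
    case True
    then show ?thesis by (intro exI[of _ 0]) auto
  next
    case False
    define k where "k = K div 2"
    have k: "k \<ge> 1" "3 * k \<ge> K" "2 * k \<le> K" using False assms(2) by (auto simp: k_def)
    let ?f = "pcompose (abs_poly k) [:0, 0, 1:]"
    have "degree ?f \<le> K"
      using degree_abs_poly[of k] k degree_pcompose_le[of "abs_poly k" "[:0, 0, 1:]"] by auto
    moreover have "\<bar>poly ?f t - \<bar>t\<bar>\<bar> \<le> 3 / real K" if "t \<in> {-1..1}" for t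
    proof -
      have "\<bar>poly ?f t - \<bar>t\<bar>\<bar> \<le> 1 / real k"
        using abs_poly_error[OF k(1) that] by (simp add: poly_pcompose power2_eq_square)
      also have "\<dots> \<le> 3 / real K" using k by (simp add: field_simps)
      finally show ?thesis .
    qed
    ultimately show ?thesis by blast
  qed
  then obtain f where f: "degree f \<le> K" "\<And>t. t \<in> {-1..1} \<Longrightarrow> \<bar>poly f t - \<bar>t\<bar>\<bar> \<le> 3 / real K" by blast
  have "\<bar>poly R t - \<bar>t\<bar>\<bar> \<le> sup_err1 (\<lambda>t. \<bar>t\<bar>) R"
    using assms(3) by (rule sup_err1_ge)
  also have "\<dots> \<le> sup_err1 (\<lambda>t. \<bar>t\<bar>) f"
    using assms(1) f by (auto simp: best_approx1_def)
  also have "\<dots> \<le> 3 / real K"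
    unfolding sup_err1_def using f by (intro cSUP_least) auto
  finally show ?thesis .
qed

lemma eval2_simps [simp]:
  "eval2 (f + g) x y = eval2 f x y + eval2 g x y"
  "eval2 (f - g) x y = eval2 f x y - eval2 g x y"
  "eval2 (f * g) x y = eval2 f x y * eval2 g x y"
  "eval2 (f ^ k) x y = eval2 f x y ^ k"
  "eval2 (const2 c) x y = c"
  "eval2 X2 x y = x"
  "eval2 Y2 x y = y"
  "eval2 0 x y = 0"
  by (simp_all add: eval2_def const2_def X2_def Y2_def)

lemma eval2_sum: "eval2 (\<Sum>i\<in>A. f i) x y = (\<Sum>i\<in>A. eval2 (f i) x y)"
  by (simp add: eval2_def poly_sum)

lemma eval2_bounded: "\<exists>c. \<forall>x\<in>{0..1}. \<forall>y\<in>{0..1}. \<bar>eval2 f x y\<bar> \<le> c"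
proof (induction f)
  case (pCons a f)
  then obtain c where c: "\<forall>x\<in>{0..1}. \<forall>y\<in>{0..1}. \<bar>eval2 f x y\<bar> \<le> c" by blast
  have "compact ((\<lambda>t. poly a t) ` {0..1::real})"
    by (intro compact_continuous_image continuous_intros) auto
  then obtain d where d: "\<bar>poly a x\<bar> \<le> d" if "x \<in> {0..1}" for x
    using compact_imp_bounded bounded_iff by (metis (no_types, lifting) image_eqI real_norm_def)
  have "\<bar>eval2 (pCons a f) x y\<bar> \<le> d + c" if "x \<in> {0..1}" "y \<in> {0..1}" for x y
  proof -
    have "\<bar>y * eval2 f x y\<bar> \<le> 1 * \<bar>eval2 f x y\<bar>"
      unfolding abs_mult using that by (intro mult_right_mono) auto
    also have "\<dots> \<le> c" using c that by simp
    moreover have "eval2 (pCons a f) x y = poly a x + y * eval2 f x y"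
      by (simp add: eval2_def)
    ultimately show ?thesis
      using d[OF that(1)] by linarith
  qed
  then show ?case by blast
qed (auto simp: eval2_def)

text \<open>A best approximation is as good as any competitor. Boundedness of \<open>g\<close> guarantees that the supremum in
  the definition of the error is an upper bound.\<close>

lemma best_approx2_error:
  assumes best: "best_approx2 K g f" and cand: "f' \<in> poly_space2 K"
    and err: "\<And>x y. x \<in> {0..1} \<Longrightarrow> y \<in> {0..1} \<Longrightarrow> \<bar>eval2 f' x y - g x y\<bar> \<le> c"
    and g: "\<And>x y. x \<in> {0..1} \<Longrightarrow> y \<in> {0..1} \<Longrightarrow> \<bar>g x y\<bar> \<le> b"
    and xy: "x \<in> {0..1}" "y \<in> {0..1}"
  shows "\<bar>eval2 f x y - g x y\<bar> \<le> c"
proof -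
  let ?e = "\<lambda>f (x, y). \<bar>eval2 f x y - g x y\<bar>"
  obtain d where d: "\<bar>eval2 f x y\<bar> \<le> d" if "x \<in> {0..1}" "y \<in> {0..1}" for x y
    using eval2_bounded[of f] by blast
  have "bdd_above (?e f ` ({0..1} \<times> {0..1}))"
  proof (rule bdd_aboveI2)
    fix z assume "z \<in> {0..1::real} \<times> {0..1::real}"
    then show "?e f z \<le> d + b"
      using d[of "fst z" "snd z"] g[of "fst z" "snd z"]
      by (auto simp: case_prod_beta)
  qed
  then have "?e f (x, y) \<le> sup_err2 g f"
    unfolding sup_err2_def using xy by (intro cSUP_upper) auto
  also have "\<dots> \<le> sup_err2 g f'"
    using best cand by (auto simp: best_approx2_def)
  also have "\<dots> \<le> c"
    unfolding sup_err2_def using err by (intro cSUP_least) auto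
  finally show ?thesis by simp
qed

lemma poly_space2_weighted_sum:
  assumes "degree b \<le> K" "\<And>m. f m \<in> poly_space2 m"
  shows "(\<Sum>m\<le>degree b. const2 (coeff b m) * f m) \<in> poly_space2 K"
proof -
  have 0: "0 \<in> poly_space2 K" by (simp add: poly_space2_def)
  have "const2 (coeff b m) * f m \<in> poly_space2 K" if "m \<le> degree b" for m
    using poly_space2_mult[OF poly_space2_const2[of "coeff b m" 0] assms(2)[of m]] that assms(1)
    by (auto intro: poly_space2_mono)
  then have "\<And>A. A \<subseteq> {..degree b} \<Longrightarrow> (\<Sum>m\<in>A. const2 (coeff b m) * f m) \<in> poly_space2 K"
  proof -
    fix A assume "A \<subseteq> {..degree b}"
    then have "finite A" by (auto intro: finite_subset)
    then show "(\<Sum>m\<in>A. const2 (coeff b m) * f m) \<in> poly_space2 K" 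
      using \<open>A \<subseteq> _\<close> \<open>\<And>m. m \<le> degree b \<Longrightarrow> _\<close>
      by (induction A rule: finite_induct) (auto intro!: poly_space2_add 0)
  qed
  then show ?thesis by blast
qed

lemma poly_space2_power: "f \<in> poly_space2 1 \<Longrightarrow> f ^ m \<in> poly_space2 m"
  by (induction m) (use poly_space2_mult[of f 1] poly_space2_const2[of 1 0] in \<open>auto simp: const2_def one_pCons\<close>)

lemma poly_space2_vars [simp]: "X2 \<in> poly_space2 (Suc 0)" "Y2 \<in> poly_space2 (Suc 0)"
  using poly_space2_X2[of 0] poly_space2_Y2[of 0] by auto

definition subst2 :: "real poly \<Rightarrow> real poly poly \<Rightarrow> real poly poly" where
  "subst2 b f = (\<Sum>m\<le>degree b. const2 (coeff b m) * f ^ m)"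

lemma eval2_subst2 [simp]: "eval2 (subst2 b f) x y = poly b (eval2 f x y)"
  by (simp add: subst2_def eval2_sum poly_altdef)

lemma poly_space2_subst2: "f \<in> poly_space2 1 \<Longrightarrow> degree b \<le> K \<Longrightarrow> subst2 b f \<in> poly_space2 K"
  unfolding subst2_def by (intro poly_space2_weighted_sum poly_space2_power)

text \<open>With \<open>x = s\<^sup>2\<close> and \<open>y = t\<^sup>2\<close> this is the symmetric expression \<open>a ^ m + b ^ m\<close> in
  \<open>a = ((s + t) / 2)\<^sup>2\<close> and \<open>b = ((s - t) / 2)\<^sup>2\<close>. It is a polynomial in \<open>x\<close> and \<open>y\<close> because \<open>a + b = (x + y) / 2\<close> and
  \<open>a * b = (x - y)\<^sup>2 / 16\<close>, and the recursion is Newton's for the roots \<open>a\<close> and \<open>b\<close>.\<close>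

fun half_power_sum :: "nat \<Rightarrow> real poly poly" where
  "half_power_sum 0 = const2 2"
| "half_power_sum (Suc 0) = const2 (1/2) * (X2 + Y2)"
| "half_power_sum (Suc (Suc m)) = const2 (1/2) * (X2 + Y2) * half_power_sum (Suc m)
     - const2 (1/16) * (X2 - Y2)\<^sup>2 * half_power_sum m"

lemma poly_space2_half_power_sum: "half_power_sum m \<in> poly_space2 m"
proof (induction m rule: half_power_sum.induct)
  case 1
  show ?case by (simp add: poly_space2_const2)
next
  case 2
  have "const2 (1/2) * (X2 + Y2) \<in> poly_space2 (0 + 1)"
    by (intro poly_space2_mult poly_space2_const2 poly_space2_add) auto
  then show ?case by simp
next
  case (3 m)
  have "const2 (1/2) * (X2 + Y2) * half_power_sum (Suc m) \<in> poly_space2 (0 + 1 + Suc m)"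
    by (intro poly_space2_mult poly_space2_const2 poly_space2_add 3) auto
  moreover have "const2 (1/16) * (X2 - Y2)\<^sup>2 * half_power_sum m \<in> poly_space2 (0 + 2 + m)"
    by (intro poly_space2_mult poly_space2_const2 poly_space2_power poly_space2_diff 3) auto
  ultimately show ?case
    by (auto intro: poly_space2_diff)
qed

lemma eval2_half_power_sum:
  assumes "s\<^sup>2 = x" "t\<^sup>2 = y"
  shows "eval2 (half_power_sum m) x y = (((s + t) / 2)\<^sup>2) ^ m + (((s - t) / 2)\<^sup>2) ^ m"
proof (induction m rule: half_power_sum.induct)
  case (3 m)
  define a where "a = ((s + t) / 2)\<^sup>2"
  define b where "b = ((s - t) / 2)\<^sup>2"
  have ab: "a + b = (x + y) / 2" "a * b = (x - y)\<^sup>2 / 16"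
    by (auto simp: a_def b_def assms[symmetric] power2_eq_square field_simps)
  have "eval2 (half_power_sum (Suc (Suc m))) x y
    = (a + b) * (a ^ Suc m + b ^ Suc m) - (a * b) * (a ^ m + b ^ m)"
    using 3 unfolding ab by (simp add: a_def b_def)
  also have "\<dots> = a ^ Suc (Suc m) + b ^ Suc (Suc m)"
    by (simp add: algebra_simps)
  finally show ?case by (simp add: a_def b_def)
qed (auto simp: assms[symmetric] power2_eq_square field_simps)

lemma best_approx2_sqrt_sum_error:
  assumes "best_approx2 K (\<lambda>x y. sqrt x + sqrt y) u" "K \<ge> 1" "x \<in> {0..1}" "y \<in> {0..1}"
  shows "\<bar>eval2 u x y - (sqrt x + sqrt y)\<bar> \<le> 2 / real K"
proof (rule best_approx2_error[OF assms(1)])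
  let ?b = "abs_poly K"
  show "subst2 ?b X2 + subst2 ?b Y2 \<in> poly_space2 K"
    by (intro poly_space2_add poly_space2_subst2 degree_abs_poly) auto
  fix x y :: real assume xy: "x \<in> {0..1}" "y \<in> {0..1}"
  then have "\<bar>poly ?b x - sqrt x\<bar> \<le> 1 / real K" "\<bar>poly ?b y - sqrt y\<bar> \<le> 1 / real K"
    using abs_poly_error[OF assms(2), of "sqrt x"] abs_poly_error[OF assms(2), of "sqrt y"]
    by (auto simp: order.trans[of _ 0])
  then show "\<bar>eval2 (subst2 ?b X2 + subst2 ?b Y2) x y - (sqrt x + sqrt y)\<bar> \<le> 2 / real K"
    by (simp add: abs_le_iff)
  show "\<bar>sqrt x + sqrt y\<bar> \<le> 2"
    using xy add_mono[of "sqrt x" 1 "sqrt y" 1] by simp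
qed (use assms in auto)

lemma symmetrised_error_bound:
  fixes a :: real
  assumes "\<bar>A - a\<bar> \<le> e" "\<bar>B - b\<bar> \<le> e" "\<bar>C - (a + b) / 2\<bar> \<le> e" "\<bar>D - w / 2\<bar> \<le> e"
  shows "\<bar>2 * (C + D) - (A + B) - w\<bar> \<le> 6 * e"
proof -
  have "A - a \<le> e" "a - A \<le> e" "B - b \<le> e" "b - B \<le> e" "C - (a + b) / 2 \<le> e" "(a + b) / 2 - C \<le> e"
    "D - w / 2 \<le> e" "w / 2 - D \<le> e"
    using assms unfolding abs_le_iff by auto
  then show ?thesis
    unfolding abs_le_iff by (auto simp: field_simps)
qed

text \<open>For nonnegative \<open>s = sqrt x\<close> and \<open>t = sqrt y\<close> the identity
  \<open>\<bar>s - t\<bar> = \<bar>s + t\<bar> + \<bar>s - t\<bar> - s - t\<close> reduces the bivariate problem to the univariate one. Replacing each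
  modulus by its even polynomial approximation gives a function that is even in \<open>s\<close> and in \<open>t\<close>, hence a
  polynomial in \<open>x\<close> and \<open>y\<close>, and of degree at most \<open>K\<close>. The arguments \<open>s + t\<close> and \<open>s - t\<close> are halved to stay in
  \<open>[-1, 1]\<close>.\<close>

lemma best_approx2_sqrt_diff_error:
  assumes "best_approx2 K (\<lambda>x y. \<bar>sqrt x - sqrt y\<bar>) v" "K \<ge> 1" "x \<in> {0..1}" "y \<in> {0..1}"
  shows "\<bar>eval2 v x y - \<bar>sqrt x - sqrt y\<bar>\<bar> \<le> 6 / real K"
proof (rule best_approx2_error[OF assms(1)])
  let ?b = "abs_poly K"
  let ?h = "\<Sum>m\<le>degree ?b. const2 (coeff ?b m) * half_power_sum m"
  let ?f = "const2 2 * ?h - (subst2 ?b X2 + subst2 ?b Y2)"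
  have "const2 2 * ?h \<in> poly_space2 (0 + K)"
    by (intro poly_space2_mult poly_space2_const2 poly_space2_weighted_sum degree_abs_poly poly_space2_half_power_sum)
  then show "?f \<in> poly_space2 K"
    by (intro poly_space2_diff poly_space2_add poly_space2_subst2 degree_abs_poly) auto
  fix x y :: real assume xy: "x \<in> {0..1}" "y \<in> {0..1}"
  define s where "s = sqrt x"
  define t where "t = sqrt y"
  have st: "s\<^sup>2 = x" "t\<^sup>2 = y" "s \<in> {0..1}" "t \<in> {0..1}" using xy by (auto simp: s_def t_def)
  have "eval2 ?h x y = (\<Sum>m\<le>degree ?b. coeff ?b m * ((((s + t) / 2)\<^sup>2) ^ m + (((s - t) / 2)\<^sup>2) ^ m))"
    using st by (simp add: eval2_sum eval2_half_power_sum[of s x t y])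
  also have "\<dots> = poly ?b (((s + t) / 2)\<^sup>2) + poly ?b (((s - t) / 2)\<^sup>2)"
    by (simp only: poly_altdef distrib_left sum.distrib)
  finally have h: "eval2 ?h x y = poly ?b (((s + t) / 2)\<^sup>2) + poly ?b (((s - t) / 2)\<^sup>2)" .
  have "\<bar>poly ?b (s\<^sup>2) - \<bar>s\<bar>\<bar> \<le> 1 / real K" "\<bar>poly ?b (t\<^sup>2) - \<bar>t\<bar>\<bar> \<le> 1 / real K"
    "\<bar>poly ?b (((s + t) / 2)\<^sup>2) - \<bar>(s + t) / 2\<bar>\<bar> \<le> 1 / real K" 
    "\<bar>poly ?b (((s - t) / 2)\<^sup>2) - \<bar>(s - t) / 2\<bar>\<bar> \<le> 1 / real K"
    using st by (intro abs_poly_error assms(2); auto)+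
  moreover have "\<bar>(s + t) / 2\<bar> = (s + t) / 2" "\<bar>(s - t) / 2\<bar> = \<bar>s - t\<bar> / 2" "\<bar>s\<bar> = s" "\<bar>t\<bar> = t"
    using st by auto
  moreover have "eval2 ?f x y = 2 * (poly ?b (((s + t) / 2)\<^sup>2) + poly ?b (((s - t) / 2)\<^sup>2)) - (poly ?b (s\<^sup>2) + poly ?b (t\<^sup>2))"
    using h st by simp
  ultimately have "\<bar>eval2 ?f x y - \<bar>s - t\<bar>\<bar> \<le> 6 * (1 / real K)"
    by (simp only: symmetrised_error_bound)
  then show "\<bar>eval2 ?f x y - \<bar>sqrt x - sqrt y\<bar>\<bar> \<le> 6 / real K"
    by (simp add: s_def t_def)
  show "\<bar>\<bar>sqrt x - sqrt y\<bar>\<bar> \<le> 1"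
    using st by (auto simp: s_def[symmetric] t_def[symmetric])
qed (use assms in auto)

section \<open>Bias and second moment of the polynomial estimators\<close>

lemma eval2_altdef:
  assumes "h \<in> poly_space2 N"
  shows "eval2 h x y = (\<Sum>(s, r)\<in>{..N} \<times> {..N}. coeff (coeff h s) r * (x ^ r * y ^ s))"
proof -
  have deg: "degree h \<le> N" "\<And>s. degree (coeff h s) \<le> N"
    using assms by (auto simp: poly_space2_def)
  have 1: "poly q t = (\<Sum>r\<le>N. coeff q r * t ^ r)" if "degree q \<le> N" for q :: "real poly" and t
    unfolding poly_altdef using that by (intro sum.mono_neutral_left) (auto simp: coeff_eq_0)
  have "poly h [:y:] = (\<Sum>s\<le>N. coeff h s * [:y:] ^ s)"
    unfolding poly_altdef using deg by (intro sum.mono_neutral_left) (auto simp: coeff_eq_0)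
  then have "eval2 h x y = (\<Sum>s\<le>N. poly (coeff h s) x * y ^ s)"
    by (simp add: eval2_def poly_sum)
  then show ?thesis
    by (simp add: 1 deg sum_distrib_right mult.assoc flip: sum.cartesian_product)
qed

lemma expectation_unbiased_P1:
  assumes "n > 0" "B > 0" "h \<in> poly_space2 N" "0 \<le> p" "0 \<le> q"
  shows "measure_pmf.expectation (Poi2 (n * p) (n * q))
    (\<lambda>z. unbiased2 n (rescale2 B h) (real (fst z) / n) (real (snd z) / n)) = B * eval2 h (p / B) (q / B)"
proof -
  let ?M = "measure_pmf (Poi2 (n * p) (n * q))"
  let ?g = "\<lambda>r s z. diff_ff r (real (fst z)) 0 * diff_ff s (real (snd z)) 0"
  have int: "integrable ?M (?g r s)" for r s
    using assms by (intro poly_growth_integrable[of "\<lambda>x y. diff_ff r (real x) 0 * diff_ff s (real y) 0"]) auto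
  have "measure_pmf.expectation (Poi2 (n * p) (n * q))
    (\<lambda>z. unbiased2 n (rescale2 B h) (real (fst z) / n) (real (snd z) / n))
   = (\<Sum>(s, r)\<in>{..N} \<times> {..N}. (B * coeff (coeff h s) r) * ((n * p) ^ r * (n * q) ^ s / (n * B) ^ (r + s)))"
    using assms int by (simp add: unbiased2_rescale2[of n B h N] case_prod_beta expectation_ff_ff integral_sum)
  also have "\<dots> = (\<Sum>(s, r)\<in>{..N} \<times> {..N}. B * (coeff (coeff h s) r * ((p / B) ^ r * (q / B) ^ s)))"
    using assms by (intro sum.cong refl) (auto simp: power_mult_distrib power_add power_divide field_simps)
  also have "\<dots> = B * eval2 h (p / B) (q / B)"
    unfolding eval2_altdef[OF assms(3)] by (simp add: sum_distrib_left case_prod_beta)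
  finally show ?thesis .
qed

text \<open>All rates are at most \<open>n * B\<close>, and so are the degrees. Then the falling factorial of order \<open>r\<close> has second
  moment at most \<open>(2 * n * B) ^ (2 * r)\<close>, which the rescaling by \<open>n * B\<close> turns into \<open>4 ^ r\<close>.\<close>

lemma second_moment_unbiased_P1:
  assumes n: "n > 0" and B: "B > 0" and h: "h \<in> poly_space2 N" and pq: "0 \<le> p" "p \<le> B" "0 \<le> q" "q \<le> B"
    and N: "real N \<le> n * B" and c: "\<And>r s. \<bar>coeff (coeff h s) r\<bar> \<le> c"
  shows "measure_pmf.expectation (Poi2 (n * p) (n * q))
    (\<lambda>z. (unbiased2 n (rescale2 B h) (real (fst z) / n) (real (snd z) / n))\<^sup>2) 
    \<le> (B * c)\<^sup>2 * real (Suc N) ^ 4 * 16 ^ N"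
proof -
  let ?M = "measure_pmf (Poi2 (n * p) (n * q))"
  let ?J = "{..N} \<times> {..N}"
  let ?Z = "\<lambda>(s, r) z. diff_ff r (real (fst z)) 0 * diff_ff s (real (snd z)) 0 / (n * B) ^ (r + s)"
  have nB: "n * B > 0" using n B by simp
  have mom: "ff_moment l 0 r r / (n * B) ^ (2 * r) \<le> 4 ^ r" if l: "0 \<le> l" "l \<le> n * B" and r: "r \<le> N" for l r
  proof -
    have "ff_moment l 0 r r \<le> \<bar>ff_moment l 0 r r\<bar>" by simp
    also have "\<dots> \<le> (\<bar>l\<bar> + sqrt (real N * l)) ^ (2 * r)"
      using ff_moment_bound[of l 0 r N r] l r by (simp add: mult_2)
    also have "\<dots> \<le> (2 * (n * B)) ^ (2 * r)"
    proof (intro power_mono)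
      have "real N * l \<le> (n * B) * (n * B)" using N l by (intro mult_mono) auto
      then have "sqrt (real N * l) \<le> n * B"
        using nB by (intro real_le_lsqrt) (auto simp: power2_eq_square l)
      then show "\<bar>l\<bar> + sqrt (real N * l) \<le> 2 * (n * B)" using l by simp
    qed (use l in auto)
    also have "\<dots> = 4 ^ r * (n * B) ^ (2 * r)"
      by (subst power_mult_distrib) (simp add: power_mult)
    finally show ?thesis
      by (subst pos_divide_le_eq) (use nB in auto)
  qed
  have sq: "(?Z (s, r) z)\<^sup>2 = (diff_ff r (real (fst z)) 0 * diff_ff s (real (snd z)) 0)\<^sup>2 / ((n * B) ^ (2 * r) * (n * B) ^ (2 * s))" for s r z
    by (simp add: power_divide power_add power_mult_distrib power_mult power2_eq_square mult_ac)
  have E: "measure_pmf.expectation (Poi2 (n * p) (n * q)) (\<lambda>z. (?Z j z)\<^sup>2) \<le> 16 ^ N" if jJ: "j \<in> ?J" for j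
  proof -
    obtain s r where j: "j = (s, r)" "s \<le> N" "r \<le> N" using jJ by auto
    have "measure_pmf.expectation (Poi2 (n * p) (n * q)) (\<lambda>z. (?Z j z)\<^sup>2)
       = (ff_moment (n * p) 0 r r / (n * B) ^ (2 * r)) * (ff_moment (n * q) 0 s s / (n * B) ^ (2 * s))"
      unfolding j sq using n pq by (simp add: second_moment_ff_ff)
    also have "\<dots> \<le> 4 ^ r * 4 ^ s"
      using n pq j nB by (intro mult_mono mom) (auto simp: ff_moment_def)
    also have "\<dots> \<le> 4 ^ N * (4::real) ^ N"
      using j by (intro mult_mono power_increasing) auto
    also have "\<dots> = 16 ^ N" by (simp flip: power_mult_distrib)
    finally show ?thesis .
  qed
  have int: "integrable ?M (\<lambda>z. (?Z j z)\<^sup>2)" for j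
  proof -
    obtain s r where j: "j = (s, r)" by fastforce
    have "integrable ?M (\<lambda>z. (diff_ff r (real (fst z)) 0 * diff_ff s (real (snd z)) 0)\<^sup>2)"
      using n pq by (intro poly_growth_integrable[of "\<lambda>x y. (diff_ff r (real x) 0 * diff_ff s (real y) 0)\<^sup>2"]) auto
    then show ?thesis unfolding j sq by (rule integrable_divide)
  qed
  have "measure_pmf.expectation (Poi2 (n * p) (n * q))
    (\<lambda>z. (unbiased2 n (rescale2 B h) (real (fst z) / n) (real (snd z) / n))\<^sup>2) 
    = measure_pmf.expectation (Poi2 (n * p) (n * q)) (\<lambda>z. (\<Sum>j\<in>?J. (B * coeff (coeff h (fst j)) (snd j)) * ?Z j z)\<^sup>2)"
    using n B h by (simp add: unbiased2_rescale2[of n B h N] case_prod_beta)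
  also have "\<dots> \<le> (\<Sum>j\<in>?J. \<bar>B * coeff (coeff h (fst j)) (snd j)\<bar>)\<^sup>2 * 16 ^ N"
    by (intro second_moment_weighted_sum int E) auto
  also have "\<dots> \<le> (\<Sum>j\<in>?J. B * c)\<^sup>2 * 16 ^ N"
    using c B by (intro mult_right_mono power_mono sum_mono sum_nonneg) (auto simp: abs_mult)
  also have "(\<Sum>j\<in>?J. B * c)\<^sup>2 = (B * c)\<^sup>2 * real (Suc N) ^ 4"
    by (simp add: power_mult_distrib power2_eq_square power4_eq_xxxx algebra_simps)
  finally show ?thesis .
qed

lemma expectation_diff_ff:
  assumes "0 \<le> l" "0 \<le> m"
  shows "measure_pmf.expectation (Poi2 l m) (\<lambda>z. diff_ff j (real (fst z)) (real (snd z))) = (l - m) ^ j"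
  using ff_moment_0(1)[OF assms, of j] by (simp add: ff_moment_def)

lemma expectation_unbiased_P2:
  assumes "n > 0" "W_scale c1 n a b > 0" "degree R \<le> K" "0 \<le> p" "0 \<le> q"
  shows "measure_pmf.expectation (Poi2 (n * p) (n * q))
    (\<lambda>z. unbiased2 n (P2_poly c1 n K R a b) (real (fst z) / n) (real (snd z) / n)) 
    = W_scale c1 n a b * poly R ((p - q) / W_scale c1 n a b)"
proof -
  define W where "W = W_scale c1 n a b"
  have W: "W > 0" using assms by (simp add: W_def)
  have int: "integrable (measure_pmf (Poi2 (n * p) (n * q))) (\<lambda>z. diff_ff j (real (fst z)) (real (snd z)))" for j
    using assms by (intro poly_growth_integrable[of "\<lambda>x y. diff_ff j (real x) (real y)"]) auto
  have "measure_pmf.expectation (Poi2 (n * p) (n * q))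
    (\<lambda>z. unbiased2 n (P2_poly c1 n K R a b) (real (fst z) / n) (real (snd z) / n)) 
    = (\<Sum>j\<le>K. W * coeff R j * ((n * p - n * q) ^ j / (n * W) ^ j))"
    using assms W int by (simp add: unbiased2_P2_poly W_def[symmetric] expectation_diff_ff integral_sum)
  also have "\<dots> = (\<Sum>j\<le>K. W * (coeff R j * ((p - q) / W) ^ j))"
    using assms(1) by (intro sum.cong refl)
      (simp add: power_mult_distrib power_divide flip: right_diff_distrib)
  also have "\<dots> = W * (\<Sum>j\<le>degree R. coeff R j * ((p - q) / W) ^ j)"
    unfolding sum_distrib_left[symmetric]
    using assms(3) by (intro arg_cong[where f = "\<lambda>t. W * t"] sum.mono_neutral_right) (auto simp: coeff_eq_0)
  finally show ?thesis by (simp add: poly_altdef W_def)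
qed

text \<open>The rates may be arbitrarily large here. What matters is that their difference and the standard
  deviation of the difference of the counts, enlarged by the factor \<open>sqrt K\<close>, are at most \<open>n * W\<close>.\<close>

lemma second_moment_unbiased_P2:
  assumes n: "n > 0" and W0: "W_scale c1 n a b > 0" and pq: "0 \<le> p" "0 \<le> q" 
    and d: "\<bar>p - q\<bar> \<le> W_scale c1 n a b" and s: "real K * (p + q) \<le> n * (W_scale c1 n a b)\<^sup>2"
    and c: "\<And>j. \<bar>coeff R j\<bar> \<le> c"
  shows "measure_pmf.expectation (Poi2 (n * p) (n * q))
    (\<lambda>z. (unbiased2 n (P2_poly c1 n K R a b) (real (fst z) / n) (real (snd z) / n))\<^sup>2) 
    \<le> (W_scale c1 n a b * c)\<^sup>2 * (real (Suc K))\<^sup>2 * 4 ^ K"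
proof -
  define W where "W = W_scale c1 n a b"
  have W: "W > 0" "n * W > 0" using assms by (auto simp: W_def)
  let ?Z = "\<lambda>j z. diff_ff j (real (fst z)) (real (snd z)) / (n * W) ^ j"
  let ?M = "measure_pmf (Poi2 (n * p) (n * q))"
  have sq: "(?Z j z)\<^sup>2 = (diff_ff j (real (fst z)) (real (snd z)))\<^sup>2 / (n * W) ^ (2 * j)" for j z
    by (simp add: power_divide power_mult mult.commute)
  have int: "integrable ?M (\<lambda>z. (?Z j z)\<^sup>2)" for j
  proof -
    have "integrable ?M (\<lambda>z. (diff_ff j (real (fst z)) (real (snd z)))\<^sup>2)"
      using n pq by (intro poly_growth_integrable[of "\<lambda>x y. (diff_ff j (real x) (real y))\<^sup>2"]) auto
    then show ?thesis unfolding sq by (rule integrable_divide)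
  qed
  have E: "measure_pmf.expectation (Poi2 (n * p) (n * q)) (\<lambda>z. (?Z j z)\<^sup>2) \<le> 4 ^ K" if j: "j \<in> {..K}" for j
  proof -
    have "measure_pmf.expectation (Poi2 (n * p) (n * q)) (\<lambda>z. (?Z j z)\<^sup>2) = ff_moment (n * p) (n * q) j j / (n * W) ^ (2 * j)"
      unfolding sq ff_moment_def by (simp add: power2_eq_square)
    also have "\<dots> \<le> (\<bar>n * p - n * q\<bar> + sqrt (real K * (n * p + n * q))) ^ (2 * j) / (n * W) ^ (2 * j)"
      using ff_moment_bound[of "n * p" "n * q" j K j] n pq j W
      by (intro divide_right_mono) (auto simp: mult_2)
    also have "\<dots> \<le> (2 * (n * W)) ^ (2 * j) / (n * W) ^ (2 * j)"
    proof (intro divide_right_mono power_mono)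
      have "\<bar>n * p - n * q\<bar> = n * \<bar>p - q\<bar>" using n by (simp add: abs_mult flip: right_diff_distrib)
      also have "\<dots> \<le> n * W" using d n by (simp add: W_def)
      finally have 1: "\<bar>n * p - n * q\<bar> \<le> n * W" .
      have "real K * (n * p + n * q) = n * (real K * (p + q))" by (simp add: algebra_simps)
      also have "\<dots> \<le> n * (n * W\<^sup>2)" using s n by (simp add: W_def)
      also have "\<dots> = (n * W)\<^sup>2" by (simp add: power2_eq_square)
      finally have "sqrt (real K * (n * p + n * q)) \<le> n * W"
        using W by (intro real_le_lsqrt) auto
      then show "\<bar>n * p - n * q\<bar> + sqrt (real K * (n * p + n * q)) \<le> 2 * (n * W)"
        using 1 by simp
    qed (use W n pq in auto)
    also have "\<dots> = 4 ^ j"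
      using W n by (simp add: power_mult_distrib power_mult)
    also have "\<dots> \<le> 4 ^ K" using j by (intro power_increasing) auto
    finally show ?thesis .
  qed
  have "measure_pmf.expectation (Poi2 (n * p) (n * q))
    (\<lambda>z. (unbiased2 n (P2_poly c1 n K R a b) (real (fst z) / n) (real (snd z) / n))\<^sup>2) 
    = measure_pmf.expectation (Poi2 (n * p) (n * q)) (\<lambda>z. (\<Sum>j\<le>K. (W * coeff R j) * ?Z j z)\<^sup>2)"
    using n W by (simp add: unbiased2_P2_poly W_def)
  also have "\<dots> \<le> (\<Sum>j\<le>K. \<bar>W * coeff R j\<bar>)\<^sup>2 * 4 ^ K"
    by (intro second_moment_weighted_sum int E) auto
  also have "\<dots> \<le> (\<Sum>j\<le>K. W * c)\<^sup>2 * 4 ^ K"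
    using c W by (intro mult_right_mono power_mono sum_mono sum_nonneg) (auto simp: abs_mult)
  also have "(\<Sum>j\<le>K. W * c)\<^sup>2 = (W * c)\<^sup>2 * (real (Suc K))\<^sup>2"
    by (simp add: power_mult_distrib mult_ac)
  finally show ?thesis by (simp add: W_def)
qed

text \<open>Multiply the two approximations, using \<open>\<bar>x - y\<bar> = (sqrt x + sqrt y) * \<bar>sqrt x - sqrt y\<bar>\<close>. Since the first
  factor is small near the origin, the error is of order \<open>1 / K\<^sup>2\<close> there instead of \<open>1 / K\<close>. The same holds
  for the constant that is subtracted, because both factors vanish at the origin.\<close>

lemma h_poly_error:
  assumes u: "best_approx2 K (\<lambda>x y. sqrt x + sqrt y) u" and v: "best_approx2 K (\<lambda>x y. \<bar>sqrt x - sqrt y\<bar>) v"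
    and K: "K \<ge> 1" and xy: "x \<in> {0..1}" "y \<in> {0..1}"
  shows "\<bar>eval2 (h_poly u v) x y - \<bar>x - y\<bar>\<bar> \<le> 72 / (real K)\<^sup>2 + 12 * (sqrt x + sqrt y) / real K"
proof -
  define e where "e = 6 / real K"
  define f where "f x y = sqrt x + sqrt y" for x y
  define g where "g x y = \<bar>sqrt x - sqrt y\<bar>" for x y
  have e0: "e \<ge> 0" by (simp add: e_def)
  have ue: "\<bar>eval2 u x y - f x y\<bar> \<le> e" if "x \<in> {0..1}" "y \<in> {0..1}" for x y
    using best_approx2_sqrt_sum_error[OF u K that] divide_right_mono[of 2 6 "real K"] by (simp add: f_def e_def)
  have ve: "\<bar>eval2 v x y - g x y\<bar> \<le> e" if "x \<in> {0..1}" "y \<in> {0..1}" for x y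
    using best_approx2_sqrt_diff_error[OF v K that] by (simp add: g_def e_def)
  have gf: "0 \<le> g x y" "g x y \<le> f x y" using xy by (auto simp: f_def g_def abs_le_iff)
  have "f x y * g x y = \<bar>f x y * (sqrt x - sqrt y)\<bar>"
    using xy by (simp add: f_def g_def abs_mult)
  also have "f x y * (sqrt x - sqrt y) = x - y"
    using xy by (simp add: f_def algebra_simps)
  finally have fg: "f x y * g x y = \<bar>x - y\<bar>" .
  let ?du = "eval2 u x y - f x y" and ?dv = "eval2 v x y - g x y"
  have 0: "\<bar>eval2 u 0 0 * eval2 v 0 0\<bar> \<le> e * e"
    using ue[of 0 0] ve[of 0 0] unfolding abs_mult by (intro mult_mono) (auto simp: f_def g_def e0)
  have 1: "\<bar>?du * ?dv\<bar> \<le> e * e" "\<bar>f x y * ?dv\<bar> \<le> f x y * e" "\<bar>g x y * ?du\<bar> \<le> f x y * e"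
    using ue[OF xy] ve[OF xy] gf e0 unfolding abs_mult by (auto intro!: mult_mono)
  have "eval2 (h_poly u v) x y - \<bar>x - y\<bar> = ?du * ?dv + f x y * ?dv + g x y * ?du - eval2 u 0 0 * eval2 v 0 0"
    unfolding fg[symmetric] by (simp add: h_poly_def algebra_simps)
  then have "\<bar>eval2 (h_poly u v) x y - \<bar>x - y\<bar>\<bar> \<le> 2 * (e * e) + 2 * (f x y * e)"
    using 0 1 unfolding abs_le_iff by linarith
  also have "\<dots> = 72 / (real K)\<^sup>2 + 12 * f x y / real K"
    by (simp add: e_def power2_eq_square)
  finally show ?thesis by (simp add: f_def)
qed

lemma coeff_h_poly_bound:
  assumes u: "best_approx2 K (\<lambda>x y. sqrt x + sqrt y) u" and v: "best_approx2 K (\<lambda>x y. \<bar>sqrt x - sqrt y\<bar>) v"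
    and K: "K \<ge> 1"
  shows "h_poly u v \<in> poly_space2 (2 * K)" "\<bar>coeff (coeff (h_poly u v) s) r\<bar> \<le> 100 * 144 ^ (2 * K)"
proof -
  show sp: "h_poly u v \<in> poly_space2 (2 * K)"
    unfolding h_poly_def mult_2 using u v
    by (intro poly_space2_diff poly_space2_mult poly_space2_const2) (auto simp: best_approx2_def)
  show "\<bar>coeff (coeff (h_poly u v) s) r\<bar> \<le> 100 * 144 ^ (2 * K)"
  proof (rule coeff2_bound_unit_square[OF sp])
    fix x y :: real assume xy: "x \<in> {0..1}" "y \<in> {0..1}"
    have "72 / (real K)\<^sup>2 \<le> 72 / 1"
      using K by (intro divide_left_mono) auto
    moreover have "12 * (sqrt x + sqrt y) / real K \<le> 24 / 1"
      using K xy add_mono[of "sqrt x" 1 "sqrt y" 1] by (intro frac_le) auto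
    moreover have "\<bar>x - y\<bar> \<le> 1" using xy by auto
    ultimately show "\<bar>eval2 (h_poly u v) x y\<bar> \<le> 100"
      using h_poly_error[OF u v K xy] by linarith
  qed
qed

lemma coeff_best_approx1_bound:
  assumes R: "best_approx1 K (\<lambda>t. \<bar>t\<bar>) R" and K: "K \<ge> 1"
  shows "\<bar>coeff R j\<bar> \<le> 4 * 12 ^ K"
proof (rule coeff_bound_unit_interval)
  show "degree R \<le> K" using R by (simp add: best_approx1_def)
  fix t :: real assume t: "t \<in> {0..1}"
  have "3 / real K \<le> 3 / 1" using K by (intro divide_left_mono) auto
  then show "\<bar>poly R t\<bar> \<le> 4"
    using best_approx1_abs_error[OF R K, of t] t by auto
qed

section \<open>The contribution of one symbol\<close>

text \<open>One summand of \<open>L_tilde\<close> as a function of the first-half frequencies \<open>a\<close>, \<open>b\<close>, which select the estimator,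
  and of the second-half frequencies \<open>x\<close>, \<open>y\<close>, to which the selected estimator is applied.\<close>

definition symbol_term ::
  "real \<Rightarrow> real \<Rightarrow> real \<Rightarrow> nat \<Rightarrow> real poly poly \<Rightarrow> real poly poly \<Rightarrow> real poly
    \<Rightarrow> real \<Rightarrow> real \<Rightarrow> real \<Rightarrow> real \<Rightarrow> real" where
  "symbol_term c1 c3 n K u v R a b x y =
       (x - y) * of_bool (a - b > tau c1 c3 n * (sqrt a + sqrt b))
     + (y - x) * of_bool (a - b < - tau c1 c3 n * (sqrt a + sqrt b))
     + unbiased2 n (P1_poly c1 n u v) x y * of_bool (a + b < c1 * ln n / n)
     + unbiased2 n (P2_poly c1 n K R a b) x y *
         of_bool ((a, b) \<in> U1 c1 c3 n \<and> a + b \<ge> c1 * ln n / n)"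

text \<open>The four indicators are those of a partition. On the scale of square roots the conditions that
  involve \<open>tau\<close> compare \<open>sqrt a - sqrt b\<close> with \<open>tau\<close>. If the modulus of this difference exceeds \<open>tau\<close>, then
  \<open>a + b \<ge> tau\<^sup>2 > c1 * ln n / n\<close>; here \<open>c3 > 0\<close> enters.\<close>

lemma symbol_term_cases:
  fixes n c1 c3 a b :: real and u v :: "real poly poly" and R :: "real poly" and K :: nat
  defines "T \<equiv> symbol_term c1 c3 n K u v R a b"
  assumes "a \<ge> 0" "b \<ge> 0" "c1 > 0" "c3 > 0" "n > 1"
  obtains (small) "a + b < c1 * ln n / n" "T = (\<lambda>x y. unbiased2 n (P1_poly c1 n u v) x y)"
  | (above) "a + b \<ge> c1 * ln n / n" "sqrt a - sqrt b > tau c1 c3 n" "T = (\<lambda>x y. x - y)"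
  | (below) "a + b \<ge> c1 * ln n / n" "sqrt b - sqrt a > tau c1 c3 n" "T = (\<lambda>x y. y - x)"
  | (close) "a + b \<ge> c1 * ln n / n" "\<bar>sqrt a - sqrt b\<bar> \<le> tau c1 c3 n"
      "T = (\<lambda>x y. unbiased2 n (P2_poly c1 n K R a b) x y)"
proof -
  let ?t = "tau c1 c3 n" and ?r = "sqrt a + sqrt b"
  have L: "ln n / n > 0" using assms by simp
  have t: "?t > 0" "?t\<^sup>2 = (c1 + c3) * ln n / n"
    using assms L by (auto simp: tau_def)
  have t1: "?t\<^sup>2 \<ge> c1 * ln n / n"
    using assms L t by (simp add: distrib_right add_divide_distrib)
  have r: "?r \<ge> 0" using assms by simp
  have ab: "a - b = (sqrt a - sqrt b) * ?r"
    using assms by (simp add: algebra_simps)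
  have pos: "a - b > ?t * ?r \<longleftrightarrow> sqrt a - sqrt b > ?t"
  proof
    show "sqrt a - sqrt b > ?t" if "a - b > ?t * ?r"
      using that r unfolding ab by (meson mult_right_less_imp_less)
    assume *: "sqrt a - sqrt b > ?t"
    then have "?r > 0" using t assms by (smt (verit) real_sqrt_ge_zero)
    then show "a - b > ?t * ?r" unfolding ab using * by (rule mult_strict_right_mono[rotated])
  qed
  have neg: "a - b < - ?t * ?r \<longleftrightarrow> sqrt b - sqrt a > ?t"
  proof
    show "sqrt b - sqrt a > ?t" if "a - b < - ?t * ?r"
    proof -
      have "(sqrt a - sqrt b) < - ?t" using that r unfolding ab by (meson mult_right_less_imp_less)
      then show ?thesis by simp
    qed
    assume *: "sqrt b - sqrt a > ?t"
    then have "?r > 0" using t assms by (smt (verit) real_sqrt_ge_zero)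
    then show "a - b < - ?t * ?r" unfolding ab using * by (intro mult_strict_right_mono) auto
  qed
  have U: "(a, b) \<in> U1 c1 c3 n \<longleftrightarrow> \<bar>sqrt a - sqrt b\<bar> \<le> ?t"
  proof -
    have "(a, b) \<in> U1 c1 c3 n \<longleftrightarrow> \<not> (a - b > ?t * ?r) \<and> \<not> (a - b < - ?t * ?r)"
      by (auto simp: U1_def tau_def abs_le_iff)
    also have "\<dots> \<longleftrightarrow> \<bar>sqrt a - sqrt b\<bar> \<le> ?t"
      unfolding pos neg by (auto simp: abs_le_iff)
    finally show ?thesis .
  qed
  have big: "a + b \<ge> c1 * ln n / n" if "\<bar>sqrt a - sqrt b\<bar> > ?t"
  proof -
    have "?t\<^sup>2 \<le> (sqrt a - sqrt b)\<^sup>2"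
      using that t by (metis abs_le_square_iff abs_of_pos less_imp_le)
    also have "\<dots> \<le> a + b" using assms by (simp add: power2_diff)
    finally show ?thesis using t1 by linarith
  qed
  have T: "T = (\<lambda>x y. (x - y) * of_bool (sqrt a - sqrt b > ?t) + (y - x) * of_bool (sqrt b - sqrt a > ?t)
     + unbiased2 n (P1_poly c1 n u v) x y * of_bool (a + b < c1 * ln n / n)
     + unbiased2 n (P2_poly c1 n K R a b) x y * of_bool (\<bar>sqrt a - sqrt b\<bar> \<le> ?t \<and> a + b \<ge> c1 * ln n / n))"
    unfolding T_def symbol_term_def[abs_def] pos neg U ..
  consider "a + b < c1 * ln n / n" | "a + b \<ge> c1 * ln n / n" "sqrt a - sqrt b > ?t"
    | "a + b \<ge> c1 * ln n / n" "sqrt b - sqrt a > ?t" | "a + b \<ge> c1 * ln n / n" "\<bar>sqrt a - sqrt b\<bar> \<le> ?t"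
    by linarith
  then show ?thesis
  proof cases
    case 1
    then have "\<not> \<bar>sqrt a - sqrt b\<bar> > ?t" using big by linarith
    then have "\<not> sqrt a - sqrt b > ?t" "\<not> sqrt b - sqrt a > ?t" by linarith+
    then show ?thesis using 1 small by (simp add: T)
  next
    case 2
    then have "\<not> sqrt b - sqrt a > ?t" "\<not> \<bar>sqrt a - sqrt b\<bar> \<le> ?t" using t by auto
    then show ?thesis using 2 above by (simp add: T)
  next
    case 3
    then have "\<not> sqrt a - sqrt b > ?t" "\<not> \<bar>sqrt a - sqrt b\<bar> \<le> ?t" using t by auto
    then show ?thesis using 3 below by (simp add: T)
  next
    case 4
    then have "\<not> sqrt a - sqrt b > ?t" "\<not> sqrt b - sqrt a > ?t" by auto
    then show ?thesis using 4 close by (simp add: T)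
  qed
qed

lemma poly_growth_unbiased2: 
  "poly_growth (\<lambda>x y. unbiased2 n f (real x / n) (real y / n))"
  unfolding unbiased2_def divide_inverse
  by (intro poly_growth_sum poly_growth_mult poly_growth_prod poly_growth_diff poly_growth_const
      poly_growth_fst poly_growth_snd)

lemma poly_growth_symbol_term: 
  "poly_growth (\<lambda>x y. symbol_term c1 c3 n K u v R a b (real x / n) (real y / n))"
proof -
  have "poly_growth (\<lambda>x y. real x / n)" "poly_growth (\<lambda>x y. real y / n)"
    unfolding divide_inverse by auto
  then show ?thesis
    unfolding symbol_term_def by (auto intro!: poly_growth_unbiased2)
qed

lemma linear_moments:
  assumes "n > 0" "0 \<le> p" "0 \<le> q"
  shows "measure_pmf.expectation (Poi2 (n * p) (n * q)) (\<lambda>z. real (fst z) / n - real (snd z) / n) = p - q"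
    and "measure_pmf.expectation (Poi2 (n * p) (n * q)) (\<lambda>z. (real (fst z) / n - real (snd z) / n - (p - q))\<^sup>2) = (p + q) / n"
proof -
  let ?M = "measure_pmf (Poi2 (n * p) (n * q))"
  have lm: "0 \<le> n * p" "0 \<le> n * q" using assms by auto
  have d: "diff_ff 1 x y = x - y" for x y by simp
  have i1: "integrable ?M (\<lambda>z. real (fst z) - real (snd z))"
    using lm by (intro poly_growth_integrable[of "\<lambda>x y. real x - real y"]) auto
  have i2: "integrable ?M (\<lambda>z. (real (fst z) - real (snd z))\<^sup>2)"
    using lm by (intro poly_growth_integrable[of "\<lambda>x y. (real x - real y)\<^sup>2"]) auto
  have E1: "measure_pmf.expectation (Poi2 (n * p) (n * q)) (\<lambda>z. real (fst z) - real (snd z)) = n * p - n * q"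
    using expectation_diff_ff[OF lm, of 1] by (simp add: d)
  have "ff_moment (n * p) (n * q) (Suc 0) 1 = (n * p - n * q)\<^sup>2 + (n * p + n * q)"
    unfolding ff_moment_Suc[OF lm] using lm by (simp add: ff_moment_0 power2_eq_square)
  then have E2: "measure_pmf.expectation (Poi2 (n * p) (n * q)) (\<lambda>z. (real (fst z) - real (snd z))\<^sup>2)
     = (n * p - n * q)\<^sup>2 + (n * p + n * q)"
    by (simp add: ff_moment_def power2_eq_square)
  show "measure_pmf.expectation (Poi2 (n * p) (n * q)) (\<lambda>z. real (fst z) / n - real (snd z) / n) = p - q"
    unfolding diff_divide_distrib[symmetric] using assms E1 i1 by (simp flip: right_diff_distrib)
  define D where "D z = real (fst z) - real (snd z)" for z :: "nat \<times> nat"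
  define c where "c = n * p - n * q"
  have "(real (fst z) / n - real (snd z) / n - (p - q))\<^sup>2 = ((D z)\<^sup>2 - 2 * c * D z + c\<^sup>2) / n\<^sup>2" for z
    using assms unfolding D_def c_def by (simp add: field_simps power2_eq_square)
  then have "measure_pmf.expectation (Poi2 (n * p) (n * q)) (\<lambda>z. (real (fst z) / n - real (snd z) / n - (p - q))\<^sup>2)
      = (c\<^sup>2 + (n * p + n * q) - 2 * c * c + c\<^sup>2) / n\<^sup>2"
    using i1 i2 E1 E2 by (simp flip: D_def c_def)
  then show "measure_pmf.expectation (Poi2 (n * p) (n * q)) (\<lambda>z. (real (fst z) / n - real (snd z) / n - (p - q))\<^sup>2) = (p + q) / n"
    using assms by (simp add: power2_eq_square field_simps)
qed

text \<open>The typical deviation of an observed frequency \<open>a\<close> from its probability \<open>p\<close>. The factor \<open>2\<close> makes the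
  probability of the opposite event of order \<open>1 / n\<^sup>2\<close>, which survives a union bound over all symbols.\<close>

definition sqrt_close :: "real \<Rightarrow> real \<Rightarrow> real \<Rightarrow> bool" where
  "sqrt_close n a p \<longleftrightarrow> \<bar>sqrt a - sqrt p\<bar> \<le> sqrt (2 * (ln n / n))"

lemma variance_le_second_moment:
  fixes F :: "nat \<Rightarrow> nat \<Rightarrow> real"
  assumes "poly_growth F" "0 \<le> l" "0 \<le> m"
  shows "measure_pmf.expectation (Poi2 l m) (\<lambda>z. (F (fst z) (snd z) - measure_pmf.expectation (Poi2 l m) (\<lambda>z. F (fst z) (snd z)))\<^sup>2)
    \<le> measure_pmf.expectation (Poi2 l m) (\<lambda>z. (F (fst z) (snd z))\<^sup>2)"
proof -
  let ?mu = "measure_pmf.expectation (Poi2 l m) (\<lambda>z. F (fst z) (snd z))"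
  have i1: "integrable (measure_pmf (Poi2 l m)) (\<lambda>z. F (fst z) (snd z))"
    using assms by (intro poly_growth_integrable)
  have i2: "integrable (measure_pmf (Poi2 l m)) (\<lambda>z. (F (fst z) (snd z))\<^sup>2)"
    using assms by (intro poly_growth_integrable[of "\<lambda>x y. (F x y)\<^sup>2"]) auto
  have "(F (fst z) (snd z) - ?mu)\<^sup>2 = (F (fst z) (snd z))\<^sup>2 - 2 * ?mu * F (fst z) (snd z) + ?mu\<^sup>2" for z :: "nat \<times> nat"
    by (simp add: power2_diff mult_ac)
  then have "measure_pmf.expectation (Poi2 l m) (\<lambda>z. (F (fst z) (snd z) - ?mu)\<^sup>2)
    = measure_pmf.expectation (Poi2 l m) (\<lambda>z. (F (fst z) (snd z))\<^sup>2) - ?mu\<^sup>2"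
    using i1 i2 by (simp add: power2_eq_square)
  then show ?thesis by simp
qed

lemma ln_ge_half: "n \<ge> 2 \<Longrightarrow> ln n \<ge> 1 / (2::real)"
  using ln2_ge_two_thirds ln_le_cancel_iff[of 2 n] by linarith

text \<open>On the scale of square roots and in units of \<open>sqrt (ln n / n)\<close>: \<open>sqrt 200 + sqrt 2 < 20\<close>.\<close>

lemma small_regime_rates:
  assumes "n > 1" "0 \<le> a" "0 \<le> p" "a < 200 * (ln n / n)" "sqrt_close n a p"
  shows "p \<le> 400 * (ln n / n)"
proof -
  define e where "e = sqrt (ln n / n)"
  have e: "e > 0" using assms by (simp add: e_def)
  have "sqrt p \<le> sqrt a + sqrt 2 * e"
    using assms(5) unfolding sqrt_close_def e_def abs_le_iff real_sqrt_mult by linarith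
  also have "sqrt a \<le> sqrt (200 * (ln n / n))" using assms by simp
  also have "\<dots> = sqrt 200 * e" by (simp only: real_sqrt_mult e_def)
  also have "sqrt 200 \<le> sqrt ((15::real)\<^sup>2)" by (subst real_sqrt_le_iff) simp
  also have "sqrt 2 \<le> sqrt ((3 / 2 :: real)\<^sup>2)" by (subst real_sqrt_le_iff) (simp add: power2_eq_square)
  finally have "sqrt p \<le> 20 * e" using e by simp
  then have "(sqrt p)\<^sup>2 \<le> (20 * e)\<^sup>2" using assms by (intro power_mono) auto
  also have "(20 * e)\<^sup>2 = 400 * (ln n / n)"
    unfolding power_mult_distrib e_def using assms by simp
  finally show ?thesis using assms by simp
qed

text \<open>Because \<open>a + b\<close> is at least a large multiple of \<open>ln n / n\<close>, the sums \<open>a + b\<close> and \<open>p + q\<close> are comparable and the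
  deviations of the frequencies are small against \<open>sqrt (a + b)\<close>. The last bound says that \<open>p - q\<close> lies in
  the range of validity \<open>[-W, W]\<close> of the approximation for the scale \<open>W\<close> that is computed from \<open>a\<close> and \<open>b\<close>.\<close>

lemma close_regime_rates:
  assumes n: "n > 1" and ab: "0 \<le> a" "0 \<le> b" and pq: "0 \<le> p" "0 \<le> q" and sum: "a + b \<ge> 200 * (ln n / n)"
    and close: "sqrt_close n a p" "sqrt_close n b q"
  shows "p + q \<le> 3 * (a + b)" "a + b \<le> (21 / 10) * (p + q)"
    "\<bar>sqrt a - sqrt b\<bar> \<le> sqrt (201 * (ln n / n)) \<Longrightarrow> \<bar>p - q\<bar> \<le> sqrt (1600 * (ln n / n) * (a + b))"
proof -
  define e where "e = sqrt (ln n / n)"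
  have e: "e > 0" "e\<^sup>2 = ln n / n" using n by (simp_all add: e_def)
  have d: "\<bar>sqrt a - sqrt p\<bar> \<le> sqrt 2 * e" "\<bar>sqrt b - sqrt q\<bar> \<le> sqrt 2 * e"
    using close unfolding sqrt_close_def e_def real_sqrt_mult by auto
  have sum': "200 * e\<^sup>2 \<le> a + b" using sum by (simp only: e)
  have sq: "x\<^sup>2 \<le> 2 * y\<^sup>2 + 4 * e\<^sup>2" if "\<bar>x - y\<bar> \<le> sqrt 2 * e" for x y :: real
  proof -
    have "(x - y)\<^sup>2 \<le> (sqrt 2 * e)\<^sup>2"
      using that by (metis abs_ge_zero power2_abs power_mono)
    moreover have "x\<^sup>2 \<le> 2 * y\<^sup>2 + 2 * (x - y)\<^sup>2"
      using zero_le_power2[of "x - 2 * y"] by (simp add: power2_eq_square algebra_simps)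
    ultimately show ?thesis by (simp add: power_mult_distrib)
  qed
  have "a \<le> 2 * p + 4 * e\<^sup>2" "b \<le> 2 * q + 4 * e\<^sup>2" 
    using sq[OF d(1)] sq[OF d(2)] ab pq by simp_all
  then show "a + b \<le> (21 / 10) * (p + q)" using sum' e pq by simp
  have "p \<le> 2 * a + 4 * e\<^sup>2" "q \<le> 2 * b + 4 * e\<^sup>2" 
    using sq[of "sqrt p" "sqrt a"] sq[of "sqrt q" "sqrt b"] d ab pq by (simp_all add: abs_minus_commute)
  then show "p + q \<le> 3 * (a + b)" using sum' e ab by simp
  show "\<bar>p - q\<bar> \<le> sqrt (1600 * (ln n / n) * (a + b))" if "\<bar>sqrt a - sqrt b\<bar> \<le> sqrt (201 * (ln n / n))"
  proof -
    define r where "r = sqrt (a + b)"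
    have r: "r \<ge> 0" "r\<^sup>2 = a + b" using ab by (simp_all add: r_def)
    have s2: "sqrt 2 \<le> 3 / 2" by (rule real_le_lsqrt) (simp_all add: power2_eq_square)
    have s201: "sqrt 201 \<le> 15" by (rule real_le_lsqrt) simp_all
    have "196 * e\<^sup>2 \<le> a + b" using sum' zero_le_power2[of e] by linarith
    then have "(14 * e)\<^sup>2 \<le> r\<^sup>2" unfolding power_mult_distrib r(2) by simp
    then have er: "14 * e \<le> r" using r(1) by (rule power2_le_imp_le)
    have "\<bar>sqrt a - sqrt b\<bar> \<le> sqrt 201 * e"
      using that by (simp only: real_sqrt_mult e_def)
    also have "\<dots> \<le> 15 * e" using s201 e by (intro mult_right_mono) auto
    finally have ab_diff: "\<bar>sqrt a - sqrt b\<bar> \<le> 15 * e" .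
    have d': "sqrt 2 * e \<le> 3 / 2 * e" using s2 e by (intro mult_right_mono) auto
    have pq_diff: "\<bar>sqrt p - sqrt q\<bar> \<le> 18 * e"
      using ab_diff d d' by linarith
    have "(sqrt a + sqrt b)\<^sup>2 \<le> 2 * (a + b)"
      using zero_le_power2[of "sqrt a - sqrt b"] ab by (simp add: power2_sum power2_diff)
    also have "\<dots> \<le> (3 / 2)\<^sup>2 * r\<^sup>2" unfolding r(2) using ab by (intro mult_right_mono) (auto simp: power2_eq_square)
    also have "\<dots> = (3 / 2 * r)\<^sup>2" by (simp only: power_mult_distrib)
    finally have "sqrt a + sqrt b \<le> 3 / 2 * r"
      by (rule power2_le_imp_le) (use r(1) in simp)
    then have pq_sum: "sqrt p + sqrt q \<le> 2 * r" using d d' er by linarith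
    have "\<bar>p - q\<bar> = \<bar>(sqrt p - sqrt q) * (sqrt p + sqrt q)\<bar>"
      using pq by (simp add: algebra_simps)
    also have "\<dots> = \<bar>sqrt p - sqrt q\<bar> * (sqrt p + sqrt q)" using pq by (simp add: abs_mult)
    also have "\<dots> \<le> (18 * e) * (2 * r)"
      using pq_diff pq_sum pq e by (intro mult_mono) auto
    also have "\<dots> \<le> 40 * (e * r)" using e(1) r(1) by simp
    also have "\<dots> \<le> sqrt (1600 * (ln n / n) * (a + b))"
    proof (rule real_le_rsqrt)
      have "(40 * (e * r))\<^sup>2 = 1600 * (e\<^sup>2 * r\<^sup>2)" by (simp add: power_mult_distrib)
      then show "(40 * (e * r))\<^sup>2 \<le> 1600 * (ln n / n) * (a + b)" by (simp only: e(2) r(2) mult.assoc order.refl)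
    qed
    finally show ?thesis .
  qed
qed

text \<open>The two deviations together are smaller than the threshold, \<open>2 * sqrt 2 < sqrt 201\<close>, so a clear
  difference of the frequencies has the sign of the difference of the probabilities.\<close>

lemma sign_preserved:
  assumes "n > 1" "sqrt a - sqrt b > tau 200 1 n" "sqrt_close n a p" "sqrt_close n b q"
  shows "q \<le> p"
proof -
  define e where "e = sqrt (ln n / n)"
  have e: "e > 0" using assms(1) by (simp add: e_def)
  have t: "tau 200 1 n = sqrt 201 * e"
    by (simp add: tau_def e_def flip: real_sqrt_mult)
  have "2 * sqrt 2 \<le> sqrt 201" by (rule real_le_rsqrt) (simp add: power_mult_distrib)
  then have "2 * sqrt 2 * e \<le> sqrt 201 * e" using e by (intro mult_right_mono) auto
  then have "sqrt q \<le> sqrt p"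
    using assms(2-4) unfolding sqrt_close_def real_sqrt_mult e_def[symmetric] t abs_le_iff by linarith
  then show ?thesis by simp
qed

lemma Suc_le_2_power: "Suc K \<le> 2 ^ K" 
  by (induction K) auto

lemma Suc_double_le_3_power: "Suc (2 * K) \<le> 3 ^ K" 
  by (induction K) auto

text \<open>The degree \<open>K\<close> is the integer part of \<open>c2 * ln n\<close>, of which only the comparison with \<open>c2 * ln n\<close> up to a
  factor of \<open>2\<close> enters. The other constants are \<open>c1 = 200\<close> and \<open>c3 = 1\<close>.\<close>

locale estimation_setting =
  fixes n c2 :: real and K :: nat and u v :: "real poly poly" and R :: "real poly"
  assumes n: "n \<ge> 2" and c2: "0 < c2" "c2 \<le> 1"
    and K: "K \<ge> 1" "real K \<le> c2 * ln n" "c2 * ln n \<le> 2 * real K"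
    and u: "best_approx2 K (\<lambda>x y. sqrt x + sqrt y) u"
    and v: "best_approx2 K (\<lambda>x y. \<bar>sqrt x - sqrt y\<bar>) v"
    and R: "best_approx1 K (\<lambda>t. \<bar>t\<bar>) R"
begin

lemma ln_n: "ln n \<ge> 1 / 2" "ln n > 0"
  using ln_ge_half[OF n] by auto

text \<open>The numerical factors are those of \<open>h_poly_error\<close>, multiplied by the constants from the scale
  \<open>400 * ln n / n\<close> and from \<open>1 / K \<le> 2 / (c2 * ln n)\<close>.\<close>

definition bias_bound :: "real \<Rightarrow> real \<Rightarrow> real" where
  "bias_bound p q = 720 / c2 * sqrt ((p + q) / (n * ln n)) + 115200 / c2\<^sup>2 / (n * ln n)"

text \<open>One summand for each regime: the plain difference of the frequencies, the polynomial in \<open>p\<close> and \<open>q\<close>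
  for small rates, and the polynomial in \<open>p - q\<close> for close rates.\<close>

definition var_bound :: "real \<Rightarrow> real \<Rightarrow> real" where
  "var_bound p q = (p + q) / n + (16 * 10 ^ 8 * (ln n / n)\<^sup>2 + 64000 * (ln n / n) * (p + q)) * (10 ^ 13) ^ K"

lemma inverse_K: "1 / real K \<le> 2 / (c2 * ln n)"
  using K c2 ln_n by (simp add: field_simps)

text \<open>The gain of the polynomial approximation: dividing the statistical scale \<open>sqrt (ln n / n * s)\<close> by a degree
  of order \<open>ln n\<close> moves the logarithm into the denominator.\<close>

lemma scale_over_K:
  assumes "0 \<le> s"
  shows "sqrt (ln n / n * s) / real K \<le> 2 / c2 * sqrt (s / (n * ln n))"
proof -
  define Q where "Q = sqrt (s / (n * ln n))"
  have "ln n / n * s = (ln n)\<^sup>2 * (s / (n * ln n))"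
    using n ln_n by (simp add: power2_eq_square)
  then have eq: "sqrt (ln n / n * s) = ln n * Q"
    unfolding Q_def using ln_n by (simp only: real_sqrt_mult) simp
  have "Q \<ge> 0" using assms n ln_n by (simp add: Q_def)
  then have "ln n * Q * (1 / real K) \<le> ln n * Q * (2 / (c2 * ln n))"
    using inverse_K ln_n by (intro mult_left_mono) auto
  also have "\<dots> = 2 / c2 * Q"
    using ln_n by simp
  finally show ?thesis unfolding eq Q_def by simp
qed

lemma small_regime:
  assumes pq: "0 \<le> p" "p \<le> 400 * (ln n / n)" "0 \<le> q" "q \<le> 400 * (ln n / n)"
  defines "Z \<equiv> \<lambda>z::nat \<times> nat. unbiased2 n (P1_poly 200 n u v) (real (fst z) / n) (real (snd z) / n)"
  shows "\<bar>measure_pmf.expectation (Poi2 (n * p) (n * q)) Z - \<bar>p - q\<bar>\<bar> \<le> bias_bound p q"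
    and "measure_pmf.expectation (Poi2 (n * p) (n * q)) (\<lambda>z. (Z z)\<^sup>2) \<le> var_bound p q"
proof -
  define B where "B = 400 * (ln n / n)"
  have B: "B > 0" "n * B = 400 * ln n" using n ln_n by (simp_all add: B_def)
  have Z: "Z = (\<lambda>z. unbiased2 n (rescale2 B (h_poly u v)) (real (fst z) / n) (real (snd z) / n))"
    by (simp add: Z_def P1_poly_def B_def)
  note h = coeff_h_poly_bound[OF u v K(1)]
  have xy: "p / B \<in> {0..1}" "q / B \<in> {0..1}" using pq[folded B_def] B(1) by auto
  have "\<bar>measure_pmf.expectation (Poi2 (n * p) (n * q)) Z - \<bar>p - q\<bar>\<bar> = \<bar>B * eval2 (h_poly u v) (p / B) (q / B) - B * \<bar>p / B - q / B\<bar>\<bar>"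
    unfolding Z using B n pq h by (subst expectation_unbiased_P1[where N = "2 * K"])
       (auto simp: abs_divide simp flip: diff_divide_distrib)
  also have "\<dots> = B * \<bar>eval2 (h_poly u v) (p / B) (q / B) - \<bar>p / B - q / B\<bar>\<bar>"
    using B by (simp add: abs_mult flip: right_diff_distrib)
  also have "\<dots> \<le> B * (72 / (real K)\<^sup>2 + 12 * (sqrt (p / B) + sqrt (q / B)) / real K)"
    using h_poly_error[OF u v K(1) xy] B by (intro mult_left_mono) auto
  also have "\<dots> = 72 * (B * (1 / real K)\<^sup>2) + 12 * ((sqrt (B * p) + sqrt (B * q)) / real K)"
  proof -
    have sqrt_B: "B * sqrt (t / B) = sqrt (B * t)" for t
    proof -
      have "B * sqrt (t / B) = sqrt (B * B) * sqrt (t / B)" using B by simp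
      also have "\<dots> = sqrt (B * t)" using B by (simp only: real_sqrt_mult[symmetric]) simp
      finally show ?thesis .
    qed
    have "B * (72 / (real K)\<^sup>2 + 12 * (s + t) / real K)
        = 72 * (B * (1 / real K)\<^sup>2) + 12 * ((B * s + B * t) / real K)" for s t
      by (simp add: algebra_simps power_divide add_divide_distrib)
    then show ?thesis by (simp only: sqrt_B)
  qed
  also have "B * (1 / real K)\<^sup>2 \<le> B * (2 / (c2 * ln n))\<^sup>2"
    using B inverse_K by (intro mult_left_mono power_mono) auto
  also have "B * (2 / (c2 * ln n))\<^sup>2 = 1600 / c2\<^sup>2 / (n * ln n)"
    using n ln_n c2 by (simp add: B_def power2_eq_square field_simps)
  also have "(sqrt (B * p) + sqrt (B * q)) / real K \<le> 30 * (2 / c2 * sqrt ((p + q) / (n * ln n)))"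
  proof -
    have "sqrt x + sqrt y \<le> (3 / 2) * sqrt (x + y)" if "x \<ge> 0" "y \<ge> 0" for x y
    proof (rule power2_le_imp_le)
      show "(sqrt x + sqrt y)\<^sup>2 \<le> (3 / 2 * sqrt (x + y))\<^sup>2"
        using that zero_le_power2[of "sqrt x - sqrt y"]
        by (simp add: power_mult_distrib power2_sum power2_diff power_divide)
    qed (use that in simp)
    from this[of "B * p" "B * q"] have "sqrt (B * p) + sqrt (B * q) \<le> 3 / 2 * sqrt (B * (p + q))"
      using B pq by (simp add: distrib_left)
    also have "sqrt (B * (p + q)) = sqrt 400 * sqrt (ln n / n * (p + q))"
      unfolding B_def real_sqrt_mult[symmetric] by (simp add: mult.assoc)
    also have "sqrt 400 = 20" by (rule real_sqrt_unique) simp_all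
    finally have "(sqrt (B * p) + sqrt (B * q)) / real K \<le> 30 * (sqrt (ln n / n * (p + q)) / real K)"
      using K by (simp add: divide_right_mono)
    then show ?thesis using scale_over_K[of "p + q"] pq by linarith
  qed
  finally have "\<bar>measure_pmf.expectation (Poi2 (n * p) (n * q)) Z - \<bar>p - q\<bar>\<bar>
     \<le> 115200 / c2\<^sup>2 / (n * ln n) + 720 / c2 * sqrt ((p + q) / (n * ln n))"
    by simp
  then show "\<bar>measure_pmf.expectation (Poi2 (n * p) (n * q)) Z - \<bar>p - q\<bar>\<bar> \<le> bias_bound p q"
    by (simp add: bias_bound_def)
  have KB: "real (2 * K) \<le> n * B"
  proof -
    have "c2 * ln n \<le> 1 * ln n" using c2 ln_n by (intro mult_right_mono) auto
    then have "real K \<le> ln n" using K(2) by linarith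
    then show ?thesis using ln_n unfolding B(2) by simp
  qed
  have "measure_pmf.expectation (Poi2 (n * p) (n * q)) (\<lambda>z. (Z z)\<^sup>2)
     \<le> (B * (100 * 144 ^ (2 * K)))\<^sup>2 * real (Suc (2 * K)) ^ 4 * 16 ^ (2 * K)"
    unfolding Z using n B pq h KB
    by (intro second_moment_unbiased_P1) (auto simp: B_def)
  also have "\<dots> \<le> (B * (100 * 144 ^ (2 * K)))\<^sup>2 * (3 ^ K) ^ 4 * 16 ^ (2 * K)"
    using of_nat_mono[OF Suc_double_le_3_power[of K], where 'a = real]
    by (intro mult_right_mono mult_left_mono power_mono) auto
  also have "\<dots> = 16 * 10 ^ 8 * (ln n / n)\<^sup>2 * (144 ^ 4 * 3 ^ 4 * 16\<^sup>2) ^ K"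
  proof -
    have "(144 ^ (2 * K))\<^sup>2 = ((144::real) ^ 4) ^ K" "(3 ^ K) ^ 4 = ((3::real) ^ 4) ^ K" "16 ^ (2 * K) = ((16::real)\<^sup>2) ^ K"
      by (simp_all only: power_mult[symmetric] mult.commute[of K] mult.assoc mult.left_commute[of K]) simp_all
    moreover have "B\<^sup>2 * (100\<^sup>2 * X) = 16 * (10 ^ 8 * ((ln n / n)\<^sup>2 * X))" for X
      by (simp add: B_def power_mult_distrib power_divide)
    ultimately show ?thesis
      by (simp only: power_mult_distrib mult.assoc)
  qed
  also have "\<dots> \<le> 16 * 10 ^ 8 * (ln n / n)\<^sup>2 * (10 ^ 13) ^ K"
    by (intro mult_left_mono power_mono) auto
  also have "\<dots> \<le> var_bound p q"
    using n ln_n pq by (auto simp: var_bound_def distrib_right)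
  finally show "measure_pmf.expectation (Poi2 (n * p) (n * q)) (\<lambda>z. (Z z)\<^sup>2) \<le> var_bound p q" .
qed

lemma close_regime:
  assumes ab: "0 \<le> a" "0 \<le> b" and pq: "0 \<le> p" "0 \<le> q" and sum: "a + b \<ge> 200 * (ln n / n)"
    and close: "sqrt_close n a p" "sqrt_close n b q"
    and d: "\<bar>sqrt a - sqrt b\<bar> \<le> sqrt (201 * (ln n / n))"
  defines "Z \<equiv> \<lambda>z::nat \<times> nat. unbiased2 n (P2_poly 200 n K R a b) (real (fst z) / n) (real (snd z) / n)"
  shows "\<bar>measure_pmf.expectation (Poi2 (n * p) (n * q)) Z - \<bar>p - q\<bar>\<bar> \<le> bias_bound p q"
    and "measure_pmf.expectation (Poi2 (n * p) (n * q)) (\<lambda>z. (Z z)\<^sup>2) \<le> var_bound p q"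
proof -
  define W where "W = W_scale 200 n a b"
  have n1: "n > 1" using n by simp
  note rates = close_regime_rates[OF n1 ab pq sum close]
  have L: "ln n / n > 0" using ln_n n by simp
  \<comment> \<open>In this regime the maximum with \<open>1 / n\<close> in the definition of \<open>W_scale\<close> is \<open>a + b\<close>.\<close>
  have "1 / n \<le> 200 * (ln n / n)" using ln_n n by (simp add: field_simps)
  then have W: "W = sqrt (1600 * (ln n / n) * (a + b))"
    using sum by (simp add: W_def W_scale_def flip: real_sqrt_mult)
  have ab0: "a + b > 0" using sum L by linarith
  have W0: "W > 0" "W\<^sup>2 = 1600 * (ln n / n) * (a + b)" 
  proof -
    have X: "0 < 1600 * (ln n / n) * (a + b)" using L ab0 by (intro mult_pos_pos) auto
    show "W > 0" "W\<^sup>2 = 1600 * (ln n / n) * (a + b)"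
      unfolding W using X real_sqrt_gt_zero[OF X] real_sqrt_pow2[OF less_imp_le[OF X]] by auto
  qed
  have pqW: "\<bar>p - q\<bar> \<le> W" using rates(3)[OF d] by (simp add: W)
  have t: "(p - q) / W \<in> {-1..1}" using pqW W0 by (auto simp: abs_le_iff field_simps)
  have W_le: "W\<^sup>2 \<le> 60\<^sup>2 * (ln n / n * (p + q))"
  proof -
    have "W\<^sup>2 \<le> 1600 * (ln n / n) * ((21 / 10) * (p + q))"
      unfolding W0 using rates(2) L by (intro mult_left_mono) auto
    also have "\<dots> = 3360 * (ln n / n * (p + q))" by simp
    also have "\<dots> \<le> 60\<^sup>2 * (ln n / n * (p + q))" using ln_n n pq by (intro mult_right_mono) auto
    finally show ?thesis .
  qed
  have W_sqrt: "W \<le> 60 * sqrt (ln n / n * (p + q))"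
  proof (rule power2_le_imp_le)
    have "0 \<le> ln n / n * (p + q)" using L pq by (intro mult_nonneg_nonneg) auto
    then show "W\<^sup>2 \<le> (60 * sqrt (ln n / n * (p + q)))\<^sup>2" "0 \<le> 60 * sqrt (ln n / n * (p + q))"
      unfolding power_mult_distrib by (simp_all only: real_sqrt_pow2 W_le real_sqrt_ge_zero mult_nonneg_nonneg zero_le_numeral)
  qed
  have degR: "degree R \<le> K" using R by (simp add: best_approx1_def)
  have "measure_pmf.expectation (Poi2 (n * p) (n * q)) Z = W * poly R ((p - q) / W)"
    unfolding Z_def W_def using n W0 degR pq by (intro expectation_unbiased_P2) (auto simp: W_def)
  moreover have "\<bar>p - q\<bar> = W * \<bar>(p - q) / W\<bar>" using W0 by (simp add: abs_divide)
  ultimately have "\<bar>measure_pmf.expectation (Poi2 (n * p) (n * q)) Z - \<bar>p - q\<bar>\<bar>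
      = \<bar>W * poly R ((p - q) / W) - W * \<bar>(p - q) / W\<bar>\<bar>" by simp
  also have "\<dots> = W * \<bar>poly R ((p - q) / W) - \<bar>(p - q) / W\<bar>\<bar>"
    using W0 by (simp only: abs_mult flip: right_diff_distrib)
  also have "\<dots> \<le> W * (3 / real K)"
    using best_approx1_abs_error[OF R K(1) t] W0 by (intro mult_left_mono) auto
  also have "\<dots> \<le> (60 * sqrt (ln n / n * (p + q))) * (3 / real K)"
    using W_sqrt K by (intro mult_right_mono) simp_all
  also have "\<dots> = 180 * (sqrt (ln n / n * (p + q)) / real K)" by simp
  also have "\<dots> \<le> 180 * (2 / c2 * sqrt ((p + q) / (n * ln n)))"
    using scale_over_K[of "p + q"] pq by (intro mult_left_mono) auto
  also have "\<dots> \<le> bias_bound p q"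
  proof -
    have "0 \<le> 360 / c2 * sqrt ((p + q) / (n * ln n))" "0 \<le> 115200 / c2\<^sup>2 / (n * ln n)"
      using c2 pq n ln_n by (auto intro!: mult_nonneg_nonneg divide_nonneg_nonneg)
    moreover have "bias_bound p q = 180 * (2 / c2 * sqrt ((p + q) / (n * ln n)))
        + 360 / c2 * sqrt ((p + q) / (n * ln n)) + 115200 / c2\<^sup>2 / (n * ln n)"
      by (simp add: bias_bound_def)
    ultimately show ?thesis by linarith
  qed
  finally show "\<bar>measure_pmf.expectation (Poi2 (n * p) (n * q)) Z - \<bar>p - q\<bar>\<bar> \<le> bias_bound p q" .
  have s: "real K * (p + q) \<le> n * W\<^sup>2"
  proof -
    have "real K \<le> ln n" using K(2) c2 ln_n mult_right_mono[of c2 1 "ln n"] by linarith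
    then have "real K * (p + q) \<le> ln n * (3 * (a + b))"
      using rates(1) pq ln_n by (intro mult_mono) auto
    also have "\<dots> \<le> 1600 * (ln n * (a + b))" using ln_n ab by simp
    also have "\<dots> = n * W\<^sup>2" unfolding W0 using n by simp
    finally show ?thesis .
  qed
  have "measure_pmf.expectation (Poi2 (n * p) (n * q)) (\<lambda>z. (Z z)\<^sup>2)
      \<le> (W * (4 * 12 ^ K))\<^sup>2 * (real (Suc K))\<^sup>2 * 4 ^ K"
    unfolding Z_def W_def
    using n W0 pq pqW s coeff_best_approx1_bound[OF R K(1)] by (intro second_moment_unbiased_P2) (auto simp: W_def)
  also have "\<dots> \<le> (W * (4 * 12 ^ K))\<^sup>2 * (2 ^ K)\<^sup>2 * 4 ^ K"
    using of_nat_mono[OF Suc_le_2_power[of K], where 'a = real]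
    by (intro mult_right_mono mult_left_mono power_mono) auto
  also have "\<dots> = 16 * W\<^sup>2 * (12\<^sup>2 * 2\<^sup>2 * 4) ^ K"
    by (simp only: power_mult_distrib power_mult[symmetric] mult.commute[of K]) simp
  also have "\<dots> \<le> 16 * (60\<^sup>2 * (ln n / n * (p + q))) * (10 ^ 13) ^ K"
    using W_le ln_n n pq by (intro mult_mono power_mono) auto
  also have "\<dots> \<le> 64000 * (ln n / n) * (p + q) * (10 ^ 13) ^ K"
    unfolding mult.assoc[symmetric] using ln_n n pq by (intro mult_right_mono) auto
  also have "\<dots> \<le> var_bound p q"
    using n pq by (auto simp: var_bound_def distrib_right)
  finally show "measure_pmf.expectation (Poi2 (n * p) (n * q)) (\<lambda>z. (Z z)\<^sup>2) \<le> var_bound p q" .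
qed

text \<open>In the two regimes where the frequencies differ clearly, the estimator is the difference of the
  frequencies, with the correct sign, and hence unbiased. The other two regimes are those of the
  polynomial estimators.\<close>

lemma symbol_term_moments:
  assumes ab: "0 \<le> a" "0 \<le> b" and pq: "0 \<le> p" "0 \<le> q" and close: "sqrt_close n a p" "sqrt_close n b q"
  defines "F \<equiv> \<lambda>x y :: nat. symbol_term 200 1 n K u v R a b (real x / n) (real y / n)"
  defines "mu \<equiv> measure_pmf.expectation (Poi2 (n * p) (n * q)) (\<lambda>z. F (fst z) (snd z))"
  shows "\<bar>mu - \<bar>p - q\<bar>\<bar> \<le> bias_bound p q"
    and "measure_pmf.expectation (Poi2 (n * p) (n * q)) (\<lambda>z. (F (fst z) (snd z) - mu)\<^sup>2) \<le> var_bound p q"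
proof -
  have n1: "n > 1" "n > 0" using n by auto
  have l: "0 \<le> n * p" "0 \<le> n * q" using n pq by auto
  have growth: "poly_growth F" unfolding F_def by (rule poly_growth_symbol_term)
  have bias0: "0 \<le> bias_bound p q" using c2 pq n ln_n by (auto simp: bias_bound_def)
  have var0: "(p + q) / n \<le> var_bound p q" using pq n ln_n by (auto simp: var_bound_def)
  have var_le: "measure_pmf.expectation (Poi2 (n * p) (n * q)) (\<lambda>z. (F (fst z) (snd z) - mu)\<^sup>2) \<le> V"
    if "measure_pmf.expectation (Poi2 (n * p) (n * q)) (\<lambda>z. (F (fst z) (snd z))\<^sup>2) \<le> V" for V
    using variance_le_second_moment[OF growth l] that unfolding mu_def by linarith
  have "\<bar>mu - \<bar>p - q\<bar>\<bar> \<le> bias_bound p q \<and>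
    measure_pmf.expectation (Poi2 (n * p) (n * q)) (\<lambda>z. (F (fst z) (snd z) - mu)\<^sup>2) \<le> var_bound p q"
  proof (rule symbol_term_cases[of a b 200 1 n K u v R])
    assume *: "a + b < 200 * ln n / n" "symbol_term 200 1 n K u v R a b = (\<lambda>x y. unbiased2 n (P1_poly 200 n u v) x y)"
    have "p \<le> 400 * (ln n / n)" "q \<le> 400 * (ln n / n)"
      using small_regime_rates[OF n1(1) _ _ _ close(1)] small_regime_rates[OF n1(1) _ _ _ close(2)] * ab pq by auto
    then show ?thesis
      using small_regime[of p q] pq var_le by (simp add: mu_def F_def *)
  next
    assume *: "sqrt a - sqrt b > tau 200 1 n" "symbol_term 200 1 n K u v R a b = (\<lambda>x y. x - y)"
    have "q \<le> p" using sign_preserved[OF n1(1) *(1) close] .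
    moreover have "mu = p - q" unfolding mu_def F_def * using linear_moments(1)[OF n1(2) pq] .
    ultimately show ?thesis
      using bias0 var0 linear_moments(2)[OF n1(2) pq] by (simp add: F_def *)
  next
    assume *: "sqrt b - sqrt a > tau 200 1 n" "symbol_term 200 1 n K u v R a b = (\<lambda>x y. y - x)"
    have "p \<le> q" using sign_preserved[OF n1(1) *(1) close(2) close(1)] .
    moreover have mu: "mu = q - p"
    proof -
      have "mu = - measure_pmf.expectation (Poi2 (n * p) (n * q)) (\<lambda>z. real (fst z) / n - real (snd z) / n)"
        unfolding mu_def F_def * by (subst integral_minus[symmetric]) simp
      then show ?thesis using linear_moments(1)[OF n1(2) pq] by simp
    qed
    moreover have "(F (fst z) (snd z) - mu)\<^sup>2 = (real (fst z) / n - real (snd z) / n - (p - q))\<^sup>2" for z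
      unfolding F_def * mu by (simp add: power2_eq_square algebra_simps)
    ultimately show ?thesis
      using bias0 var0 linear_moments(2)[OF n1(2) pq] by simp
  next
    assume *: "a + b \<ge> 200 * ln n / n" "\<bar>sqrt a - sqrt b\<bar> \<le> tau 200 1 n"
      "symbol_term 200 1 n K u v R a b = (\<lambda>x y. unbiased2 n (P2_poly 200 n K R a b) x y)"
    then have "\<bar>sqrt a - sqrt b\<bar> \<le> sqrt (201 * (ln n / n))" "a + b \<ge> 200 * (ln n / n)"
      by (simp_all add: tau_def)
    then show ?thesis
      using close_regime[OF ab pq _ close] var_le by (simp add: mu_def F_def *)
  qed (use ab n in auto)
  then show "\<bar>mu - \<bar>p - q\<bar>\<bar> \<le> bias_bound p q"
    "measure_pmf.expectation (Poi2 (n * p) (n * q)) (\<lambda>z. (F (fst z) (snd z) - mu)\<^sup>2) \<le> var_bound p q"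
    by auto
qed

end

section \<open>Independence across symbols\<close>

text \<open>Regroups the two samples into a single family of independent pairs.\<close>

lemma pair_Pi_pmf:
  assumes "finite A"
  shows "pair_pmf (Pi_pmf A d p) (Pi_pmf A e q)
    = map_pmf (\<lambda>h. (fst \<circ> h, snd \<circ> h)) (Pi_pmf A (d, e) (\<lambda>i. pair_pmf (p i) (q i)))"
proof (rule pmf_eqI)
  fix XY :: "('a \<Rightarrow> 'b) \<times> ('a \<Rightarrow> 'c)"
  obtain X Y where XY: "XY = (X, Y)" by fastforce
  let ?f = "\<lambda>h :: 'a \<Rightarrow> 'b \<times> 'c. (fst \<circ> h, snd \<circ> h)"
  have inj: "inj ?f"
    by (rule injI) (auto simp: fun_eq_iff prod_eq_iff)
  have XY_eq: "XY = ?f (\<lambda>i. (X i, Y i))" by (simp add: XY comp_def)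
  have "pmf (map_pmf ?f (Pi_pmf A (d, e) (\<lambda>i. pair_pmf (p i) (q i)))) XY
      = pmf (Pi_pmf A (d, e) (\<lambda>i. pair_pmf (p i) (q i))) (\<lambda>i. (X i, Y i))"
    unfolding XY_eq by (rule pmf_map_inj'[OF inj])
  then show "pmf (pair_pmf (Pi_pmf A d p) (Pi_pmf A e q)) XY
      = pmf (map_pmf ?f (Pi_pmf A (d, e) (\<lambda>i. pair_pmf (p i) (q i)))) XY"
    using assms by (auto simp: XY pmf_pair pmf_Pi prod.distrib)
qed

lemma Pi_pmf_second_moment:
  fixes H :: "'i \<Rightarrow> 'b \<Rightarrow> real"
  assumes I: "finite I" and int: "\<And>i. i \<in> I \<Longrightarrow> integrable (measure_pmf (D i)) (H i)"
    and int2: "\<And>i. i \<in> I \<Longrightarrow> integrable (measure_pmf (D i)) (\<lambda>z. (H i z)\<^sup>2)"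
    and zero: "\<And>i. i \<in> I \<Longrightarrow> measure_pmf.expectation (D i) (H i) = 0"
  shows "integrable (measure_pmf (Pi_pmf I d D)) (\<lambda>h. \<Sum>i\<in>I. H i (h i))"
    and "measure_pmf.expectation (Pi_pmf I d D) (\<lambda>h. \<Sum>i\<in>I. H i (h i)) = 0"
    and "integrable (measure_pmf (Pi_pmf I d D)) (\<lambda>h. (\<Sum>i\<in>I. H i (h i))\<^sup>2)"
    and "measure_pmf.expectation (Pi_pmf I d D) (\<lambda>h. (\<Sum>i\<in>I. H i (h i))\<^sup>2)
      = (\<Sum>i\<in>I. measure_pmf.expectation (D i) (\<lambda>z. (H i z)\<^sup>2))"
proof -
  let ?M = "Pi_pmf I d D"
  have comp: "map_pmf (\<lambda>h. h i) ?M = D i" if "i \<in> I" for i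
    using that I by (simp add: Pi_pmf_component)
  have pull_int: "integrable (measure_pmf ?M) (\<lambda>h. f (h i))" if "i \<in> I" "integrable (measure_pmf (D i)) f"
    for i and f :: "'b \<Rightarrow> real"
    using that(2) unfolding comp[OF that(1), symmetric] integrable_map_pmf_eq .
  have pull: "measure_pmf.expectation ?M (\<lambda>h. f (h i)) = measure_pmf.expectation (D i) f" if "i \<in> I"
    for i and f :: "'b \<Rightarrow> real"
    unfolding comp[OF that, symmetric] integral_map_pmf ..
  have E0: "measure_pmf.expectation ?M (\<lambda>h. H i (h i)) = 0" if "i \<in> I" for i
    using pull[OF that] zero[OF that] by simp
  have i1: "integrable (measure_pmf ?M) (\<lambda>h. H i (h i))" if "i \<in> I" for i
    using pull_int[OF that int[OF that]] .
  have indep: "prob_space.indep_vars (measure_pmf ?M) (\<lambda>_. borel) (\<lambda>i h. H i (h i)) I"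
    using prob_space.indep_vars_compose2[OF measure_pmf.prob_space_axioms
        indep_vars_Pi_pmf[OF I, of d D], of H "\<lambda>_. borel"] by simp
  have cross: "integrable (measure_pmf ?M) (\<lambda>h. H i (h i) * H j (h j)) \<and>
     measure_pmf.expectation ?M (\<lambda>h. H i (h i) * H j (h j)) = (if i = j then measure_pmf.expectation (D i) (\<lambda>z. (H i z)\<^sup>2) else 0)"
    if "i \<in> I" "j \<in> I" for i j
  proof (cases "i = j")
    case True
    then show ?thesis
      using pull_int[OF that(1) int2[OF that(1)]] pull[OF that(1), of "\<lambda>z. (H i z)\<^sup>2"] by (simp add: power2_eq_square)
  next
    case False
    have ij: "finite {i, j}" "prob_space.indep_vars (measure_pmf ?M) (\<lambda>_. borel) (\<lambda>i h. H i (h i)) {i, j}"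
      using prob_space.indep_vars_subset[OF measure_pmf.prob_space_axioms indep] that by auto
    show ?thesis
      using prob_space.indep_vars_integrable[OF measure_pmf.prob_space_axioms ij]
        prob_space.indep_vars_lebesgue_integral[OF measure_pmf.prob_space_axioms ij]
        i1 E0 that False by fastforce
  qed
  show "integrable (measure_pmf ?M) (\<lambda>h. \<Sum>i\<in>I. H i (h i))"
    using i1 by (intro Bochner_Integration.integrable_sum)
  show "measure_pmf.expectation ?M (\<lambda>h. \<Sum>i\<in>I. H i (h i)) = 0"
    using i1 E0 by (simp add: Bochner_Integration.integral_sum)
  have sq: "(\<lambda>h. (\<Sum>i\<in>I. H i (h i))\<^sup>2) = (\<lambda>h. \<Sum>i\<in>I. \<Sum>j\<in>I. H i (h i) * H j (h j))"
    by (simp add: power2_eq_square sum_product)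
  show "integrable (measure_pmf ?M) (\<lambda>h. (\<Sum>i\<in>I. H i (h i))\<^sup>2)"
    unfolding sq using cross by (intro Bochner_Integration.integrable_sum) auto
  have "measure_pmf.expectation ?M (\<lambda>h. (\<Sum>i\<in>I. H i (h i))\<^sup>2)
     = (\<Sum>i\<in>I. \<Sum>j\<in>I. measure_pmf.expectation ?M (\<lambda>h. H i (h i) * H j (h j)))"
    unfolding sq using cross by (simp add: Bochner_Integration.integral_sum Bochner_Integration.integrable_sum)
  also have "\<dots> = (\<Sum>i\<in>I. \<Sum>j\<in>I. if i = j then measure_pmf.expectation (D i) (\<lambda>z. (H i z)\<^sup>2) else 0)"
    using cross by (intro sum.cong) auto
  finally show "measure_pmf.expectation ?M (\<lambda>h. (\<Sum>i\<in>I. H i (h i))\<^sup>2)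
      = (\<Sum>i\<in>I. measure_pmf.expectation (D i) (\<lambda>z. (H i z)\<^sup>2))"
    using I by simp
qed

text \<open>The variances add up over independent coordinates, while the biases may all have the same sign.\<close>

lemma Pi_pmf_bias_variance:
  fixes G :: "'i \<Rightarrow> 'b \<Rightarrow> real"
  assumes I: "finite I" and int: "\<And>i. i \<in> I \<Longrightarrow> integrable (measure_pmf (D i)) (G i)"
    and int2: "\<And>i. i \<in> I \<Longrightarrow> integrable (measure_pmf (D i)) (\<lambda>z. (G i z)\<^sup>2)"
    and bias: "\<And>i. i \<in> I \<Longrightarrow> \<bar>measure_pmf.expectation (D i) (G i) - t i\<bar> \<le> b i"
    and var: "\<And>i. i \<in> I \<Longrightarrow>
      measure_pmf.expectation (D i) (\<lambda>z. (G i z - measure_pmf.expectation (D i) (G i))\<^sup>2) \<le> v i"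
  shows "(\<integral>\<^sup>+h. ennreal (((\<Sum>i\<in>I. G i (h i)) - (\<Sum>i\<in>I. t i))\<^sup>2) \<partial>measure_pmf (Pi_pmf I d D))
    \<le> ennreal ((\<Sum>i\<in>I. v i) + (\<Sum>i\<in>I. b i)\<^sup>2)"
proof -
  let ?M = "Pi_pmf I d D"
  define mu where "mu i = measure_pmf.expectation (D i) (G i)" for i
  define H where "H i z = G i z - mu i" for i z
  define S where "S h = (\<Sum>i\<in>I. H i (h i))" for h
  define B where "B = (\<Sum>i\<in>I. mu i - t i)"
  have Hint: "integrable (measure_pmf (D i)) (H i)" if "i \<in> I" for i
    unfolding H_def using int[OF that] by simp
  have Hint2: "integrable (measure_pmf (D i)) (\<lambda>z. (H i z)\<^sup>2)" if "i \<in> I" for i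
    unfolding H_def power2_diff using int[OF that] int2[OF that] by simp
  have H0: "measure_pmf.expectation (D i) (H i) = 0" if "i \<in> I" for i
    unfolding H_def using int[OF that] by (simp add: mu_def)
  note S = Pi_pmf_second_moment[of I D H d, OF I Hint Hint2 H0, folded S_def]
  have eq: "((\<Sum>i\<in>I. G i (h i)) - (\<Sum>i\<in>I. t i))\<^sup>2 = (S h)\<^sup>2 + 2 * B * S h + B\<^sup>2" for h
  proof -
    have "(\<Sum>i\<in>I. G i (h i)) - (\<Sum>i\<in>I. t i) = S h + B"
      by (simp add: S_def B_def H_def sum_subtractf)
    then show ?thesis by (simp add: power2_sum)
  qed
  have int_all: "integrable (measure_pmf ?M) (\<lambda>h. (S h)\<^sup>2 + 2 * B * S h + B\<^sup>2)"
    using S by auto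
  have "\<bar>B\<bar> \<le> (\<Sum>i\<in>I. b i)"
    unfolding B_def using bias by (intro order.trans[OF sum_abs] sum_mono) (simp add: mu_def)
  then have B2: "B\<^sup>2 \<le> (\<Sum>i\<in>I. b i)\<^sup>2"
    by (metis abs_ge_zero power2_abs power_mono)
  have "(\<integral>\<^sup>+h. ennreal (((\<Sum>i\<in>I. G i (h i)) - (\<Sum>i\<in>I. t i))\<^sup>2) \<partial>measure_pmf ?M)
      = ennreal (measure_pmf.expectation ?M (\<lambda>h. (S h)\<^sup>2 + 2 * B * S h + B\<^sup>2))"
    unfolding eq using int_all by (intro nn_integral_eq_integral) (auto simp flip: eq)
  also have "measure_pmf.expectation ?M (\<lambda>h. (S h)\<^sup>2 + 2 * B * S h + B\<^sup>2)
      = (\<Sum>i\<in>I. measure_pmf.expectation (D i) (\<lambda>z. (H i z)\<^sup>2)) + B\<^sup>2"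
    using S by simp
  also have "ennreal \<dots> \<le> ennreal ((\<Sum>i\<in>I. v i) + (\<Sum>i\<in>I. b i)\<^sup>2)"
    using B2 var by (intro ennreal_leI add_mono sum_mono) (auto simp: H_def mu_def)
  finally show ?thesis .
qed

lemma prob_not_sqrt_close:
  assumes "n \<ge> 2" "0 \<le> p"
  shows "measure_pmf.prob (Poi (n * p)) {x. \<not> sqrt_close n (real x / n) p} \<le> 2 / n\<^sup>2"
proof -
  have n: "n > 1" using assms by simp
  have ln: "ln n > 0" using n by simp
  have "{x::nat. \<not> sqrt_close n (real x / n) p} = {x. \<bar>sqrt (real x) - sqrt (n * p)\<bar> > sqrt (2 * ln n)}"
  proof (intro Collect_cong)
    fix x :: nat
    have "sqrt (real x / n) - sqrt p = (sqrt (real x) - sqrt (n * p)) / sqrt n"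
      using n by (simp add: real_sqrt_divide real_sqrt_mult field_simps)
    moreover have "sqrt (2 * (ln n / n)) = sqrt (2 * ln n) / sqrt n"
      by (simp only: real_sqrt_divide times_divide_eq_right)
    ultimately show "\<not> sqrt_close n (real x / n) p \<longleftrightarrow> \<bar>sqrt (real x) - sqrt (n * p)\<bar> > sqrt (2 * ln n)"
      using n by (simp add: sqrt_close_def abs_divide divide_le_cancel not_le)
  qed
  also have "measure_pmf.prob (Poi (n * p)) \<dots> \<le> 2 * exp (- (sqrt (2 * ln n))\<^sup>2)"
    using assms n by (intro Poi_sqrt_concentration) auto
  also have "\<dots> = 2 / n\<^sup>2"
  proof -
    have "exp (2 * ln n) = n\<^sup>2" using n by (simp add: exp_double)
    then show ?thesis using ln by (simp add: exp_minus divide_inverse)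
  qed
  finally show ?thesis .
qed

lemma prob_not_sqrt_close2:
  assumes "n \<ge> 2" "0 \<le> p" "0 \<le> q"
  shows "measure_pmf.prob (Poi2 (n * p) (n * q))
    {z. \<not> (sqrt_close n (real (fst z) / n) p \<and> sqrt_close n (real (snd z) / n) q)} \<le> 4 / n\<^sup>2"
proof -
  let ?X = "{x. \<not> sqrt_close n (real x / n) p}" and ?Y = "{y. \<not> sqrt_close n (real y / n) q}"
  let ?M = "Poi2 (n * p) (n * q)"
  have "measure_pmf.prob ?M {z. \<not> (sqrt_close n (real (fst z) / n) p \<and> sqrt_close n (real (snd z) / n) q)}
     = measure_pmf.prob ?M (fst -` ?X \<union> snd -` ?Y)"
    by (rule arg_cong[where f = "measure_pmf.prob ?M"]) auto
  also have "\<dots> \<le> measure_pmf.prob ?M (fst -` ?X) + measure_pmf.prob ?M (snd -` ?Y)"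
    by (rule measure_Un_le) auto
  also have "measure_pmf.prob ?M (fst -` ?X) = measure_pmf.prob (Poi (n * p)) ?X"
    by (subst measure_map_pmf[symmetric]) (simp add: map_fst_pair_pmf)
  also have "measure_pmf.prob ?M (snd -` ?Y) = measure_pmf.prob (Poi (n * q)) ?Y"
    by (subst measure_map_pmf[symmetric]) (simp add: map_snd_pair_pmf)
  also have "measure_pmf.prob (Poi (n * p)) ?X + measure_pmf.prob (Poi (n * q)) ?Y \<le> 4 / n\<^sup>2"
    using prob_not_sqrt_close[OF assms(1,2)] prob_not_sqrt_close[OF assms(1,3)] by simp
  finally show ?thesis .
qed

lemma clip_contraction:
  fixes x t :: real assumes "0 \<le> t" "t \<le> 2"
  shows "\<bar>max 0 (min x 2) - t\<bar> \<le> \<bar>x - t\<bar>" "\<bar>max 0 (min x 2) - t\<bar> \<le> 2"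
  using assms by (auto simp: max_def min_def)

lemma l1_dist_range:
  assumes "P \<in> prob_vectors S" "Q \<in> prob_vectors S"
  shows "0 \<le> l1_dist S P Q" "l1_dist S P Q \<le> 2"
proof -
  show "0 \<le> l1_dist S P Q" by (simp add: l1_dist_def sum_nonneg)
  have "l1_dist S P Q \<le> (\<Sum>i=1..S. P i + Q i)"
    unfolding l1_dist_def using assms by (intro sum_mono) (auto simp: prob_vectors_def abs_le_iff)
  then show "l1_dist S P Q \<le> 2"
    using assms by (simp add: sum.distrib prob_vectors_def)
qed

text \<open>The outer integral runs over the first halves of the samples, the inner one over the second halves.\<close>

lemma nn_integral_sample_pmf:
  fixes F :: "(nat \<times> nat \<Rightarrow> nat) \<Rightarrow> (nat \<times> nat \<Rightarrow> nat) \<Rightarrow> ennreal"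
  defines "D \<equiv> \<lambda>P Q n (i, j). Poi2 (n * P i) (n * Q i)"
  shows "(\<integral>\<^sup>+(X, Y). F X Y \<partial>measure_pmf (sample_pmf S n P Q))
   = (\<integral>\<^sup>+f. \<integral>\<^sup>+g. F (\<lambda>x. fst (if x \<in> {1..S} \<times> {1} then f x else g x)) (\<lambda>x. snd (if x \<in> {1..S} \<times> {1} then f x else g x))
       \<partial>measure_pmf (Pi_pmf ({1..S} \<times> {2}) (0, 0) (D P Q n)) \<partial>measure_pmf (Pi_pmf ({1..S} \<times> {1}) (0, 0) (D P Q n)))"
proof -
  have un: "{1..S} \<times> {1, 2} = {1..S} \<times> {1::nat} \<union> {1..S} \<times> {2}" by auto
  have D: "(\<lambda>i. pair_pmf (case i of (i, j) \<Rightarrow> Poi (n * P i)) (case i of (i, j) \<Rightarrow> Poi (n * Q i))) = D P Q n"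
    by (auto simp: D_def fun_eq_iff)
  have "sample_pmf S n P Q = map_pmf (\<lambda>h. (fst \<circ> h, snd \<circ> h))
     (map_pmf (\<lambda>(f, g) x. if x \<in> {1..S} \<times> {1} then f x else g x)
       (pair_pmf (Pi_pmf ({1..S} \<times> {1}) (0, 0) (D P Q n)) (Pi_pmf ({1..S} \<times> {2}) (0, 0) (D P Q n))))"
    unfolding sample_pmf_def by (subst pair_Pi_pmf) (simp, subst un, subst Pi_pmf_union, auto simp: D)
  then show ?thesis
    by (simp add: nn_integral_pair_pmf' comp_def)
qed

section \<open>The risk of the estimator\<close>

context estimation_setting
begin

text \<open>Fix the first halves. If all first-half frequencies are close to their probabilities, then the
  conditional risk is at most the sum of the variances plus the square of the sum of the biases.
  Otherwise the truncation to \<open>[0, 2]\<close> bounds the loss by \<open>4\<close>, and this happens with probability at most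
  \<open>4 * S / n\<^sup>2\<close>.\<close>

lemma L_hat_risk:
  assumes P: "P \<in> prob_vectors S" and Q: "Q \<in> prob_vectors S"
  shows "(\<integral>\<^sup>+(X, Y). ennreal (\<bar>L_hat 200 1 n K u v R S (freq n X) (freq n Y) - l1_dist S P Q\<bar>\<^sup>2)
      \<partial>measure_pmf (sample_pmf S n P Q))
    \<le> ennreal (16 * real S / n\<^sup>2 + ((\<Sum>i=1..S. var_bound (P i) (Q i)) + (\<Sum>i=1..S. bias_bound (P i) (Q i))\<^sup>2))"
proof -
  let ?I1 = "{1..S} \<times> {1::nat}" and ?I2 = "{1..S} \<times> {2::nat}"
  let ?D = "\<lambda>(i, j::nat). Poi2 (n * P i) (n * Q i)"
  let ?M1 = "Pi_pmf ?I1 (0, 0) ?D" and ?M2 = "Pi_pmf ?I2 (0, 0) ?D"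
  define V where "V = (\<Sum>i=1..S. var_bound (P i) (Q i)) + (\<Sum>i=1..S. bias_bound (P i) (Q i))\<^sup>2"
  define T where "T f i z = symbol_term 200 1 n K u v R (real (fst (f (i, 1::nat))) / n) (real (snd (f (i, 1))) / n)
      (real (fst z) / n) (real (snd z) / n)" for f :: "nat \<times> nat \<Rightarrow> nat \<times> nat" and i and z :: "nat \<times> nat"
  define good where "good i w \<longleftrightarrow> sqrt_close n (real (fst w) / n) (P i) \<and> sqrt_close n (real (snd w) / n) (Q i)"
    for i and w :: "nat \<times> nat"
  define bad where "bad = (\<Union>i\<in>{1..S}. {f :: nat \<times> nat \<Rightarrow> nat \<times> nat. \<not> good i (f (i, 1))})"
  define err where "err f g = ennreal (\<bar>L_hat 200 1 n K u v R S
      (freq n (\<lambda>x. fst (if x \<in> ?I1 then f x else g x))) (freq n (\<lambda>x. snd (if x \<in> ?I1 then f x else g x))) - l1_dist S P Q\<bar>\<^sup>2)"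
    for f g :: "nat \<times> nat \<Rightarrow> nat \<times> nat"
  note L = l1_dist_range[OF P Q]
  have pq: "0 \<le> P i" "0 \<le> Q i" if "i \<in> {1..S}" for i
    using P Q that by (auto simp: prob_vectors_def)
  have n0: "n > 0" using n by simp
  have V0: "V \<ge> 0"
  proof -
    have "0 \<le> var_bound (P i) (Q i)" if "i \<in> {1..S}" for i
      using pq[OF that] n ln_n by (auto simp: var_bound_def intro!: add_nonneg_nonneg mult_nonneg_nonneg divide_nonneg_nonneg)
    then show ?thesis unfolding V_def by (intro add_nonneg_nonneg sum_nonneg) auto
  qed
  have L_tilde: "L_tilde 200 1 n K u v R S
      (freq n (\<lambda>x. fst (if x \<in> ?I1 then f x else g x))) (freq n (\<lambda>x. snd (if x \<in> ?I1 then f x else g x)))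
    = (\<Sum>i=1..S. T f i (g (i, 2)))" for f g
    unfolding L_tilde_def T_def symbol_term_def freq_def by (intro sum.cong refl) simp
  have err_le_4: "err f g \<le> 4" for f g
  proof -
    have "\<bar>L_hat 200 1 n K u v R S (freq n X) (freq n Y) - l1_dist S P Q\<bar>\<^sup>2 \<le> 2\<^sup>2" for X Y
      unfolding L_hat_def using clip_contraction(2)[OF L] by (intro power_mono) auto
    then have "err f g \<le> ennreal (2\<^sup>2)"
      unfolding err_def by (intro ennreal_leI)
    then show ?thesis by simp
  qed
  have err_le: "err f g \<le> ennreal (((\<Sum>i=1..S. T f i (g (i, 2))) - l1_dist S P Q)\<^sup>2)" for f g
  proof -
    have "\<bar>L_hat 200 1 n K u v R S (freq n X) (freq n Y) - l1_dist S P Q\<bar>\<^sup>2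
        \<le> \<bar>L_tilde 200 1 n K u v R S (freq n X) (freq n Y) - l1_dist S P Q\<bar>\<^sup>2" for X Y
      unfolding L_hat_def by (intro power_mono clip_contraction(1)[OF L]) auto
    from ennreal_leI[OF this] show ?thesis unfolding err_def L_tilde[symmetric] by simp
  qed
  have inner_good: "(\<integral>\<^sup>+g. err f g \<partial>measure_pmf ?M2) \<le> ennreal V" if "f \<notin> bad" for f
  proof -
    have good: "good i (f (i, 1))" if "i \<in> {1..S}" for i
      using \<open>f \<notin> bad\<close> that by (auto simp: bad_def)
    have moments: "integrable (measure_pmf (Poi2 (n * P i) (n * Q i))) (T f i)"
      "integrable (measure_pmf (Poi2 (n * P i) (n * Q i))) (\<lambda>z. (T f i z)\<^sup>2)"
      "\<bar>measure_pmf.expectation (Poi2 (n * P i) (n * Q i)) (T f i) - \<bar>P i - Q i\<bar>\<bar> \<le> bias_bound (P i) (Q i)"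
      "measure_pmf.expectation (Poi2 (n * P i) (n * Q i))
        (\<lambda>z. (T f i z - measure_pmf.expectation (Poi2 (n * P i) (n * Q i)) (T f i))\<^sup>2) \<le> var_bound (P i) (Q i)"
      if i: "i \<in> {1..S}" for i
    proof -
      let ?a = "real (fst (f (i, 1))) / n" and ?b = "real (snd (f (i, 1))) / n"
      have nonneg: "0 \<le> ?a" "0 \<le> ?b" "0 \<le> n * P i" "0 \<le> n * Q i" using n0 pq[OF i] by auto
      let ?F = "\<lambda>x y. symbol_term 200 1 n K u v R ?a ?b (real x / n) (real y / n)"
      have growth: "poly_growth ?F" by (rule poly_growth_symbol_term)
      have T: "T f i = (\<lambda>z. ?F (fst z) (snd z))" by (simp add: T_def fun_eq_iff)
      show "integrable (measure_pmf (Poi2 (n * P i) (n * Q i))) (T f i)"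
        unfolding T by (rule poly_growth_integrable[OF growth nonneg(3,4)])
      show "integrable (measure_pmf (Poi2 (n * P i) (n * Q i))) (\<lambda>z. (T f i z)\<^sup>2)"
        unfolding T by (rule poly_growth_integrable[OF poly_growth_power[OF growth] nonneg(3,4)])
      have close: "sqrt_close n ?a (P i)" "sqrt_close n ?b (Q i)"
        using good[OF i] by (auto simp: good_def)
      show "\<bar>measure_pmf.expectation (Poi2 (n * P i) (n * Q i)) (T f i) - \<bar>P i - Q i\<bar>\<bar> \<le> bias_bound (P i) (Q i)"
        "measure_pmf.expectation (Poi2 (n * P i) (n * Q i))
        (\<lambda>z. (T f i z - measure_pmf.expectation (Poi2 (n * P i) (n * Q i)) (T f i))\<^sup>2) \<le> var_bound (P i) (Q i)"
        unfolding T using symbol_term_moments[OF nonneg(1,2) pq[OF i] close] by simp_all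
    qed
    have sum_I2: "(\<Sum>x\<in>?I2. w x) = (\<Sum>i=1..S. w (i, 2))" for w :: "nat \<times> nat \<Rightarrow> real"
      using sum.cartesian_product[of "\<lambda>i j. w (i, j)" "{2}" "{1..S}"] by (simp add: case_prod_beta)
    have "(\<integral>\<^sup>+g. ennreal (((\<Sum>x\<in>?I2. T f (fst x) (g x)) - (\<Sum>x\<in>?I2. \<bar>P (fst x) - Q (fst x)\<bar>))\<^sup>2) \<partial>measure_pmf ?M2)
       \<le> ennreal ((\<Sum>x\<in>?I2. var_bound (P (fst x)) (Q (fst x))) + (\<Sum>x\<in>?I2. bias_bound (P (fst x)) (Q (fst x)))\<^sup>2)"
      by (intro Pi_pmf_bias_variance) (use moments in auto)
    then have "(\<integral>\<^sup>+g. ennreal (((\<Sum>i=1..S. T f i (g (i, 2))) - l1_dist S P Q)\<^sup>2) \<partial>measure_pmf ?M2) \<le> ennreal V"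
      unfolding sum_I2 l1_dist_def V_def by simp
    then show ?thesis
      using nn_integral_mono[of "measure_pmf ?M2" "err f", OF err_le] by (rule order.trans[rotated])
  qed
  have inner_bad: "(\<integral>\<^sup>+g. err f g \<partial>measure_pmf ?M2) \<le> 4" for f
  proof -
    have "(\<integral>\<^sup>+g. err f g \<partial>measure_pmf ?M2) \<le> (\<integral>\<^sup>+g. 4 \<partial>measure_pmf ?M2)"
      by (intro nn_integral_mono err_le_4)
    then show ?thesis by simp
  qed
  have prob_bad: "measure_pmf.prob ?M1 bad \<le> real S * (4 / n\<^sup>2)"
  proof -
    have "measure_pmf.prob ?M1 bad \<le> (\<Sum>i\<in>{1..S}. measure_pmf.prob ?M1 {f. \<not> good i (f (i, 1))})"
      unfolding bad_def by (intro measure_pmf.finite_measure_subadditive_finite) auto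
    also have "\<dots> \<le> (\<Sum>i\<in>{1..S}. 4 / n\<^sup>2)"
    proof (intro sum_mono)
      fix i assume i: "i \<in> {1..S}"
      have comp: "map_pmf (\<lambda>f. f (i, 1)) ?M1 = Poi2 (n * P i) (n * Q i)"
        using i by (simp add: Pi_pmf_component)
      have "measure_pmf.prob ?M1 {f. \<not> good i (f (i, 1))} = measure_pmf.prob (map_pmf (\<lambda>f. f (i, 1)) ?M1) {w. \<not> good i w}"
        by (simp add: vimage_def)
      also have "\<dots> \<le> 4 / n\<^sup>2"
        unfolding comp good_def using prob_not_sqrt_close2[OF n pq[OF i]] .
      finally show "measure_pmf.prob ?M1 {f. \<not> good i (f (i, 1))} \<le> 4 / n\<^sup>2" .
    qed
    finally show ?thesis by simp
  qed
  have "(\<integral>\<^sup>+(X, Y). ennreal (\<bar>L_hat 200 1 n K u v R S (freq n X) (freq n Y) - l1_dist S P Q\<bar>\<^sup>2)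
      \<partial>measure_pmf (sample_pmf S n P Q)) = (\<integral>\<^sup>+f. \<integral>\<^sup>+g. err f g \<partial>measure_pmf ?M2 \<partial>measure_pmf ?M1)"
    unfolding err_def
    by (rule nn_integral_sample_pmf[where F = "\<lambda>X Y. ennreal (\<bar>L_hat 200 1 n K u v R S (freq n X) (freq n Y) - l1_dist S P Q\<bar>\<^sup>2)"])
  also have "\<dots> \<le> (\<integral>\<^sup>+f. 4 * indicator bad f + ennreal V \<partial>measure_pmf ?M1)"
  proof (intro nn_integral_mono)
    fix f show "(\<integral>\<^sup>+g. err f g \<partial>measure_pmf ?M2) \<le> 4 * indicator bad f + ennreal V"
      using inner_good[of f] inner_bad[of f] by (cases "f \<in> bad") (auto intro: add_increasing2)
  qed
  also have "\<dots> = 4 * emeasure (measure_pmf ?M1) bad + ennreal V"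
    by (subst nn_integral_add) (auto simp: nn_integral_cmult)
  also have "\<dots> = ennreal (4 * measure_pmf.prob ?M1 bad + V)"
    using V0 by (simp add: measure_pmf.emeasure_eq_measure ennreal_plus ennreal_mult')
  also have "\<dots> \<le> ennreal (16 * real S / n\<^sup>2 + V)"
    using prob_bad by (intro ennreal_leI) simp
  finally show ?thesis unfolding V_def .
qed

end

lemma ln_power_le:
  assumes "n \<ge> (1::real)" "k > 0"
  shows "ln n \<le> k * n powr (1 / k)"
proof -
  have "ln n = k * ln (n powr (1 / k))" using assms by (simp add: ln_powr)
  also have "\<dots> \<le> k * n powr (1 / k)"
    using assms ln_le_minus_one[of "n powr (1 / k)"] by (intro mult_left_mono) auto
  finally show ?thesis .
qed

context estimation_setting
begin

text \<open>The conditions on \<open>c2\<close> turn the factor \<open>(10 ^ 13) ^ K\<close> of the variance bounds into a small power of \<open>n\<close>. In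
  the small regime the variances add up to \<open>S * (ln n / n)\<^sup>2\<close> times this power, where the exponent \<open>1 / 4\<close>
  suffices. In the close regime they add up to \<open>ln n / n\<close> times this power, without a factor \<open>S\<close>, and
  this is where \<open>ln n \<le> C * ln S\<close>, that is \<open>n powr (1 / C) \<le> S\<close>, is used. The biases add up to the order of
  \<open>sqrt (S / (n * ln n))\<close> by the Cauchy-Schwarz inequality.\<close>

lemma risk_bound_rate:
  fixes C :: real and S :: nat
  assumes C: "C > 0" "ln n \<le> C * ln (real S)" and c2_small: "c2 * ln ((10::real) ^ 13) \<le> 1 / 4" "c2 * ln ((10::real) ^ 13) \<le> 1 / (2 * C)"
    and S: "real S \<le> n * ln n" "S \<ge> 1" and P: "P \<in> prob_vectors S" and Q: "Q \<in> prob_vectors S"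
  shows "16 * real S / n\<^sup>2 + ((\<Sum>i=1..S. var_bound (P i) (Q i)) + (\<Sum>i=1..S. bias_bound (P i) (Q i))\<^sup>2)
    \<le> (16 + 2 * C + 1024 * 10 ^ 8 + 128000 * 16 * C\<^sup>2 + 4 * (720 / c2)\<^sup>2 + 2 * (115200 / c2\<^sup>2)\<^sup>2) * (real S / (n * ln n))"
proof -
  define X where "X = real S / (n * ln n)"
  define D where "D = ((10::real) ^ 13) ^ K"
  have n0: "n > 0" "n \<ge> 1" using n by auto
  have nl: "n * ln n > 0" using n0 ln_n by simp
  have X0: "X \<ge> 0" "X \<le> 1" using nl S by (auto simp: X_def)
  have sumP: "(\<Sum>i=1..S. P i + Q i) = 2" using P Q by (simp add: prob_vectors_def sum.distrib)
  have pq: "0 \<le> P i + Q i" if "i \<in> {1..S}" for i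
    using P Q that by (auto simp: prob_vectors_def)
  have D_le: "D \<le> n powr (c2 * ln ((10::real) ^ 13))"
  proof -
    have "D = exp (real K * ln ((10::real) ^ 13))"
      unfolding D_def by (simp add: exp_of_nat_mult)
    also have "\<dots> \<le> exp (c2 * ln n * ln ((10::real) ^ 13))"
      using K by (intro iffD2[OF exp_le_cancel_iff] mult_right_mono) auto
    also have "\<dots> = n powr (c2 * ln ((10::real) ^ 13))"
      using n0 by (simp add: powr_def mult_ac)
    finally show ?thesis .
  qed
  have D0: "D \<ge> 0" by (simp add: D_def)
  have D1: "D \<le> n powr (1 / 4)"
    using D_le powr_mono[OF c2_small(1) n0(2)] by linarith
  have D2: "D \<le> n powr (1 / (2 * C))"
    using D_le powr_mono[OF c2_small(2) n0(2)] by linarith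
  \<comment> \<open>The contribution of atypical first halves.\<close>
  have t1: "16 * real S / n\<^sup>2 \<le> 16 * X"
  proof -
    have "ln n \<le> n" using n0 ln_le_minus_one[of n] by linarith
    then have "n * ln n \<le> n\<^sup>2" using n0 by (simp add: power2_eq_square)
    then have "16 * real S / n\<^sup>2 \<le> 16 * real S / (n * ln n)"
      using nl n ln_n by (intro divide_left_mono mult_pos_pos) auto
    then show ?thesis by (simp add: X_def)
  qed
  \<comment> \<open>The variances of the frequencies themselves.\<close>
  have t2: "2 / n \<le> 2 * C * X"
  proof -
    have "ln n \<le> C * real S"
      using C mult_left_mono[of "ln (real S)" "real S" C] ln_le_minus_one[of "real S"] S by linarith
    then show ?thesis using n0 ln_n by (simp add: X_def field_simps)
  qed
  \<comment> \<open>The variances in the small regime.\<close>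
  have t3: "real S * (16 * 10 ^ 8 * (ln n / n)\<^sup>2) * D \<le> 1024 * 10 ^ 8 * X"
  proof -
    have ln4: "ln n \<le> 4 * n powr (1 / 4)" using ln_power_le[of n 4] n0 by simp
    have "ln n * ln n * ln n * D
        \<le> (4 * n powr (1 / 4)) * (4 * n powr (1 / 4)) * (4 * n powr (1 / 4)) * n powr (1 / 4)"
      using ln4 D1 D0 ln_n by (intro mult_mono mult_nonneg_nonneg) auto
    also have "\<dots> = 64 * n powr (1 / 4 + 1 / 4 + 1 / 4 + 1 / 4)"
      unfolding powr_add by simp
    also have "\<dots> = 64 * n" using n0 by simp
    finally have le: "ln n * ln n * ln n * D \<le> 64 * n" .
    have "real S * (16 * 10 ^ 8 * (ln n / n)\<^sup>2) * D = 16 * 10 ^ 8 * X * ((ln n * ln n * ln n * D) / n)"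
      using n0 ln_n by (simp add: X_def power2_eq_square field_simps)
    also have "\<dots> \<le> 16 * 10 ^ 8 * X * 64"
      using le n0 X0 by (intro mult_left_mono) (auto simp: field_simps)
    finally show ?thesis by simp
  qed
  \<comment> \<open>The variances in the close regime.\<close>
  have t4: "128000 * (ln n / n) * D \<le> 128000 * 16 * C\<^sup>2 * X"
  proof -
    have ln4: "ln n \<le> (4 * C) * n powr (1 / (4 * C))" using ln_power_le[of n "4 * C"] n0 C by simp
    have "ln n * ln n * D \<le> ((4 * C) * n powr (1 / (4 * C))) * ((4 * C) * n powr (1 / (4 * C))) * n powr (1 / (2 * C))"
      using ln4 D2 D0 ln_n C by (intro mult_mono mult_nonneg_nonneg) auto
    also have "\<dots> = 16 * C\<^sup>2 * n powr (1 / (4 * C) + 1 / (4 * C) + 1 / (2 * C))"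
      unfolding powr_add by (simp add: power2_eq_square)
    also have "1 / (4 * C) + 1 / (4 * C) + 1 / (2 * C) = 1 / C" using C by (simp add: field_simps)
    also have "n powr (1 / C) \<le> real S"
    proof -
      have "ln n / C \<le> ln (real S)" using C by (simp add: field_simps)
      then have "exp (ln n / C) \<le> exp (ln (real S))" by simp
      then show ?thesis using S n0 by (simp add: powr_def)
    qed
    finally have le: "ln n * ln n * D \<le> 16 * C\<^sup>2 * real S" by (simp add: mult_left_mono)
    have "128000 * (ln n / n) * D = 128000 * ((ln n * ln n * D) / (n * ln n))"
      using n0 ln_n by (simp add: field_simps)
    also have "\<dots> \<le> 128000 * ((16 * C\<^sup>2 * real S) / (n * ln n))"
      using le nl by (intro mult_left_mono divide_right_mono) auto
    finally show ?thesis by (simp add: X_def)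
  qed
  have var: "(\<Sum>i=1..S. var_bound (P i) (Q i)) = 2 / n + real S * (16 * 10 ^ 8 * (ln n / n)\<^sup>2) * D + 128000 * (ln n / n) * D"
  proof -
    let ?w = "1 / n + 64000 * (ln n / n) * D" and ?c = "16 * 10 ^ 8 * (ln n / n)\<^sup>2 * D"
    have "var_bound (P i) (Q i) = ?w * (P i + Q i) + ?c" for i
      by (simp add: var_bound_def D_def algebra_simps add_divide_distrib)
    then have "(\<Sum>i=1..S. var_bound (P i) (Q i)) = ?w * (\<Sum>i=1..S. P i + Q i) + real S * ?c"
      by (simp only: sum.distrib[of "\<lambda>i. ?w * (P i + Q i)" "\<lambda>_. ?c"] sum_distrib_left[symmetric] sum_constant card_atLeastAtMost)
        simp
    then show ?thesis unfolding sumP by (simp add: algebra_simps)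
  qed
  have bias: "(\<Sum>i=1..S. bias_bound (P i) (Q i))\<^sup>2 \<le> (4 * (720 / c2)\<^sup>2 + 2 * (115200 / c2\<^sup>2)\<^sup>2) * X"
  proof -
    define s where "s = (\<Sum>i=1..S. sqrt ((P i + Q i) / (n * ln n)))"
    have "s\<^sup>2 = (\<Sum>i=1..S. 1 * sqrt ((P i + Q i) / (n * ln n)))\<^sup>2" by (simp add: s_def)
    also have "\<dots> \<le> (\<Sum>i=1..S. 1\<^sup>2) * (\<Sum>i=1..S. (sqrt ((P i + Q i) / (n * ln n)))\<^sup>2)"
      by (rule Cauchy_Schwarz_ineq_sum)
    also have "(\<Sum>i=1..S. (sqrt ((P i + Q i) / (n * ln n)))\<^sup>2) = (\<Sum>i=1..S. (P i + Q i) / (n * ln n))"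
      using pq nl by (intro sum.cong refl real_sqrt_pow2 divide_nonneg_nonneg) auto
    also have "\<dots> = 2 / (n * ln n)" by (simp only: sum_divide_distrib[symmetric] sumP)
    finally have s2: "s\<^sup>2 \<le> 2 * X" by (simp add: X_def mult.commute)
    have "(\<Sum>i=1..S. bias_bound (P i) (Q i)) = 720 / c2 * s + 115200 / c2\<^sup>2 * X"
      by (simp add: bias_bound_def s_def sum.distrib sum_distrib_left X_def)
    then have "(\<Sum>i=1..S. bias_bound (P i) (Q i))\<^sup>2 \<le> 2 * (720 / c2 * s)\<^sup>2 + 2 * (115200 / c2\<^sup>2 * X)\<^sup>2"
      using zero_le_power2[of "720 / c2 * s - 115200 / c2\<^sup>2 * X"] by (simp only: power2_sum power2_diff)
    also have "(720 / c2 * s)\<^sup>2 \<le> (720 / c2)\<^sup>2 * (2 * X)"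
      unfolding power_mult_distrib using s2 by (intro mult_left_mono) auto
    also have "(115200 / c2\<^sup>2 * X)\<^sup>2 \<le> (115200 / c2\<^sup>2)\<^sup>2 * X"
      unfolding power_mult_distrib using X0 by (intro mult_left_mono) (auto simp: power2_eq_square mult_left_le)
    finally show ?thesis by (simp add: distrib_right)
  qed
  show ?thesis
    using t1 t2 t3 t4 bias unfolding var X_def[symmetric] distrib_right by linarith
qed

end

theorem theorem6:
  fixes C :: real
  assumes "C > 0"
  shows "\<exists>c1 c2 c3 A :: real.
    c1 > c3 \<and> c3 > c2 \<and> c2 > 0 \<and> c3 / c1 < 8 / (sqrt 2 + 1)\<^sup>2 - 1 \<and> A > 0 \<and>
    (\<forall>(S :: nat) (n :: real) (u :: real poly poly) (v :: real poly poly) (R :: real poly).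
      n \<ge> 2 \<longrightarrow> ln n \<le> C * ln (real S) \<longrightarrow>
      best_approx2 (deg_bound c2 n) (\<lambda>x y. sqrt x + sqrt y) u \<longrightarrow>
      best_approx2 (deg_bound c2 n) (\<lambda>x y. \<bar>sqrt x - sqrt y\<bar>) v \<longrightarrow>
      best_approx1 (deg_bound c2 n) (\<lambda>t. \<bar>t\<bar>) R \<longrightarrow>
      (SUP (P, Q)\<in>prob_vectors S \<times> prob_vectors S.
         \<integral>\<^sup>+ (X, Y). ennreal
           (\<bar>L_hat c1 c3 n (deg_bound c2 n) u v R S (freq n X) (freq n Y) - l1_dist S P Q\<bar>\<^sup>2)
           \<partial>measure_pmf (sample_pmf S n P Q))
      \<le> ennreal (A * (real S / (n * ln n))))"
proof -
  \<comment> \<open>The base \<open>10 ^ 13\<close> collects the exponential factors in the variance bounds of both polynomial estimators.\<close>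
  define lD where "lD = ln ((10::real) ^ 13)"
  have lD: "lD > 0" by (simp add: lD_def)
  define c2 where "c2 = min (1 / 2) (min (1 / (4 * lD)) (1 / (2 * C * lD)))"
  have c2: "0 < c2" "c2 < 1" using lD assms by (auto simp: c2_def)
  have c2_small: "c2 * lD \<le> 1 / 4" "c2 * lD \<le> 1 / (2 * C)"
  proof -
    have "c2 * lD \<le> 1 / (4 * lD) * lD" "c2 * lD \<le> 1 / (2 * C * lD) * lD"
      using lD by (intro mult_right_mono; simp add: c2_def)+
    then show "c2 * lD \<le> 1 / 4" "c2 * lD \<le> 1 / (2 * C)" using lD by simp_all
  qed
  define A1 where "A1 = 16 + 2 * C + 1024 * 10 ^ 8 + 128000 * 16 * C\<^sup>2 + 4 * (720 / c2)\<^sup>2 + 2 * (115200 / c2\<^sup>2)\<^sup>2"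
  \<comment> \<open>The second summand covers the bounded range of \<open>n\<close> in which the degree is \<open>0\<close>.\<close>
  define A where "A = A1 + 4 * (exp (1 / c2) / c2)"
  have A1: "A1 \<ge> 4"
    using assms by (simp add: A1_def add_increasing2)
  have "exp (1 / c2) / c2 \<ge> 0" using c2 by simp
  then have A: "A \<ge> A1" "A \<ge> 4 * (exp (1 / c2) / c2)" "A \<ge> 4" "A > 0"
    using A1 unfolding A_def by linarith+
  have ratio: "1 / 200 < 8 / (sqrt 2 + 1)\<^sup>2 - (1::real)"
  proof -
    have pos: "0 < sqrt 2 + (1::real)" by (intro add_pos_pos) simp_all
    have "sqrt 2 < (3/2::real)" by (rule real_less_lsqrt) (auto simp: power2_eq_square)
    then have "(sqrt 2 + 1)\<^sup>2 < (5/2::real)\<^sup>2" by (intro power_strict_mono) auto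
    then have "8 / (5/2)\<^sup>2 < 8 / (sqrt 2 + (1::real))\<^sup>2"
      using pos by (intro divide_strict_left_mono mult_pos_pos zero_less_power) simp_all
    then show ?thesis by (simp add: power2_eq_square)
  qed
  have main: "(\<integral>\<^sup>+ (X, Y). ennreal
           (\<bar>L_hat 200 1 n (deg_bound c2 n) u v R S (freq n X) (freq n Y) - l1_dist S P Q\<bar>\<^sup>2)
           \<partial>measure_pmf (sample_pmf S n P Q)) \<le> ennreal (A * (real S / (n * ln n)))"
    if n: "n \<ge> 2" and nS: "ln n \<le> C * ln (real S)"
      and u: "best_approx2 (deg_bound c2 n) (\<lambda>x y. sqrt x + sqrt y) u"
      and v: "best_approx2 (deg_bound c2 n) (\<lambda>x y. \<bar>sqrt x - sqrt y\<bar>) v"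
      and R: "best_approx1 (deg_bound c2 n) (\<lambda>t. \<bar>t\<bar>) R"
      and P: "P \<in> prob_vectors S" and Q: "Q \<in> prob_vectors S" for S n u v R P Q
  proof -
    let ?K = "deg_bound c2 n"
    have ln_n: "ln n > 0" using n by simp
    then have "ln (real S) > 0" using nS assms by (smt (verit) mult_nonneg_nonpos)
    then have S: "S \<ge> 1" by (cases S) auto
    \<comment> \<open>The loss is never larger than \<open>4\<close>.\<close>
    have trivial: ?thesis if "4 \<le> A * (real S / (n * ln n))"
    proof -
      have "\<bar>L_hat 200 1 n ?K u v R S (freq n X) (freq n Y) - l1_dist S P Q\<bar>\<^sup>2 \<le> 2\<^sup>2" for X Y
        unfolding L_hat_def using clip_contraction(2)[OF l1_dist_range[OF P Q]] by (intro power_mono) auto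
      then have "\<bar>L_hat 200 1 n ?K u v R S (freq n X) (freq n Y) - l1_dist S P Q\<bar>\<^sup>2 \<le> A * (real S / (n * ln n))" for X Y
        by (rule order.trans) (use that in simp)
      then have "(\<integral>\<^sup>+ (X, Y). ennreal
           (\<bar>L_hat 200 1 n ?K u v R S (freq n X) (freq n Y) - l1_dist S P Q\<bar>\<^sup>2)
           \<partial>measure_pmf (sample_pmf S n P Q)) \<le> (\<integral>\<^sup>+ z. ennreal (A * (real S / (n * ln n))) \<partial>measure_pmf (sample_pmf S n P Q))"
        by (intro nn_integral_mono) (auto intro!: ennreal_leI)
      then show ?thesis by simp
    qed
    show ?thesis
    proof (cases "c2 * ln n < 1 \<or> real S > n * ln n")
      case True
      then show ?thesis
      proof
        assume "real S > n * ln n"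
        then have "real S / (n * ln n) \<ge> 1" using n ln_n by simp
        then have "4 * 1 \<le> A * (real S / (n * ln n))" using A by (intro mult_mono) auto
        then show ?thesis using trivial by simp
      next
        assume small: "c2 * ln n < 1"
        then have l: "ln n \<le> 1 / c2" using c2 by (simp add: field_simps)
        then have "n \<le> exp (1 / c2)" using n by (metis exp_le_cancel_iff exp_ln less_le_trans zero_less_numeral)
        then have "n * ln n \<le> exp (1 / c2) * (1 / c2)" using l n ln_n by (intro mult_mono) auto
        then have "1 / (exp (1 / c2) / c2) \<le> real S / (n * ln n)"
          using S n ln_n c2 by (intro frac_le) auto
        then have "4 * (exp (1 / c2) / c2) * (1 / (exp (1 / c2) / c2)) \<le> A * (real S / (n * ln n))"
          using A c2 by (intro mult_mono) auto
        then show ?thesis using trivial c2 by simp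
      qed
    next
      case False
      then have x: "c2 * ln n \<ge> 1" "real S \<le> n * ln n" by auto
      have K: "?K \<ge> 1" "real ?K \<le> c2 * ln n" "c2 * ln n \<le> 2 * real ?K"
      proof -
        have fl: "\<lfloor>c2 * ln n\<rfloor> \<ge> 1" using x(1) by linarith
        then have "real ?K = of_int \<lfloor>c2 * ln n\<rfloor>" by (simp add: deg_bound_def)
        then show "?K \<ge> 1" "real ?K \<le> c2 * ln n" "c2 * ln n \<le> 2 * real ?K"
          using fl by linarith+
      qed
      interpret estimation_setting n c2 ?K u v R
        using n c2 K u v R by unfold_locales auto
      have "16 * real S / n\<^sup>2 + ((\<Sum>i=1..S. var_bound (P i) (Q i)) + (\<Sum>i=1..S. bias_bound (P i) (Q i))\<^sup>2)
          \<le> A1 * (real S / (n * ln n))"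
        unfolding A1_def using risk_bound_rate[OF assms nS c2_small[unfolded lD_def] x(2) S P Q] .
      also have "\<dots> \<le> A * (real S / (n * ln n))"
        using A n ln_n by (intro mult_right_mono) auto
      finally show ?thesis
        using L_hat_risk[OF P Q] by (meson ennreal_leI order.trans)
    qed
  qed
  show ?thesis
    using c2 A ratio main
    by (intro exI[of _ 200] exI[of _ c2] exI[of _ 1] exI[of _ A]) (auto intro!: SUP_least)
qed

end
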